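(* Let $\chi$ be an odd primitive Dirichlet character (i.e. $\chi(-1)=-1$) with conductor $q\geq 23$. Then the following are equivalent: (i) $L(s,\chi)\neq 0$ for all $s$ with $0<\operatorname{Re}(s)<1/2$; (ii) $L'(s,\chi)$ has no zeros in $0<\operatorname{Re}(s)<1/2$.
   Context: $L(s,\chi)$ is the Dirichlet $L$-function of $\chi$ and $L'(s,\chi)$ its derivative in $s$. *)

theory Defs
  imports "HOL-Complex_Analysis.Complex_Analysis"
begin

text \<open>
  Dirichlet characters modulo \<open>q\<close> are taken as functions on the integers, extended by
  zero to the integers not coprime to \<open>q\<close>.
\<close>

definition dirichlet_character :: "nat \<Rightarrow> (int \<Rightarrow> complex) \<Rightarrow> bool" where
  "dirichlet_character q chi \<longleftrightarrow>
     q > 0 \<and>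
     (\<forall>a b. chi (a * b) = chi a * chi b) \<and>
     (\<forall>a. chi (a + int q) = chi a) \<and>
     (\<forall>a. chi a \<noteq> 0 \<longleftrightarrow> coprime a (int q))"

definition induced_from :: "nat \<Rightarrow> (int \<Rightarrow> complex) \<Rightarrow> nat \<Rightarrow> bool" where
  "induced_from q chi d \<longleftrightarrow>
     d dvd q \<and> (\<exists>\<psi>. dirichlet_character d \<psi> \<and> (\<forall>a. coprime a (int q) \<longrightarrow> chi a = \<psi> a))"

definition conductor :: "nat \<Rightarrow> (int \<Rightarrow> complex) \<Rightarrow> nat" where
  "conductor q chi = (LEAST d. induced_from q chi d)"

definition primitive_character :: "nat \<Rightarrow> (int \<Rightarrow> complex) \<Rightarrow> bool" where
  "primitive_character q chi \<longleftrightarrow> dirichlet_character q chi \<and> conductor q chi = q"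

definition odd_character :: "(int \<Rightarrow> complex) \<Rightarrow> bool" where
  "odd_character chi \<longleftrightarrow> chi (-1) = -1"

definition dirichlet_series :: "(int \<Rightarrow> complex) \<Rightarrow> complex \<Rightarrow> complex" where
  "dirichlet_series chi s = (\<Sum>n. chi (int (Suc n)) / of_nat (Suc n) powr s)"

text \<open>
  The \<open>L\<close>-function is the meromorphic continuation to the whole plane of the series, which
  converges absolutely for \<open>Re s > 1\<close>.  A function that is nicely meromorphic is analytic
  away from its poles and takes the value 0 at the poles (here: only at \<open>s = 1\<close>, and only for
  a principal character), so the continuation is unique as a total function.
\<close>

definition dirichlet_L :: "(int \<Rightarrow> complex) \<Rightarrow> complex \<Rightarrow> complex" where
  "dirichlet_L chi =
     (THE f. f nicely_meromorphic_on UNIV \<and> (\<forall>s. Re s > 1 \<longrightarrow> f s = dirichlet_series chi s))"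

lemma nicely_meromorphic_eqI:
  assumes f: "f nicely_meromorphic_on UNIV" and g: "g nicely_meromorphic_on UNIV"
    and eq: "\<And>s. Re s > 1 \<Longrightarrow> f s = g s"
  shows "f = g"
proof
  fix z :: complex
  define h where "h = remove_sings (\<lambda>s. f s - g s)"
  have merof: "f meromorphic_on UNIV" and merog: "g meromorphic_on UNIV"
    using f g by (auto simp: nicely_meromorphic_on_def)
  have mero: "(\<lambda>s. f s - g s) meromorphic_on UNIV"
    by (intro meromorphic_intros merof merog)
  have h: "h nicely_meromorphic_on UNIV"
    unfolding h_def by (rule remove_sings_nicely_meromorphic[OF mero])
  have hev: "eventually (\<lambda>s. h s = f s - g s) (at w)" for w
    unfolding h_def
    by (rule eventually_remove_sings_eq_at)
       (rule meromorphic_on_isolated_singularity[OF meromorphic_on_subset[OF mero subset_UNIV]])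
  have "eventually (\<lambda>s::complex. Re s > 1) (at 2)"
    using eventually_at_in_open'[OF open_halfspace_Re_gt[of 1], of 2] by simp
  with hev[of 2] have "eventually (\<lambda>s. h s = 0) (at 2)"
    by eventually_elim (use eq in auto)
  hence "frequently (\<lambda>s. h s = 0) (at 2)"
    by (intro eventually_frequently) auto
  hence h0: "h w = 0" for w
    by (rule frequently_eq_meromorphic_imp_constant[OF _ h]) auto
  have ev: "eventually (\<lambda>s. f s = g s) (at z)"
    using hev[of z] by eventually_elim (simp add: h0)
  have poles: "is_pole f z \<longleftrightarrow> is_pole g z"
    unfolding is_pole_def by (rule filterlim_cong[OF refl refl ev])
  show "f z = g z"
  proof (cases "is_pole f z")
    case True
    moreover have "\<not> (f \<midarrow>z\<rightarrow> f z)" "\<not> (g \<midarrow>z\<rightarrow> g z)"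
      using True poles not_tendsto_and_filterlim_at_infinity[of "at z"]
      unfolding is_pole_def by auto
    ultimately have "f z = 0" "g z = 0"
      using f g unfolding nicely_meromorphic_on_def by blast+
    thus ?thesis by simp
  next
    case False
    hence "f \<midarrow>z\<rightarrow> f z" "g \<midarrow>z\<rightarrow> g z"
      using f g poles by (auto simp: nicely_meromorphic_on_def)
    moreover from this(1) have "g \<midarrow>z\<rightarrow> f z"
      by (simp add: tendsto_cong[OF ev])
    ultimately show ?thesis
      by (metis LIM_unique)
  qed
qed

lemma dirichlet_L_eqI:
  assumes "f nicely_meromorphic_on UNIV" "\<And>s. Re s > 1 \<Longrightarrow> f s = dirichlet_series chi s"
  shows "dirichlet_L chi = f"
  unfolding dirichlet_L_def
proof (rule the_equality)
  show "f nicely_meromorphic_on UNIV \<and> (\<forall>s. Re s > 1 \<longrightarrow> f s = dirichlet_series chi s)"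
    using assms by blast
next
  fix g assume "g nicely_meromorphic_on UNIV \<and> (\<forall>s. Re s > 1 \<longrightarrow> g s = dirichlet_series chi s)"
  with assms show "g = f"
    by (intro nicely_meromorphic_eqI) simp_all
qed

lemma dirichlet_L_entire_eqI:
  assumes "f holomorphic_on UNIV" "\<And>s. Re s > 1 \<Longrightarrow> f s = dirichlet_series chi s"
  shows "dirichlet_L chi = f"
  using assms
  by (intro dirichlet_L_eqI analytic_on_imp_nicely_meromorphic_on) (auto simp: analytic_on_open)

end

theory Submission
  imports Defs "HOL-Real_Asymp.Real_Asymp" "HOL-Number_Theory.Number_Theory"
begin

text \<open>
  Let \<open>\<xi>(s) = (q / \<pi>)\<^bsup>(s + 1) / 2\<^esup> \<Gamma>((s + 1) / 2) L(s, \<chi>)\<close> be the completed function.  If all zeros of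
  \<open>\<xi>\<close> lie in the closed strip between the vertical lines through \<open>s\<close> and its mirror image
  \<open>1 - cnj s\<close>, where \<open>Re s \<le> 1/2\<close>, then every term \<open>1 / (s - \<rho>)\<close> has nonpositive real part at \<open>s\<close>
  and nonnegative real part at the mirror image, so \<open>Re (\<xi>'/\<xi>)\<close> increases from \<open>s\<close> to \<open>1 - cnj s\<close>; as
  the functional equation makes the two values opposite, \<open>Re (\<xi>'/\<xi>)(s) \<le> 0\<close>.  Since
  \<open>ln (q / \<pi>) + \<psi>(1/2) > 0\<close> for \<open>q \<ge> 23\<close>, where \<open>\<psi>\<close> is the digamma function, \<open>Re (L'/L)(s)\<close> is then
  bounded above by a negative constant.

  If \<open>L\<close> has no zeros in the left half of the critical strip, all zeros of \<open>\<xi>\<close> lie on the critical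
  line and this applies to every point of the left half, so \<open>L' \<noteq> 0\<close> there.  Unconditionally the bound holds
  for \<open>Re s = 0\<close>, as the zeros lie in the critical strip, and for \<open>Re s = 1/2\<close>, where \<open>s\<close> is its own
  mirror image.  If \<open>L' \<noteq> 0\<close> between these lines, \<open>L / L'\<close> is holomorphic there and of finite order; by
  Phragmen-Lindelof its real part stays nonpositive, so a zero of \<open>L\<close> would contradict the maximum principle.
\<close>

subsection \<open>Factorisation of entire functions on discs\<close>

text \<open>The constant 23 is the first integer above \<open>4 * pi * exp euler_mascheroni\<close>,
  about 22.38, the value of \<open>q\<close> at which \<open>ln (q / pi) + Digamma (1/2)\<close>
  changes sign. Statement (i) says nothing about the lines Re s = 0 and Re s = 1, and a zero of
  \<xi> there would spoil the sign argument inside the strip; this is why L must be shown not to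
  vanish on Re s = 1, including the point 1 for real characters. In the other direction the obstacle
  is that L / L' is known to be of moderate size only on horizontal segments staying away from the
  zeros of L', so Phragmen-Lindelof is needed in a form that asks for growth along a sequence of
  heights only. Growth is measured with the exponent 3/2, a convenient number strictly between 1 and
  2: it absorbs the logarithm in the growth of Gamma, yet on large discs the second derivative of
  the zero-free factor still tends to 0, which replaces a product over all zeros. The functional
  equation comes from Mellin transforms of the partial fractions of the cotangent, taken at real
  arguments between 0 and 1, and spreads by the identity theorem.\<close>

lemma Borel_Caratheodory:
  assumes holh: "h holomorphic_on ball 0 R" and h0: "h 0 = 0"
    and Re_le: "\<And>z. z \<in> ball 0 R \<Longrightarrow> Re (h z) < A" and A: "A > 0" and z: "norm z < R"
  shows "norm (h z) \<le> 2 * A * norm z / (R - norm z)"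
proof -
  have R: "R > 0"
    using z norm_ge_zero[of z] by linarith
  \<comment> \<open>The map \<open>w / (2 * A - w)\<close> sends the half-plane
    \<open>Re w < A\<close> into the unit disc and fixes 0, so the Schwarz lemma applies after
    rescaling the radius to 1.\<close>
  define \<phi> where "\<phi> = (\<lambda>u. h (of_real R * u) / (2 * of_real A - h (of_real R * u)))"
  have in_ball: "of_real R * u \<in> ball 0 R" if "norm u < 1" for u :: complex
    using that R by (simp add: norm_mult)
  have den: "2 * of_real A - h (of_real R * u) \<noteq> 0" if "norm u < 1" for u
  proof
    assume "2 * of_real A - h (of_real R * u) = 0"
    hence "Re (h (of_real R * u)) = 2 * A"
      by (simp add: complex_eq_iff)
    thus False
      using Re_le[OF in_ball[OF that]] A by simp
  qed
  have hol: "\<phi> holomorphic_on ball 0 1"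
    unfolding \<phi>_def
  proof (intro holomorphic_intros)
    show "(\<lambda>x. h (complex_of_real R * x)) holomorphic_on ball 0 1"
      by (rule holomorphic_on_compose_gen[of "\<lambda>x. of_real R * x" _ h "ball 0 R", unfolded o_def])
         (use in_ball holh in \<open>auto intro!: holomorphic_intros\<close>)
    thus "(\<lambda>x. h (complex_of_real R * x)) holomorphic_on ball 0 1" .
  qed (use den in auto)
  have lt1: "norm (\<phi> u) < 1" if "norm u < 1" for u
  proof -
    define w where "w = h (of_real R * u)"
    have w: "Re w < A"
      using Re_le[OF in_ball[OF that]] by (simp add: w_def)
    have "(Re w)\<^sup>2 < (2 * A - Re w)\<^sup>2"
      using mult_pos_pos[OF A, of "A - Re w"] w A by (simp add: power2_eq_square algebra_simps)
    hence "(norm w)\<^sup>2 < (norm (2 * of_real A - w))\<^sup>2"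
      by (simp add: cmod_power2)
    hence "norm w < norm (2 * of_real A - w)"
      by (rule power2_less_imp_less) simp
    thus ?thesis
      using den[OF that] by (simp add: \<phi>_def w_def[symmetric] norm_divide)
  qed
  define u where "u = z / of_real R"
  have u: "norm u < 1"
    using z R by (simp add: u_def norm_divide)
  have "norm (\<phi> u) \<le> norm u"
    by (rule Schwarz_Lemma(1)[OF hol _ _ u]) (use lt1 h0 in \<open>auto simp: \<phi>_def\<close>)
  moreover have "\<phi> u = h z / (2 * of_real A - h z)"
    using R by (simp add: \<phi>_def u_def)
  moreover have "2 * of_real A - h z \<noteq> 0"
    using den[OF u] R by (simp add: u_def)
  ultimately have "norm (h z) / norm (2 * of_real A - h z) \<le> norm z / R"
    and "norm (2 * of_real A - h z) > 0"
    using R by (simp_all add: norm_divide u_def)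
  hence "norm (h z) \<le> norm z / R * norm (2 * of_real A - h z)"
    by (simp only: pos_divide_le_eq)
  also have "\<dots> \<le> norm z / R * (2 * A + norm (h z))"
    using R norm_triangle_ineq4[of "2 * of_real A" "h z"] A by (intro mult_left_mono) auto
  finally have "norm (h z) * (R - norm z) \<le> 2 * A * norm z"
    using R by (simp add: field_simps)
  thus ?thesis
    using z by (simp add: field_simps)
qed

text \<open>The order of vanishing is finite because \<open>f\<close> is not identically zero. The
  case \<open>k = 0\<close> is included, so points can be stripped off one after another without
  deciding which are zeros.\<close>

lemma holomorphic_UNIV_factor_zero:
  assumes f: "f holomorphic_on UNIV" and nz: "f w \<noteq> 0"
  obtains g k where "g holomorphic_on UNIV" "g a \<noteq> 0" "\<And>z. f z = (z - a) ^ k * g z"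
proof (cases "f a = 0")
  case False
  thus ?thesis
    using that[of f 0] f by simp
next
  case True
  have "\<exists>g k. g holomorphic_on UNIV \<and> g a \<noteq> 0 \<and> (\<forall>z. f z = (z - a) ^ k * g z)"
  proof -
    have nc: "\<not> f constant_on UNIV"
      using True nz unfolding constant_on_def by force
    obtain g r n where n: "0 < n" and r: "0 < r" and g: "g holomorphic_on ball a r"
      and fg: "\<And>z. z \<in> ball a r \<Longrightarrow> f z = (z - a) ^ n * g z"
      and g0: "\<And>z. z \<in> ball a r \<Longrightarrow> g z \<noteq> 0"
      by (rule holomorphic_factor_zero_nonconstant[OF f open_UNIV connected_UNIV UNIV_I True nc]) metis
    \<comment> \<open>The quotient is holomorphic away from \<open>a\<close> and agrees near
      \<open>a\<close> with the local factor \<open>g\<close>, so filling in the value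
      \<open>g a\<close> makes it entire.\<close>
    define G where "G = (\<lambda>z. if z = a then g a else f z / (z - a) ^ n)"
    have "G z = g z" if "z \<in> ball a r" for z
      using fg[OF that] by (auto simp: G_def)
    hence 1: "G holomorphic_on ball a r"
      using holomorphic_cong[of "ball a r" "ball a r" G g] g by blast
    have "(\<lambda>z. f z / (z - a) ^ n) holomorphic_on (- {a})"
      by (intro holomorphic_intros holomorphic_on_subset[OF f]) auto
    hence 2: "G holomorphic_on (- {a})"
      by (rule holomorphic_transform) (auto simp: G_def)
    have "G holomorphic_on (ball a r \<union> - {a})"
      using 1 2 by (intro holomorphic_on_Un) auto
    moreover have "ball a r \<union> - {a} = UNIV"
      using r by auto
    ultimately have "G holomorphic_on UNIV"
      by simp
    moreover have "G a \<noteq> 0"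
      using g0[of a] r by (simp add: G_def)
    moreover have "f z = (z - a) ^ n * G z" for z
      using True n by (auto simp: G_def)
    ultimately show ?thesis by blast
  qed
  thus ?thesis
    using that by blast
qed

lemma factor_finite_zeros:
  assumes "finite Z" "f holomorphic_on UNIV" "f w \<noteq> 0"
  obtains g m where "g holomorphic_on UNIV" "\<And>\<rho>. \<rho> \<in> Z \<Longrightarrow> g \<rho> \<noteq> 0"
    "\<And>z. f z = (\<Prod>\<rho>\<in>Z. (z - \<rho>) ^ m \<rho>) * g z"
proof -
  have "\<exists>g m. g holomorphic_on UNIV \<and> (\<forall>\<rho>\<in>Z. g \<rho> \<noteq> 0) \<and>
              (\<forall>z. f z = (\<Prod>\<rho>\<in>Z. (z - \<rho>) ^ m \<rho>) * g z)"
    using assms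
  proof (induction Z rule: finite_induct)
    case empty
    thus ?case by auto
  next
    case (insert a Z)
    then obtain g m where g: "g holomorphic_on UNIV" "\<forall>\<rho>\<in>Z. g \<rho> \<noteq> 0"
      and m: "\<forall>z. f z = (\<Prod>\<rho>\<in>Z. (z - \<rho>) ^ m \<rho>) * g z"
      by blast
    have gw: "g w \<noteq> 0"
      using m insert.prems by auto
    obtain g' k where g': "g' holomorphic_on UNIV" "g' a \<noteq> 0" "\<And>z. g z = (z - a) ^ k * g' z"
      by (rule holomorphic_UNIV_factor_zero[OF g(1) gw]) blast
    have "f z = (\<Prod>\<rho>\<in>insert a Z. (z - \<rho>) ^ (m(a := k)) \<rho>) * g' z" for z
    proof -
      have "(\<Prod>\<rho>\<in>Z. (z - \<rho>) ^ (m(a := k)) \<rho>) = (\<Prod>\<rho>\<in>Z. (z - \<rho>) ^ m \<rho>)"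
        using insert.hyps by (intro prod.cong) auto
      thus ?thesis
        using insert.hyps m g'(3) by (simp add: mult_ac)
    qed
    moreover have "g' \<rho> \<noteq> 0" if "\<rho> \<in> insert a Z" for \<rho>
      using that g g' by (cases "\<rho> = a") auto
    ultimately show ?case
      using g'(1) by blast
  qed
  thus ?thesis
    using that by blast
qed

text \<open>
  A factorisation of an entire function on a disc, with explicit bounds.  Comparing \<open>\<bar>z - \<rho>\<bar> \<ge> 2 R\<close>
  on \<open>\<bar>z\<bar> = 3 R\<close> with \<open>\<bar>\<rho>\<bar> \<le> R\<close> bounds both the zero-free factor and the number of zeros.
\<close>
lemma disc_factorization:
  assumes f: "f holomorphic_on UNIV" and f0: "f 0 \<noteq> 0" and R: "R > 0"
    and M: "\<And>z. norm z \<le> 3 * R \<Longrightarrow> norm (f z) \<le> norm (f 0) * exp A" and A: "A > 0"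
  obtains Z m h where "finite Z" "\<And>\<rho>. \<rho> \<in> Z \<longleftrightarrow> norm \<rho> \<le> R \<and> f \<rho> = 0"
    "h holomorphic_on ball 0 R" "h 0 = 0"
    "\<And>z. norm z < R \<Longrightarrow> f z = f 0 * exp (h z) * (\<Prod>\<rho>\<in>Z. ((z - \<rho>) / (-\<rho>)) ^ m \<rho>)"
    "\<And>z. norm z < R \<Longrightarrow> norm (h z) \<le> 4 * A * norm z / (R - norm z)"
    "2 ^ (\<Sum>\<rho>\<in>Z. m \<rho>) \<le> exp A" "\<And>\<rho>. \<rho> \<in> Z \<Longrightarrow> m \<rho> > 0"
proof -
  define Z where "Z = {\<rho>\<in>cball 0 R. f \<rho> = 0}"
  have finZ: "finite Z"
  proof (cases "f constant_on UNIV")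
    case True
    then obtain c where "\<And>z. f z = c" by (auto simp: constant_on_def)
    with f0 have "Z = {}" by (auto simp: Z_def)
    thus ?thesis by simp
  next
    case False
    thus ?thesis
      unfolding Z_def by (intro holomorphic_compact_finite_zeros[OF f open_UNIV connected_UNIV]) auto
  qed
  obtain g m where g: "g holomorphic_on UNIV" and gZ: "\<And>\<rho>. \<rho> \<in> Z \<Longrightarrow> g \<rho> \<noteq> 0"
    and fg: "\<And>z. f z = (\<Prod>\<rho>\<in>Z. (z - \<rho>) ^ m \<rho>) * g z"
    using factor_finite_zeros[OF finZ f f0] by blast
  define P where "P = (\<lambda>z. \<Prod>\<rho>\<in>Z. (z - \<rho>) ^ m \<rho>)"
  define N where "N = (\<Sum>\<rho>\<in>Z. m \<rho>)"
  have g_nz: "g z \<noteq> 0" if "norm z \<le> R" for z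
  proof
    assume "g z = 0"
    hence "z \<in> Z" using that fg[of z] by (auto simp: Z_def)
    thus False using gZ \<open>g z = 0\<close> by blast
  qed
  have g0: "g 0 \<noteq> 0" using g_nz[of 0] R by simp
  have P0: "P 0 \<noteq> 0" using fg[of 0] f0 by (auto simp: P_def)
  have P0_le: "norm (P 0) \<le> R ^ N"
    unfolding P_def N_def prod_norm[symmetric] power_sum
    by (intro prod_mono) (auto simp: Z_def norm_power intro!: power_mono)
  have P_ge: "(2 * R) ^ N \<le> norm (P z)" if "norm z = 3 * R" for z
    unfolding P_def N_def prod_norm[symmetric] power_sum
  proof (intro prod_mono conjI)
    fix \<rho> assume "\<rho> \<in> Z"
    hence "norm \<rho> \<le> R" by (simp add: Z_def)
    hence "2 * R \<le> norm (z - \<rho>)"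
      using norm_triangle_ineq2[of z \<rho>] that by linarith
    thus "(2 * R) ^ m \<rho> \<le> norm ((z - \<rho>) ^ m \<rho>)"
      using R unfolding norm_power by (intro power_mono) auto
  qed (use R in auto)
  have g_le: "norm (g z) * 2 ^ N \<le> norm (g 0) * exp A" if z: "norm z \<le> 3 * R" for z
  proof -
    have "norm (g z) \<le> norm (g 0) * exp A / 2 ^ N"
    proof (rule maximum_modulus_frontier[where S = "cball 0 (3 * R)" and f = g])
      fix z :: complex assume "z \<in> frontier (cball 0 (3 * R))"
      hence z: "norm z = 3 * R" using R by simp
      have "norm (g z) * (2 * R) ^ N \<le> norm (g z) * norm (P z)"
        using P_ge[OF z] by (intro mult_left_mono) auto
      also have "\<dots> = norm (f z)"
        by (simp add: fg[of z] P_def norm_mult)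
      also have "\<dots> \<le> norm (f 0) * exp A"
        using M z by simp
      also have "\<dots> = norm (P 0) * norm (g 0) * exp A"
        by (simp add: fg[of 0] P_def norm_mult)
      also have "\<dots> \<le> R ^ N * norm (g 0) * exp A"
        using P0_le by (intro mult_right_mono) auto
      finally show "norm (g z) \<le> norm (g 0) * exp A / 2 ^ N"
        using R by (simp add: power_mult_distrib field_simps)
    qed (use z in \<open>auto intro!: holomorphic_on_imp_continuous_on holomorphic_on_subset[OF g]\<close>)
    thus ?thesis by (simp add: field_simps)
  qed
  obtain h0 where h0: "h0 holomorphic_on ball 0 R" "\<And>z. z \<in> ball 0 R \<Longrightarrow> g z / g 0 = exp (h0 z)"
  proof (rule contractible_imp_holomorphic_log[where S = "ball (0::complex) R" and f = "\<lambda>z. g z / g 0"])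
    show "(\<lambda>z. g z / g 0) holomorphic_on ball 0 R"
      using g0 by (intro holomorphic_intros holomorphic_on_subset[OF g]) auto
  qed (use g_nz g0 in \<open>auto simp: convex_imp_contractible\<close>)
  \<comment> \<open>The logarithm is normalised to vanish at 0, as the Borel-Caratheodory bound
    requires.\<close>
  define h where "h = (\<lambda>z. h0 z - h0 0)"
  have h: "h holomorphic_on ball 0 R" "h 0 = 0"
    using h0 by (auto simp: h_def intro!: holomorphic_intros)
  have gh: "g z = g 0 * exp (h z)" if "norm z < R" for z
  proof -
    have "exp (h0 0) = 1" using h0(2)[of 0] R g0 by simp
    thus ?thesis using h0(2)[of z] that g0 by (simp add: h_def exp_diff field_simps)
  qed
  have Re_h: "Re (h z) \<le> A" if "z \<in> ball 0 R" for z
  proof -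
    have "norm (g z) * 1 \<le> norm (g z) * 2 ^ N"
      by (intro mult_left_mono) auto
    also have "\<dots> \<le> norm (g 0) * exp A"
      using that R by (intro g_le) auto
    finally have "exp (Re (h z)) \<le> exp A"
      using gh[of z] that g0 by (simp add: norm_mult)
    thus ?thesis by simp
  qed
  show ?thesis
  proof (rule that[of Z h m])
    show "\<rho> \<in> Z \<longleftrightarrow> norm \<rho> \<le> R \<and> f \<rho> = 0" for \<rho>
      by (auto simp: Z_def)
    show "2 ^ (\<Sum>\<rho>\<in>Z. m \<rho>) \<le> exp A"
      using g_le[of 0] R g0 by (simp add: N_def)
    show "f z = f 0 * exp (h z) * (\<Prod>\<rho>\<in>Z. ((z - \<rho>) / (-\<rho>)) ^ m \<rho>)" if "norm z < R" for z
    proof -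
      have "(\<Prod>\<rho>\<in>Z. ((z - \<rho>) / (-\<rho>)) ^ m \<rho>) = P z / P 0"
        unfolding P_def prod_dividef[symmetric] by (simp only: power_divide diff_0)
      moreover have "f z = P z * g z" "f 0 = P 0 * g 0"
        using fg by (auto simp: P_def)
      ultimately show ?thesis
        using gh[OF that] P0 by simp
    qed
    show "norm (h z) \<le> 4 * A * norm z / (R - norm z)" if "norm z < R" for z
      \<comment> \<open>The real part is only known to be at most \<open>A\<close>, while a strict
        bound is required; passing to \<open>2 * A\<close> costs the factor 2 that turns
        \<open>2 * A\<close> into \<open>4 * A\<close> in the conclusion.\<close>
      using Borel_Caratheodory[OF h(1,2), of "2 * A" z] Re_h A that by force
    show "m \<rho> > 0" if "\<rho> \<in> Z" for \<rho>
    \<comment> \<open>If the exponent at \<rho> were 0, no factor of the product would vanish at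
      \<rho>, and neither does \<open>g\<close>, although \<open>f \<rho> = 0\<close>.\<close>
    proof (rule ccontr)
      assume "\<not> m \<rho> > 0"
      have "f \<rho> = 0" using that by (simp add: Z_def)
      hence "P \<rho> = 0" using fg[of \<rho>] gZ[OF that] by (auto simp: P_def)
      then obtain \<rho>' where "\<rho>' \<in> Z" "(\<rho> - \<rho>') ^ m \<rho>' = 0"
        unfolding P_def using finZ by (auto simp: prod_zero_iff)
      thus False using \<open>\<not> m \<rho> > 0\<close> by (cases "\<rho>' = \<rho>") auto
    qed
  qed (use finZ h in auto)
qed

subsection \<open>Logarithmic derivatives of entire functions of order less than two\<close>

text \<open>Any exponent strictly between 1 and 2 would serve: above 1 to cover
  \<open>exp (|z| ln |z|)\<close>, below 2 so that the bound is negligible against the square of the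
  radius.\<close>

definition growth :: "(complex \<Rightarrow> complex) \<Rightarrow> bool" where
  "growth f \<longleftrightarrow> (\<exists>C>0. \<forall>z. norm (f z) \<le> exp (C * (1 + norm z) powr (3/2)))"

lemma growthI:
  assumes "\<And>z. norm (f z) \<le> exp (C * (1 + norm z) powr (3/2))"
  shows "growth f"
  unfolding growth_def
proof (intro exI[of _ "max C 1"] conjI allI)
  fix z
  have "norm (f z) \<le> exp (C * (1 + norm z) powr (3/2))" by (rule assms)
  also have "\<dots> \<le> exp (max C 1 * (1 + norm z) powr (3/2))"
    by (intro iffD2[OF exp_le_cancel_iff] mult_right_mono) auto
  finally show "norm (f z) \<le> exp (max C 1 * (1 + norm z) powr (3/2))" .
qed auto

lemma growth_translate:
  assumes "growth f"
  shows "growth (\<lambda>z. f (c + z))"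
proof -
  obtain C where C: "C > 0" "\<And>z. norm (f z) \<le> exp (C * (1 + norm z) powr (3/2))"
    using assms by (auto simp: growth_def)
  show ?thesis
  proof (rule growthI)
    fix z
    have "1 + norm (c + z) \<le> (1 + norm c) * (1 + norm z)"
    proof -
      have "0 \<le> norm c * norm z" by simp
      thus ?thesis
        using norm_triangle_ineq[of c z] unfolding distrib_left distrib_right by linarith
    qed
    hence "(1 + norm (c + z)) powr (3/2) \<le> ((1 + norm c) * (1 + norm z)) powr (3/2)"
      by (intro powr_mono2) (auto simp: add_nonneg_nonneg)
    also have "\<dots> = (1 + norm c) powr (3/2) * (1 + norm z) powr (3/2)"
      by (rule powr_mult)
    finally have "C * (1 + norm (c + z)) powr (3/2) \<le> (C * (1 + norm c) powr (3/2)) * (1 + norm z) powr (3/2)"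
      using C(1) by (simp add: mult.assoc)
    with C(2)[of "c + z"] show "norm (f (c + z)) \<le> exp ((C * (1 + norm c) powr (3/2)) * (1 + norm z) powr (3/2))"
      by (meson exp_le_cancel_iff order_trans)
  qed
qed

lemma growth_deriv:
  assumes "growth f" and f: "f holomorphic_on UNIV"
  shows "growth (deriv f)"
proof -
  obtain C where C: "C > 0" "\<And>z. norm (f z) \<le> exp (C * (1 + norm z) powr (3/2))"
    using assms by (auto simp: growth_def)
  show ?thesis
  proof (rule growthI)
    fix z
    have "norm ((deriv ^^ 1) f z) \<le> fact 1 * exp ((C * 2 powr (3/2)) * (1 + norm z) powr (3/2)) / 1 ^ 1"
    proof (rule Cauchy_inequality)
      fix x assume "norm (z - x) = 1"
      hence "1 + norm x \<le> 2 * (1 + norm z)"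
        using norm_triangle_ineq2[of x z] norm_ge_zero[of z] unfolding norm_minus_commute[of z x]
        by argo
      hence "(1 + norm x) powr (3/2) \<le> (2 * (1 + norm z)) powr (3/2)"
        by (intro powr_mono2) auto
      also have "\<dots> = 2 powr (3/2) * (1 + norm z) powr (3/2)"
        by (rule powr_mult)
      finally have "C * (1 + norm x) powr (3/2) \<le> (C * 2 powr (3/2)) * (1 + norm z) powr (3/2)"
        using C(1) by (simp add: mult.assoc)
      with C(2)[of x] show "norm (f x) \<le> exp ((C * 2 powr (3/2)) * (1 + norm z) powr (3/2))"
        by (meson exp_le_cancel_iff order_trans)
    qed (auto intro!: holomorphic_on_imp_continuous_on holomorphic_on_subset[OF f])
    thus "norm (deriv f z) \<le> exp ((C * 2 powr (3/2)) * (1 + norm z) powr (3/2))"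
      by simp
  qed
qed

text \<open>Puts the growth condition in the form relative to \<open>f 0\<close> in which discs are
  factored. The term \<open>ln (norm (f 0))\<close> is absorbed in the constant because
  \<open>(1 + R) powr (3/2)\<close> is at least 1.\<close>

lemma growth_disc_bound:
  assumes "growth f" "f 0 \<noteq> 0"
  obtains C where "C > 0"
    "\<And>R z. R > 0 \<Longrightarrow> norm z \<le> 3 * R \<Longrightarrow> norm (f z) \<le> norm (f 0) * exp (C * (1 + R) powr (3/2))"
proof -
  obtain C where C: "C > 0" "\<And>z. norm (f z) \<le> exp (C * (1 + norm z) powr (3/2))"
    using assms by (auto simp: growth_def)
  define K where "K = C * 3 powr (3/2) + \<bar>ln (norm (f 0))\<bar>"
  show ?thesis
  proof (rule that[of K])
    fix R :: real and z :: complex assume R: "R > 0" and z: "norm z \<le> 3 * R"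
    have "(1 + norm z) powr (3/2) \<le> (3 * (1 + R)) powr (3/2)"
      using z R by (intro powr_mono2) auto
    also have "\<dots> = 3 powr (3/2) * (1 + R) powr (3/2)"
      by (rule powr_mult)
    finally have 1: "C * (1 + norm z) powr (3/2) \<le> C * 3 powr (3/2) * (1 + R) powr (3/2)"
      using C(1) by (simp add: mult.assoc)
    have "1 \<le> (1 + R) powr (3/2)"
      using R by (intro ge_one_powr_ge_zero) auto
    hence "\<bar>ln (norm (f 0))\<bar> * 1 \<le> \<bar>ln (norm (f 0))\<bar> * (1 + R) powr (3/2)"
      by (intro mult_left_mono) auto
    hence "C * (1 + norm z) powr (3/2) - ln (norm (f 0)) \<le> K * (1 + R) powr (3/2)"
      using 1 unfolding K_def distrib_right by linarith
    hence "exp (C * (1 + norm z) powr (3/2)) \<le> exp (ln (norm (f 0)) + K * (1 + R) powr (3/2))"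
      by simp
    also have "\<dots> = norm (f 0) * exp (K * (1 + R) powr (3/2))"
      using assms(2) by (simp add: exp_add)
    finally show "norm (f z) \<le> norm (f 0) * exp (K * (1 + R) powr (3/2))"
      using C(2)[of z] by linarith
  qed (use C(1) in \<open>auto simp: K_def intro!: add_pos_nonneg\<close>)
qed

text \<open>Equality is asked for only near \<open>w\<close>, since the factorisation is available
  only inside a disc.\<close>

lemma logderiv_prod:
  fixes h :: "complex \<Rightarrow> complex"
  assumes "finite Z" and h: "(h has_field_derivative h') (at w)" and c: "c \<noteq> 0"
    and w: "w \<notin> Z" and Z0: "0 \<notin> Z"
    and f: "\<forall>\<^sub>F z in nhds w. f z = c * exp (h z) * (\<Prod>\<rho>\<in>Z. ((z - \<rho>) / (-\<rho>)) ^ m \<rho>)"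
  shows "deriv f w / f w = h' + (\<Sum>\<rho>\<in>Z. of_nat (m \<rho>) / (w - \<rho>))"
proof -
  define P where "P = (\<lambda>z. \<Prod>\<rho>\<in>Z. ((z - \<rho>) / (-\<rho>)) ^ m \<rho>)"
  have P: "(P has_field_derivative P w * (\<Sum>\<rho>\<in>Z. of_nat (m \<rho>) / (w - \<rho>))) (at w) \<and> P w \<noteq> 0"
    using \<open>finite Z\<close> w Z0 unfolding P_def
  proof (induction Z rule: finite_induct)
    case empty
    show ?case by simp
  next
    case (insert a Z)
    define Q where "Q = (\<lambda>z. \<Prod>\<rho>\<in>Z. ((z - \<rho>) / (-\<rho>)) ^ m \<rho>)"
    have Q: "(Q has_field_derivative Q w * (\<Sum>\<rho>\<in>Z. of_nat (m \<rho>) / (w - \<rho>))) (at w)" "Q w \<noteq> 0"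
      using insert unfolding Q_def by auto
    have wa: "w - a \<noteq> 0" "a \<noteq> 0" using insert.prems by auto
    define k where "k = m a"
    have 1: "((\<lambda>z. ((z - a) / (-a)) ^ k) has_field_derivative
            ((w - a) / (-a)) ^ k * (of_nat k / (w - a))) (at w)"
    proof (cases k)
      case 0
      thus ?thesis by simp
    next
      case (Suc j)
      have "((\<lambda>z. ((z - a) / (-a)) ^ k) has_field_derivative
            of_nat k * ((w - a) / (-a)) ^ (k - 1) * (1 / (-a))) (at w)"
        using wa by (auto intro!: derivative_eq_intros)
      moreover have "of_nat k * ((w - a) / (-a)) ^ (k - 1) * (1 / (-a)) =
            ((w - a) / (-a)) ^ k * (of_nat k / (w - a))"
        using wa Suc by (simp add: field_simps)
      ultimately show ?thesis by simp
    qed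
    have "((\<lambda>z. ((z - a) / (-a)) ^ k * Q z) has_field_derivative
           (((w - a) / (-a)) ^ k * Q w) * (of_nat k / (w - a) + (\<Sum>\<rho>\<in>Z. of_nat (m \<rho>) / (w - \<rho>)))) (at w)"
      by (rule DERIV_cong[OF DERIV_mult[OF 1 Q(1)]]) (simp add: algebra_simps)
    thus ?case
      using insert.hyps wa Q(2) by (simp add: Q_def k_def)
  qed
  have "((\<lambda>z. c * exp (h z) * P z) has_field_derivative
      (c * exp (h w) * P w) * (h' + (\<Sum>\<rho>\<in>Z. of_nat (m \<rho>) / (w - \<rho>)))) (at w)"
    using P h by (auto intro!: derivative_eq_intros simp: algebra_simps)
  hence "(f has_field_derivative
      (c * exp (h w) * P w) * (h' + (\<Sum>\<rho>\<in>Z. of_nat (m \<rho>) / (w - \<rho>)))) (at w)"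
    using f by (subst DERIV_cong_ev[OF refl _ refl]) (auto simp: P_def)
  moreover have "f w = c * exp (h w) * P w"
    using eventually_nhds_x_imp_x[OF f] by (simp add: P_def)
  ultimately show ?thesis
    using P c by (simp add: DERIV_imp_deriv)
qed

text \<open>
  A substitute for the Hadamard product: the linear exponential factor cancels in the difference
  of the two logarithmic derivatives, and the rest of the zero-free factor disappears as the
  radius of the disc tends to infinity.
\<close>
lemma Re_logderiv_mono_0:
  assumes f: "f holomorphic_on UNIV" and "growth f" and f0: "f 0 \<noteq> 0" and fw: "f w \<noteq> 0"
    and zeros: "\<And>\<rho>. f \<rho> = 0 \<Longrightarrow> 0 \<le> Re \<rho> \<and> Re \<rho> \<le> Re w"
  shows "Re (deriv f 0 / f 0) \<le> Re (deriv f w / f w)"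
proof -
  obtain C where C: "C > 0" and bnd: "\<And>R z. R > 0 \<Longrightarrow> norm z \<le> 3 * R \<Longrightarrow>
      norm (f z) \<le> norm (f 0) * exp (C * (1 + R) powr (3/2))"
    using growth_disc_bound[OF \<open>growth f\<close> f0] by blast
  \<comment> \<open>Up to a constant, \<open>E R\<close> is the Cauchy bound for the second
    derivative of \<open>h\<close> times the distance from 0 to \<open>w\<close>; it decays like
    \<open>R powr (-1/2)\<close>.\<close>
  define E where "E = (\<lambda>R. (2 * (4 * (C * (1 + R) powr (3/2)))) / (R / 4) ^ 2 * 2 * norm w)"
  have main: "Re (deriv f 0 / f 0) - Re (deriv f w / f w) \<le> E R" if R: "R > 4 * norm w" for R
  proof -
    have R0: "R > 0" using R norm_ge_zero[of w] by linarith
    define A where "A = C * (1 + R) powr (3/2)"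
    have A: "A > 0" using C R0 by (simp add: A_def)
    obtain Z m h where Z: "finite Z" "\<And>\<rho>. \<rho> \<in> Z \<longleftrightarrow> norm \<rho> \<le> R \<and> f \<rho> = 0"
      and h: "h holomorphic_on ball 0 R"
      and fh: "\<And>z. norm z < R \<Longrightarrow> f z = f 0 * exp (h z) * (\<Prod>\<rho>\<in>Z. ((z - \<rho>) / (-\<rho>)) ^ m \<rho>)"
      and hb: "\<And>z. norm z < R \<Longrightarrow> norm (h z) \<le> 4 * A * norm z / (R - norm z)"
      by (rule disc_factorization[OF f f0 R0 _ A], erule bnd[OF R0, folded A_def]) (rule that)
    have ld: "deriv f z / f z = deriv h z + (\<Sum>\<rho>\<in>Z. of_nat (m \<rho>) / (z - \<rho>))"
      if "norm z < R" "f z \<noteq> 0" for z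
    proof (rule logderiv_prod[OF Z(1) _ f0])
      show "(h has_field_derivative deriv h z) (at z)"
        using that by (intro holomorphic_derivI[OF h]) auto
      have "\<forall>\<^sub>F z in nhds z. z \<in> ball 0 R"
        using that by (intro eventually_nhds_in_open) auto
      thus "\<forall>\<^sub>F z in nhds z. f z = f 0 * exp (h z) * (\<Prod>\<rho>\<in>Z. ((z - \<rho>) / - \<rho>) ^ m \<rho>)"
        by eventually_elim (use fh in auto)
    qed (use that Z f0 in auto)
    \<comment> \<open>Bounding the second derivative controls \<open>deriv h w - deriv h 0\<close>,
      in which the linear part of \<open>h\<close> is invisible. The circle of radius
      \<open>R / 4\<close> around \<open>z\<close> stays in the disc of radius \<open>R / 2\<close>,
      where the bound on \<open>h\<close> is at most \<open>4 * A\<close>.\<close>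
    have h2: "norm (deriv (deriv h) z) \<le> 2 * (4 * A) / (R / 4) ^ 2" if z: "norm z \<le> R / 4" for z
    proof -
      have sub: "cball z (R / 4) \<subseteq> ball 0 R"
      proof
        fix u assume "u \<in> cball z (R / 4)"
        thus "u \<in> ball 0 R"
          using norm_triangle_ineq2[of u z] z R0 by (simp add: dist_norm norm_minus_commute)
      qed
      have "norm ((deriv ^^ 2) h z) \<le> fact 2 * (4 * A) / (R / 4) ^ 2"
      proof (rule Cauchy_inequality)
        show "h holomorphic_on ball z (R / 4)"
          using sub ball_subset_cball by (intro holomorphic_on_subset[OF h]) blast
        show "continuous_on (cball z (R / 4)) h"
          using sub by (intro holomorphic_on_imp_continuous_on holomorphic_on_subset[OF h])
      next
        fix u assume "norm (z - u) = R / 4"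
        hence u: "norm u \<le> R / 2"
          using norm_triangle_ineq2[of u z] z by (simp add: norm_minus_commute)
        have "norm (h u) \<le> 4 * A * norm u / (R - norm u)"
          using u R0 by (intro hb) auto
        also have "\<dots> \<le> 4 * A"
          using u R0 A by (simp add: divide_le_eq)
        finally show "norm (h u) \<le> 4 * A" .
      qed (use R0 in auto)
      thus ?thesis by (simp add: numeral_2_eq_2)
    qed
    have "norm (deriv h w - deriv h 0) \<le> 2 * (4 * A) / (R / 4) ^ 2 * norm (w - 0)"
    proof (rule field_differentiable_bound[of "cball 0 (R / 4)"])
      fix z assume z: "z \<in> cball (0::complex) (R / 4)"
      have "deriv h holomorphic_on ball 0 R"
        by (intro holomorphic_deriv h) auto
      thus "(deriv h has_field_derivative deriv (deriv h) z) (at z within cball 0 (R / 4))"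
        using z R0 by (intro holomorphic_derivI[of _ "ball 0 R"]) auto
      show "norm (deriv (deriv h) z) \<le> 2 * (4 * A) / (R / 4) ^ 2"
        using h2 z by simp
    qed (use R R0 in auto)
    hence d: "Re (deriv h 0) - Re (deriv h w) \<le> E R"
      using abs_Re_le_cmod[of "deriv h w - deriv h 0"] A R0 unfolding E_def A_def by simp
    have "Re (\<Sum>\<rho>\<in>Z. of_nat (m \<rho>) / (0 - \<rho>)) \<le> Re (\<Sum>\<rho>\<in>Z. of_nat (m \<rho>) / (w - \<rho>))"
      unfolding Re_sum
    proof (rule sum_mono)
      fix \<rho> assume "\<rho> \<in> Z"
      hence \<rho>: "0 \<le> Re \<rho>" "Re \<rho> \<le> Re w"
        using zeros Z by auto
      have "Re (of_nat (m \<rho>) / (0 - \<rho>)) \<le> 0"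
        using \<rho> by (auto simp: Re_divide divide_nonpos_nonneg mult_nonneg_nonpos intro!: divide_nonpos_nonneg)
      also have "0 \<le> Re (of_nat (m \<rho>) / (w - \<rho>))"
        using \<rho> by (auto simp: Re_divide)
      finally show "Re (of_nat (m \<rho>) / (0 - \<rho>)) \<le> Re (of_nat (m \<rho>) / (w - \<rho>))" .
    qed
    with d show ?thesis
      using ld[of 0] ld[of w] f0 fw R0 R by simp
  qed
  have "(E \<longlongrightarrow> 0) at_top"
    unfolding E_def using C by real_asymp
  moreover have "\<forall>\<^sub>F R in at_top. Re (deriv f 0 / f 0) - Re (deriv f w / f w) \<le> E R"
    using eventually_gt_at_top[of "4 * norm w"] by eventually_elim (rule main)
  ultimately have "Re (deriv f 0 / f 0) - Re (deriv f w / f w) \<le> 0"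
    by (rule tendsto_lowerbound) auto
  thus ?thesis by simp
qed

lemma Re_logderiv_mono:
  assumes f: "f holomorphic_on UNIV" and g: "growth f" and "f v \<noteq> 0" and "f w \<noteq> 0"
    and zeros: "\<And>\<rho>. f \<rho> = 0 \<Longrightarrow> Re v \<le> Re \<rho> \<and> Re \<rho> \<le> Re w"
  shows "Re (deriv f v / f v) \<le> Re (deriv f w / f w)"
proof -
  define F where "F = (\<lambda>z. f (v + z))"
  have F: "F holomorphic_on UNIV"
    unfolding F_def by (rule holomorphic_on_compose_gen[OF _ f, of "\<lambda>z. v + z", unfolded o_def])
      (auto intro!: holomorphic_intros)
  have dF: "deriv F z = deriv f (v + z)" for z
  proof -
    have "((\<lambda>z. f (v + z)) has_field_derivative deriv f (v + z) * 1) (at z)"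
      by (rule DERIV_chain2[of f]) (auto intro!: derivative_eq_intros holomorphic_derivI[OF f])
    thus ?thesis unfolding F_def by (intro DERIV_imp_deriv) simp
  qed
  have "Re (deriv F 0 / F 0) \<le> Re (deriv F (w - v) / F (w - v))"
  proof (rule Re_logderiv_mono_0[OF F])
    fix \<rho> assume "F \<rho> = 0"
    thus "0 \<le> Re \<rho> \<and> Re \<rho> \<le> Re (w - v)"
      using zeros[of "v + \<rho>"] by (simp add: F_def)
  qed (use assms growth_translate[OF g, of v] in \<open>auto simp: F_def\<close>)
  thus ?thesis by (simp add: dF) (simp add: F_def)
qed

section \<open>Lower bounds for entire functions along horizontal segments\<close>

lemma obtain_horizontal_gap:
  fixes Z :: "complex set"
  assumes Z: "finite Z" and n: "card Z \<le> n" and R: "R > 0"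
  obtains T where "R / 4 \<le> T" "T \<le> R / 2"
    "\<And>\<rho>. \<rho> \<in> Z \<Longrightarrow> R / (8 * (real n + 1)) \<le> \<bar>T - \<bar>Im \<rho>\<bar>\<bar>"
proof -
  define \<delta> where "\<delta> = R / (8 * (real n + 1))"
  have \<delta>: "\<delta> > 0" using R by (simp add: \<delta>_def)
  \<comment> \<open>These \<open>n + 1\<close> heights lie \<open>2 * \<delta>\<close> apart, so
    each zero comes closer than \<delta> to at most one of them, and \<open>n\<close> zeros cannot
    spoil them all. The choice of \<delta> keeps all heights below \<open>R / 2\<close>.\<close>
  define t where "t = (\<lambda>k::nat. R / 4 + 2 * real k * \<delta>)"
  have "\<exists>k\<le>n. \<forall>\<rho>\<in>Z. \<delta> \<le> \<bar>t k - \<bar>Im \<rho>\<bar>\<bar>"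
  proof (rule ccontr)
    assume no: "\<not> ?thesis"
    have ex: "\<exists>\<rho>. \<rho> \<in> Z \<and> \<bar>t k - \<bar>Im \<rho>\<bar>\<bar> < \<delta>" if "k \<le> n" for k
    proof -
      have "\<not> (\<forall>\<rho>\<in>Z. \<delta> \<le> \<bar>t k - \<bar>Im \<rho>\<bar>\<bar>)"
        using no that by metis
      thus ?thesis unfolding Ball_def not_all not_imp not_le .
    qed
    define r where "r = (\<lambda>k. SOME \<rho>. \<rho> \<in> Z \<and> \<bar>t k - \<bar>Im \<rho>\<bar>\<bar> < \<delta>)"
    have r: "r k \<in> Z" "\<bar>t k - \<bar>Im (r k)\<bar>\<bar> < \<delta>" if "k \<in> {..n}" for k
      using someI_ex[OF ex[of k]] that by (auto simp: r_def)
    have "inj_on r {..n}"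
    proof (rule inj_onI)
      fix j k assume jk: "j \<in> {..n}" "k \<in> {..n}" "r j = r k"
      have "\<bar>t j - t k\<bar> < 2 * \<delta>"
        using r(2)[OF jk(1)] r(2)[OF jk(2)] unfolding jk(3) by linarith
      moreover have "\<bar>t j - t k\<bar> = 2 * \<delta> * \<bar>real j - real k\<bar>"
      proof -
        have "t j - t k = 2 * \<delta> * (real j - real k)"
          by (simp add: t_def algebra_simps)
        thus ?thesis using \<delta> by (simp add: abs_mult)
      qed
      ultimately have "\<bar>real j - real k\<bar> < 1"
        using \<delta> by simp
      thus "j = k" by linarith
    qed
    hence "card {..n} \<le> card Z"
      using r by (intro card_inj_on_le[of r] Z) auto
    thus False using n by simp
  qed
  then obtain k where k: "k \<le> n" "\<forall>\<rho>\<in>Z. \<delta> \<le> \<bar>t k - \<bar>Im \<rho>\<bar>\<bar>" by blast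
  show ?thesis
  proof (rule that[of "t k"])
    show "R / 4 \<le> t k" using \<delta> by (simp add: t_def)
    have "2 * real k * \<delta> \<le> 2 * (real n + 1) * \<delta>"
      using k(1) \<delta> by (intro mult_right_mono) auto
    also have "\<dots> = R / 4" by (simp add: \<delta>_def divide_simps)
    finally show "t k \<le> R / 2" by (simp add: t_def)
  qed (use k in \<open>auto simp: \<delta>_def\<close>)
qed

text \<open>At a height avoiding the zeros each factor of the product is at least a constant over
  \<open>N + 1\<close>, where the number \<open>N\<close> of zeros is of order
  \<open>R powr (3/2)\<close>. Hence \<open>ln (norm (f z))\<close> is at worst of order
  \<open>- R powr (3/2) * ln R\<close>, which is negligible against the square of
  \<open>R\<close>.\<close>

lemma min_modulus_horizontal_0:
  assumes f: "f holomorphic_on UNIV" and "growth f" and f0: "f 0 \<noteq> 0" and eps: "\<epsilon> > 0"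
  shows "\<forall>\<^sub>F R in at_top. \<exists>T\<ge>R/4. T \<le> R/2 \<and>
           (\<forall>z. \<bar>Re z\<bar> \<le> R/4 \<longrightarrow> \<bar>Im z\<bar> = T \<longrightarrow> exp (-\<epsilon> * R\<^sup>2) \<le> norm (f z))"
proof -
  obtain C where C: "C > 0" and bnd: "\<And>R z. R > 0 \<Longrightarrow> norm z \<le> 3 * R \<Longrightarrow>
      norm (f z) \<le> norm (f 0) * exp (C * (1 + R) powr (3/2))"
    using growth_disc_bound[OF \<open>growth f\<close> f0] by blast
  \<comment> \<open>An explicit lower bound for \<open>ln (norm (f z))\<close>, with
    \<open>A = C * (1 + R) powr (3/2)\<close>: \<open>12 * A\<close> bounds \<open>h\<close> for
    \<open>norm z\<close> up to \<open>3/4 * R\<close>, and the last term bounds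
    \<open>N * ln (8 * (N + 1))\<close> with \<open>N\<close> at most \<open>2 * A\<close>.\<close>
  define L where "L = (\<lambda>R. ln (norm (f 0)) - 12 * (C * (1 + R) powr (3/2)) -
     (2 * (C * (1 + R) powr (3/2)) + 1) * ln (8 * (2 * (C * (1 + R) powr (3/2)) + 2)))"
  have "((\<lambda>R. L R / R\<^sup>2) \<longlongrightarrow> 0) at_top"
    unfolding L_def using C by real_asymp
  hence "\<forall>\<^sub>F R in at_top. L R / R\<^sup>2 > - \<epsilon>"
    using eps by (intro order_tendstoD) auto
  thus ?thesis
    using eventually_gt_at_top[of 0]
  proof eventually_elim
    case (elim R)
    hence R0: "R > 0" and L: "- \<epsilon> * R\<^sup>2 < L R"
      by (auto simp: pos_less_divide_eq)
    define A where "A = C * (1 + R) powr (3/2)"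
    have A: "A > 0" using C R0 by (simp add: A_def)
    obtain Z m h where Z: "finite Z" "\<And>\<rho>. \<rho> \<in> Z \<longleftrightarrow> norm \<rho> \<le> R \<and> f \<rho> = 0"
      and fh: "\<And>z. norm z < R \<Longrightarrow> f z = f 0 * exp (h z) * (\<Prod>\<rho>\<in>Z. ((z - \<rho>) / (-\<rho>)) ^ m \<rho>)"
      and hb: "\<And>z. norm z < R \<Longrightarrow> norm (h z) \<le> 4 * A * norm z / (R - norm z)"
      and mN: "2 ^ (\<Sum>\<rho>\<in>Z. m \<rho>) \<le> exp A" and m: "\<And>\<rho>. \<rho> \<in> Z \<Longrightarrow> m \<rho> > 0"
      by (rule disc_factorization[OF f f0 R0 _ A], erule bnd[OF R0, folded A_def]) (rule that)
    define N where "N = (\<Sum>\<rho>\<in>Z. m \<rho>)"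
    have "real N * ln 2 = ln (2 ^ N)" by (simp add: ln_realpow)
    also have "\<dots> \<le> ln (exp A)" using mN by (subst ln_le_cancel_iff) (auto simp: N_def)
    finally have "real N * ln 2 \<le> A" by simp
    moreover have "real N * (1/2) \<le> real N * ln 2"
      using ln2_ge_two_thirds by (intro mult_left_mono) auto
    ultimately have NA: "real N \<le> 2 * A" by simp
    have "card Z = (\<Sum>\<rho>\<in>Z. 1)" by simp
    also have "\<dots> \<le> N" unfolding N_def using m by (intro sum_mono) (simp add: Suc_leI)
    finally obtain T where T: "R / 4 \<le> T" "T \<le> R / 2"
      "\<And>\<rho>. \<rho> \<in> Z \<Longrightarrow> R / (8 * (real N + 1)) \<le> \<bar>T - \<bar>Im \<rho>\<bar>\<bar>"
      using obtain_horizontal_gap[OF Z(1) _ R0] by blast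
    have "exp (-\<epsilon> * R\<^sup>2) \<le> norm (f z)" if z: "\<bar>Re z\<bar> \<le> R / 4" "\<bar>Im z\<bar> = T" for z
    proof -
      have zR: "norm z \<le> 3/4 * R"
        using cmod_le[of z] z T by simp
      define p where "p = 1 / (8 * (real N + 1))"
      have p: "p > 0" by (simp add: p_def)
      have "p ^ N \<le> norm (\<Prod>\<rho>\<in>Z. ((z - \<rho>) / (-\<rho>)) ^ m \<rho>)"
        unfolding N_def prod_norm[symmetric] power_sum
      proof (intro prod_mono conjI)
        fix \<rho> assume \<rho>: "\<rho> \<in> Z"
        have \<rho>0: "\<rho> \<noteq> 0" using f0 Z(2)[of \<rho>] \<rho> by auto
        have "norm \<rho> \<le> R" using Z \<rho> by auto
        hence "p * norm \<rho> \<le> p * R" using p by simp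
        also have "\<dots> = R / (8 * (real N + 1))" by (simp add: p_def)
        also have "\<dots> \<le> \<bar>T - \<bar>Im \<rho>\<bar>\<bar>" by (rule T(3)[OF \<rho>])
        also have "\<dots> \<le> \<bar>Im (z - \<rho>)\<bar>" using z(2) by auto
        also have "\<dots> \<le> norm (z - \<rho>)" by (rule abs_Im_le_cmod)
        finally have "p \<le> norm ((z - \<rho>) / (-\<rho>))"
          using \<rho>0 by (simp add: norm_divide pos_le_divide_eq)
        thus "p ^ m \<rho> \<le> norm (((z - \<rho>) / (-\<rho>)) ^ m \<rho>)"
          using p unfolding norm_power by (intro power_mono) auto
      qed (use p in auto)
      moreover have "exp (-12 * A) \<le> norm (exp (h z))"
      proof -
        have "norm (h z) \<le> 4 * A * norm z / (R - norm z)"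
          using zR R0 by (intro hb) auto
        also have "\<dots> \<le> 4 * A * (3/4 * R) / (R - 3/4 * R)"
          using zR R0 A by (intro frac_le mult_mono) auto
        also have "\<dots> = 12 * A" using R0 by simp
        finally have "- 12 * A \<le> Re (h z)"
          using abs_Re_le_cmod[of "h z"] by linarith
        thus ?thesis by simp
      qed
      ultimately have "norm (f 0) * exp (-12 * A) * p ^ N \<le> norm (f z)"
        using fh[of z] zR R0 p by (auto simp: norm_mult intro!: mult_mono)
      moreover have "exp (L R) \<le> norm (f 0) * exp (-12 * A) * p ^ N"
      proof -
        have "ln (p ^ N) = - (real N * ln (8 * (real N + 1)))"
          by (simp add: p_def ln_realpow ln_div)
        moreover have "real N * ln (8 * (real N + 1)) \<le> (2 * A + 1) * ln (8 * (2 * A + 2))"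
          using NA A by (intro mult_mono) auto
        ultimately have "L R \<le> ln (norm (f 0)) - 12 * A + ln (p ^ N)"
          by (simp add: L_def A_def)
        hence "exp (L R) \<le> exp (ln (norm (f 0)) + (- 12 * A) + ln (p ^ N))"
          by simp
        also have "\<dots> = norm (f 0) * exp (-12 * A) * p ^ N"
          using f0 p unfolding exp_add by simp
        finally show ?thesis .
      qed
      moreover have "exp (- \<epsilon> * R\<^sup>2) \<le> exp (L R)" using L by simp
      ultimately show ?thesis by linarith
    qed
    thus ?case using T by blast
  qed
qed

text \<open>Reduction to the case of a nonzero value at the origin by a translation along the real
  axis, which leaves heights unchanged. A suitable real point exists, as otherwise \<open>f\<close>
  would vanish identically.\<close>

lemma min_modulus_horizontal:
  assumes f: "f holomorphic_on UNIV" and g: "growth f" and nz: "f w \<noteq> 0" and eps: "\<epsilon> > 0"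
  shows "\<exists>T\<ge>N. \<forall>z. \<bar>Re z\<bar> \<le> 1 \<longrightarrow> \<bar>Im z\<bar> = T \<longrightarrow> exp (-\<epsilon> * T\<^sup>2) \<le> norm (f z)"
proof -
  have "\<exists>c. f (complex_of_real c) \<noteq> 0"
  proof (rule ccontr)
    assume "\<not> ?thesis"
    hence 0: "f (complex_of_real c) = 0" for c by auto
    have lim: "(0 :: complex) islimpt range complex_of_real"
      unfolding islimpt_approachable
    proof (intro allI impI)
      fix e :: real assume "e > 0"
      thus "\<exists>x'\<in>range complex_of_real. x' \<noteq> 0 \<and> dist x' 0 < e"
        by (intro bexI[of _ "complex_of_real (e / 2)"] rangeI) auto
    qed
    have "f w = 0"
      by (rule analytic_continuation[OF f open_UNIV connected_UNIV subset_UNIV UNIV_I lim])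
         (use 0 in auto)
    with nz show False by simp
  qed
  then obtain c where c: "f (complex_of_real c) \<noteq> 0" by blast
  define F where "F = (\<lambda>z. f (of_real c + z))"
  have F: "F holomorphic_on UNIV"
    unfolding F_def by (rule holomorphic_on_compose_gen[OF _ f, of "\<lambda>z. of_real c + z", unfolded o_def])
      (auto intro!: holomorphic_intros)
  have "\<forall>\<^sub>F R in at_top. \<exists>T\<ge>R/4. T \<le> R/2 \<and>
           (\<forall>z. \<bar>Re z\<bar> \<le> R/4 \<longrightarrow> \<bar>Im z\<bar> = T \<longrightarrow> exp (-(\<epsilon> / 16) * R\<^sup>2) \<le> norm (F z))"
    using eps c growth_translate[OF g, of "of_real c"] by (intro min_modulus_horizontal_0[OF F]) (auto simp: F_def)
  moreover have "\<forall>\<^sub>F R in at_top. R \<ge> 4 * \<bar>N\<bar> + 4 * (1 + \<bar>c\<bar>)"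
    by (rule eventually_ge_at_top)
  ultimately have "\<forall>\<^sub>F R in at_top. (\<exists>T\<ge>R/4. T \<le> R/2 \<and>
           (\<forall>z. \<bar>Re z\<bar> \<le> R/4 \<longrightarrow> \<bar>Im z\<bar> = T \<longrightarrow> exp (-(\<epsilon> / 16) * R\<^sup>2) \<le> norm (F z))) \<and>
      R \<ge> 4 * \<bar>N\<bar> + 4 * (1 + \<bar>c\<bar>)"
    by (rule eventually_conj)
  then obtain R where elim: "\<exists>T\<ge>R/4. T \<le> R/2 \<and>
           (\<forall>z. \<bar>Re z\<bar> \<le> R/4 \<longrightarrow> \<bar>Im z\<bar> = T \<longrightarrow> exp (-(\<epsilon> / 16) * R\<^sup>2) \<le> norm (F z))"
      "R \<ge> 4 * \<bar>N\<bar> + 4 * (1 + \<bar>c\<bar>)"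
    using eventually_happens'[OF trivial_limit_at_top_linorder] by blast
  show ?thesis
  proof -
    from elim(1) obtain T where T: "R / 4 \<le> T" "T \<le> R / 2" and
      b: "\<And>z. \<bar>Re z\<bar> \<le> R/4 \<Longrightarrow> \<bar>Im z\<bar> = T \<Longrightarrow> exp (-(\<epsilon> / 16) * R\<^sup>2) \<le> norm (F z)"
      by blast
    show ?thesis
    proof (intro exI[of _ T] conjI allI impI)
      show "N \<le> T" using T(1) elim(2) abs_ge_self[of N] abs_ge_zero[of c] by argo
      fix z assume z: "\<bar>Re z\<bar> \<le> 1" "\<bar>Im z\<bar> = T"
      \<comment> \<open>The height is at least \<open>R / 4\<close>, which is why \<epsilon> was
        divided by 16.\<close>
      have "(R / 4)\<^sup>2 \<le> T\<^sup>2"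
        using T elim(2) by (intro power_mono) auto
      hence "\<epsilon> / 16 * R\<^sup>2 \<le> \<epsilon> * T\<^sup>2"
        using eps by (simp add: power_divide)
      hence "exp (-\<epsilon> * T\<^sup>2) \<le> exp (-(\<epsilon> / 16) * R\<^sup>2)" by simp
      also have "\<dots> \<le> norm (F (z - of_real c))"
      proof (rule b)
        have "\<bar>Re z - c\<bar> \<le> 1 + \<bar>c\<bar>"
          using z abs_triangle_ineq4[of "Re z" c] by linarith
        moreover have "4 * (1 + \<bar>c\<bar>) \<le> R"
          using elim(2) abs_ge_zero[of N] by argo
        ultimately show "\<bar>Re (z - of_real c)\<bar> \<le> R / 4"
          by simp
      qed (use z in auto)
      finally show "exp (-\<epsilon> * T\<^sup>2) \<le> norm (f z)" by (simp add: F_def)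
    qed
  qed
qed

subsection \<open>Transferring zeros between a function and its derivative\<close>

lemma rectangle_eq_box: "cbox (Complex a c) (Complex b d) = {z. a \<le> Re z \<and> Re z \<le> b \<and> c \<le> Im z \<and> Im z \<le> d}"
  by (auto simp: cbox_def Basis_complex_def)

text \<open>Multiplication by \<open>exp (\<epsilon> * z^2)\<close> makes the horizontal sides of a
  tall rectangle harmless: there the factor decays like \<open>exp (- \<epsilon> * T^2)\<close> and
  beats growth with \<epsilon> halved. It costs at most \<open>exp \<epsilon>\<close> on the
  vertical sides, since the width is at most 1, and \<epsilon> tends to 0 at the end. Growth is
  assumed only at some arbitrarily large heights, which is all that a minimum modulus bound
  supplies.\<close>

lemma Phragmen_Lindelof_strip:
  assumes hol: "f holomorphic_on {z. 0 < Re z \<and> Re z < b}"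
    and cont: "continuous_on {z. 0 \<le> Re z \<and> Re z \<le> b} f"
    and b: "0 < b" "b \<le> 1"
    and bd: "\<And>z. Re z = 0 \<or> Re z = b \<Longrightarrow> norm (f z) \<le> B" and B: "B > 0"
    and gr: "\<And>\<epsilon> N. \<epsilon> > 0 \<Longrightarrow> \<exists>T\<ge>N. \<forall>z. 0 \<le> Re z \<longrightarrow> Re z \<le> b \<longrightarrow> \<bar>Im z\<bar> = T \<longrightarrow> norm (f z) \<le> exp (\<epsilon> * T\<^sup>2)"
    and z: "0 \<le> Re z" "Re z \<le> b"
  shows "norm (f z) \<le> B"
proof -
  have main: "norm (f z) \<le> B * exp \<epsilon> * exp (\<epsilon> * (Im z)\<^sup>2)" if eps: "\<epsilon> > 0" for \<epsilon> :: real
  proof -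
    have "((\<lambda>T::real. exp \<epsilon> * exp (-(\<epsilon> / 2) * T\<^sup>2)) \<longlongrightarrow> 0) at_top"
      using eps by real_asymp
    hence "\<forall>\<^sub>F T in at_top. exp \<epsilon> * exp (-(\<epsilon> / 2) * T\<^sup>2) < B * exp \<epsilon>"
      using B by (intro order_tendstoD) auto
    then obtain N where N: "\<And>T. T \<ge> N \<Longrightarrow> exp \<epsilon> * exp (-(\<epsilon> / 2) * T\<^sup>2) < B * exp \<epsilon>"
      by (auto simp: eventually_at_top_linorder)
    obtain T where T: "T \<ge> max N (\<bar>Im z\<bar> + 1)"
      and fT: "\<And>z. 0 \<le> Re z \<Longrightarrow> Re z \<le> b \<Longrightarrow> \<bar>Im z\<bar> = T \<Longrightarrow> norm (f z) \<le> exp (\<epsilon> / 2 * T\<^sup>2)"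
      using gr[of "\<epsilon> / 2" "max N (\<bar>Im z\<bar> + 1)"] eps by auto
    define F where "F = (\<lambda>z. f z * exp (of_real \<epsilon> * z\<^sup>2))"
    define S where "S = cbox (Complex 0 (-T)) (Complex b T)"
    have clS: "closure S = S" unfolding S_def by (rule closure_cbox)
    have S: "S = {z. 0 \<le> Re z \<and> Re z \<le> b \<and> -T \<le> Im z \<and> Im z \<le> T}"
      unfolding S_def by (rule rectangle_eq_box)
    have intS: "interior S = {z. 0 < Re z \<and> Re z < b \<and> -T < Im z \<and> Im z < T}"
      unfolding S_def interior_cbox by (auto simp: box_def Basis_complex_def)
    have norm_F: "norm (F z) = norm (f z) * exp (\<epsilon> * ((Re z)\<^sup>2 - (Im z)\<^sup>2))" for z
      by (simp add: F_def norm_mult power2_eq_square)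
    have Re_sq: "(Re z)\<^sup>2 \<le> 1" if "0 \<le> Re z" "Re z \<le> b" for z
      using that b by (simp add: power_le_one)
    have "norm (F z) \<le> B * exp \<epsilon>"
    proof (rule maximum_modulus_frontier[where f = F and S = S])
      show "F holomorphic_on interior S"
        unfolding F_def by (intro holomorphic_intros holomorphic_on_subset[OF hol]) (auto simp: intS)
      show "continuous_on (closure S) F"
        unfolding F_def clS by (intro continuous_intros continuous_on_subset[OF cont]) (auto simp: S)
      show "bounded S" by (simp add: S_def)
      show "z \<in> S" using z T by (auto simp: S)
    next
      fix u assume "u \<in> frontier S"
      hence u: "u \<in> S" "u \<notin> interior S"
        by (auto simp: frontier_def S_def)
      hence "Re u = 0 \<or> Re u = b \<or> \<bar>Im u\<bar> = T"
        unfolding intS unfolding S by auto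
      thus "norm (F u) \<le> B * exp \<epsilon>"
      proof (elim disjE)
        assume ImT: "\<bar>Im u\<bar> = T"
        have "norm (F u) \<le> exp (\<epsilon> / 2 * T\<^sup>2) * exp (\<epsilon> * ((Re u)\<^sup>2 - (Im u)\<^sup>2))"
          unfolding norm_F using u ImT by (intro mult_right_mono fT) (auto simp: S)
        also have "\<dots> \<le> exp (\<epsilon> / 2 * T\<^sup>2) * exp (\<epsilon> * (1 - T\<^sup>2))"
          using Re_sq[of u] u eps unfolding ImT[symmetric] by (auto simp: S)
        also have "\<dots> = exp \<epsilon> * exp (-(\<epsilon> / 2) * T\<^sup>2)"
          unfolding exp_add[symmetric] by (simp add: algebra_simps)
        also have "\<dots> \<le> B * exp \<epsilon>"
          using N[of T] T by simp
        finally show ?thesis .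
      next
        have *: "norm (F u) \<le> B * exp \<epsilon>" if "Re u = 0 \<or> Re u = b"
        proof -
          have "\<epsilon> * ((Re u)\<^sup>2 - (Im u)\<^sup>2) \<le> \<epsilon> * 1"
            using Re_sq[of u] u eps by (intro mult_left_mono) (auto simp: S intro: order_trans[of _ "(Re u)\<^sup>2"])
          thus ?thesis
            unfolding norm_F using bd[OF that] B by (intro mult_mono) auto
        qed
        assume "Re u = 0"
        thus ?thesis using * by blast
      next
        have *: "norm (F u) \<le> B * exp \<epsilon>" if "Re u = 0 \<or> Re u = b"
        proof -
          have "\<epsilon> * ((Re u)\<^sup>2 - (Im u)\<^sup>2) \<le> \<epsilon> * 1"
            using Re_sq[of u] u eps by (intro mult_left_mono) (auto simp: S intro: order_trans[of _ "(Re u)\<^sup>2"])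
          thus ?thesis
            unfolding norm_F using bd[OF that] B by (intro mult_mono) auto
        qed
        assume "Re u = b"
        thus ?thesis using * by blast
      qed
    qed
    hence "norm (f z) * exp (\<epsilon> * ((Re z)\<^sup>2 - (Im z)\<^sup>2)) * exp (\<epsilon> * (Im z)\<^sup>2) \<le> B * exp \<epsilon> * exp (\<epsilon> * (Im z)\<^sup>2)"
      unfolding norm_F by (intro mult_right_mono) auto
    moreover have "exp (\<epsilon> * ((Re z)\<^sup>2 - (Im z)\<^sup>2)) * exp (\<epsilon> * (Im z)\<^sup>2) = exp (\<epsilon> * (Re z)\<^sup>2)"
      unfolding exp_add[symmetric] by (simp add: algebra_simps)
    moreover have "norm (f z) * 1 \<le> norm (f z) * exp (\<epsilon> * (Re z)\<^sup>2)"
      using eps by (intro mult_left_mono) auto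
    ultimately show ?thesis by (simp add: mult.assoc)
  qed
  have "((\<lambda>\<epsilon>. B * exp \<epsilon> * exp (\<epsilon> * (Im z)\<^sup>2)) \<longlongrightarrow> B * exp 0 * exp (0 * (Im z)\<^sup>2)) (at_right 0)"
    by (intro tendsto_intros)
  moreover have "\<forall>\<^sub>F \<epsilon> in at_right 0. norm (f z) \<le> B * exp \<epsilon> * exp (\<epsilon> * (Im z)\<^sup>2)"
    using eventually_at_right_less[of 0] by eventually_elim (rule main)
  ultimately have "norm (f z) \<le> B * exp 0 * exp (0 * (Im z)\<^sup>2)"
    by (rule tendsto_lowerbound) auto
  thus ?thesis by simp
qed

text \<open>At a zero of order \<open>k\<close> write \<open>L s = (s - z)^k * g s\<close>; then
  \<open>deriv L s = (s - z)^(k - 1) * D s\<close> with \<open>D z = k * g z\<close> nonzero, and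
  the quotient is \<open>(s - z) * g s / D s\<close>. The value 0 at zeros of \<open>L\<close> is
  thus the analytic one, also at multiple zeros, where the plain quotient is 0 / 0.\<close>

lemma analytic_quotient_deriv:
  assumes L: "L holomorphic_on UNIV" and nz: "L w \<noteq> 0"
    and z: "L z = 0 \<or> deriv L z \<noteq> 0"
  shows "(\<lambda>s. if L s = 0 then 0 else L s / deriv L s) analytic_on {z}"
proof -
  define H where "H = (\<lambda>s. if L s = 0 then 0 else L s / deriv L s)"
  have dL: "deriv L holomorphic_on UNIV"
    by (rule holomorphic_deriv[OF L open_UNIV])
  show "H analytic_on {z}"
  proof (cases "L z = 0")
    case False
    hence dz: "deriv L z \<noteq> 0" using z by simp
    have "open (L -` (-{0}) \<inter> deriv L -` (-{0}))"
      using L dL by (intro open_Int open_vimage holomorphic_on_imp_continuous_on) auto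
    then obtain e where e: "e > 0" "ball z e \<subseteq> L -` (-{0}) \<inter> deriv L -` (-{0})"
      using False dz by (force simp: open_contains_ball)
    have "(\<lambda>s. L s / deriv L s) holomorphic_on ball z e"
      using e by (intro holomorphic_intros holomorphic_on_subset[OF L] holomorphic_on_subset[OF dL]) auto
    hence "H holomorphic_on ball z e"
      by (rule holomorphic_transform) (use e in \<open>auto simp: H_def\<close>)
    thus ?thesis
      using e by (auto simp: analytic_at_ball)
  next
    case True
    obtain g k where g: "g holomorphic_on UNIV" "g z \<noteq> 0" "\<And>s. L s = (s - z) ^ k * g s"
      using holomorphic_UNIV_factor_zero[OF L nz, of z] by blast
    have k: "k > 0" using True g by (cases k) auto
    have dg: "deriv g holomorphic_on UNIV"
      by (rule holomorphic_deriv[OF g(1) open_UNIV])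
    define D where "D = (\<lambda>s. of_nat k * g s + (s - z) * deriv g s)"
    have D: "D holomorphic_on UNIV"
      unfolding D_def by (intro holomorphic_intros g dg)
    have "open (g -` (-{0}) \<inter> D -` (-{0}))"
      using g(1) D by (intro open_Int open_vimage holomorphic_on_imp_continuous_on) auto
    then obtain e where e: "e > 0" "ball z e \<subseteq> g -` (-{0}) \<inter> D -` (-{0})"
      using g(2) k by (force simp: open_contains_ball D_def)
    have dLeq: "deriv L s = (s - z) ^ (k - 1) * D s" for s
    proof -
      have "((\<lambda>s. (s - z) ^ k * g s) has_field_derivative
          (of_nat k * (s - z) ^ (k - 1)) * g s + deriv g s * (s - z) ^ k) (at s)"
        using holomorphic_derivI[OF g(1) open_UNIV UNIV_I] by (auto intro!: derivative_eq_intros)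
      moreover have "L = (\<lambda>s. (s - z) ^ k * g s)" using g(3) by auto
      ultimately have "deriv L s = (of_nat k * (s - z) ^ (k - 1)) * g s + deriv g s * (s - z) ^ k"
        by (simp add: DERIV_imp_deriv)
      also have "(s - z) ^ k = (s - z) ^ (k - 1) * (s - z)"
        using k by (metis power_minus_mult)
      finally show ?thesis by (simp add: D_def algebra_simps)
    qed
    have "(\<lambda>s. (s - z) * g s / D s) holomorphic_on ball z e"
      using e by (intro holomorphic_intros holomorphic_on_subset[OF g(1)] holomorphic_on_subset[OF D]) auto
    hence "H holomorphic_on ball z e"
    proof (rule holomorphic_transform)
      fix s assume s: "s \<in> ball z e"
      have nz: "g s \<noteq> 0" "D s \<noteq> 0" using e s by auto
      have "(s - z) ^ k = (s - z) ^ (k - 1) * (s - z)"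
        using k by (metis power_minus_mult)
      thus "(s - z) * g s / D s = H s"
        using nz k by (cases "s = z") (auto simp: H_def g(3) dLeq)
    qed
    thus ?thesis
      using e by (auto simp: analytic_at_ball)
  qed
qed

text \<open>
  \<open>L / L'\<close> is bounded on the boundary of the strip, where it has nonpositive real part; two
  applications of Phragmen-Lindelof transport both properties to the interior, where an interior
  zero would be a maximum of the real part.
\<close>
lemma deriv_zero_free_imp_zero_free:
  assumes L: "L holomorphic_on UNIV" and gL: "growth L" and nz: "L w \<noteq> 0"
    and b: "0 < b" "b \<le> 1" and c: "c > 0"
    and bd: "\<And>s. Re s = 0 \<or> Re s = b \<Longrightarrow> L s \<noteq> 0 \<Longrightarrow> Re (deriv L s / L s) \<le> -c"
    and dnz: "\<And>s. 0 < Re s \<Longrightarrow> Re s < b \<Longrightarrow> deriv L s \<noteq> 0"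
    and s: "0 < Re s" "Re s < b"
  shows "L s \<noteq> 0"
proof
  assume Ls: "L s = 0"
  define H where "H = (\<lambda>s. if L s = 0 then 0 else L s / deriv L s)"
  have bd': "Re z = 0 \<or> Re z = b \<Longrightarrow> L z \<noteq> 0 \<Longrightarrow> deriv L z \<noteq> 0" for z
    using bd[of z] c by auto
  have ana: "H analytic_on {z}" if "0 \<le> Re z" "Re z \<le> b" for z
    unfolding H_def by (rule analytic_quotient_deriv[OF L nz]) (use that bd'[of z] dnz[of z] in force)
  have "H analytic_on {z. 0 \<le> Re z \<and> Re z \<le> b}"
    using ana unfolding analytic_on_def by blast
  hence "H holomorphic_on {z. 0 \<le> Re z \<and> Re z \<le> b}"
    by (rule analytic_imp_holomorphic)
  hence cont: "continuous_on {z. 0 \<le> Re z \<and> Re z \<le> b} H"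
    and hol: "H holomorphic_on {z. 0 < Re z \<and> Re z < b}"
    by (auto intro: holomorphic_on_imp_continuous_on holomorphic_on_subset)
  \<comment> \<open>The logarithmic derivative lies in the half-plane of real part at most
    \<open>-c\<close>; inversion maps that half-plane into the left half-plane and into the disc of
    radius \<open>1 / c\<close>.\<close>
  have bdH: "norm (H z) \<le> 1 / c \<and> Re (H z) \<le> 0" if z: "Re z = 0 \<or> Re z = b" for z
  proof (cases "L z = 0")
    case False
    define G where "G = deriv L z / L z"
    have G: "Re G \<le> -c" using bd[OF z False] by (simp add: G_def)
    have HG: "H z = 1 / G" using False by (simp add: H_def G_def)
    have "c \<le> norm G"
      using G abs_Re_le_cmod[of G] by linarith
    hence "norm (H z) \<le> 1 / c"
      using c unfolding HG norm_divide by (auto intro!: divide_left_mono mult_pos_pos)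
    moreover have "Re (H z) \<le> 0"
      using G c unfolding HG by (auto simp: Re_divide intro!: divide_nonpos_nonneg)
    ultimately show ?thesis by blast
  qed (use c in \<open>auto simp: H_def\<close>)
  have dL: "deriv L holomorphic_on UNIV"
    by (rule holomorphic_deriv[OF L open_UNIV])
  have dLnz: "deriv L s' \<noteq> 0" if "s' = of_real (b/2)" for s' :: complex
    unfolding that by (rule dnz) (use b in auto)
  obtain C where C: "C > 0" "\<And>z. norm (L z) \<le> exp (C * (1 + norm z) powr (3/2))"
    using gL by (auto simp: growth_def)
  have H_le: "norm (H z) \<le> 1 / c" if "0 \<le> Re z" "Re z \<le> b" for z
  proof (rule Phragmen_Lindelof_strip[OF hol cont b _ _ _ that])
    fix \<epsilon> N :: real assume eps: "\<epsilon> > 0"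
    have "((\<lambda>T. C * (2 + T) powr (3/2) / T\<^sup>2) \<longlongrightarrow> 0) at_top"
      using C(1) by real_asymp
    hence "\<forall>\<^sub>F T in at_top. C * (2 + T) powr (3/2) / T\<^sup>2 < \<epsilon> / 2"
      using eps by (intro order_tendstoD) auto
    then obtain N' where N': "\<And>T. T \<ge> N' \<Longrightarrow> C * (2 + T) powr (3/2) / T\<^sup>2 < \<epsilon> / 2"
      by (auto simp: eventually_at_top_linorder)
    \<comment> \<open>At these heights \<open>L\<close> is at most
      \<open>exp (\<epsilon> / 2 * T^2)\<close> by its growth and \<open>deriv L\<close> is at least
      \<open>exp (- \<epsilon> / 2 * T^2)\<close>, so the quotient meets the growth
      condition.\<close>
    obtain T where T: "T \<ge> max N (max N' 1)" and dT:
      "\<And>z. \<bar>Re z\<bar> \<le> 1 \<Longrightarrow> \<bar>Im z\<bar> = T \<Longrightarrow> exp (- (\<epsilon> / 2) * T\<^sup>2) \<le> norm (deriv L z)"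
      using min_modulus_horizontal[OF dL growth_deriv[OF gL L] dLnz[OF refl], of "\<epsilon> / 2" "max N (max N' 1)"]
        eps by auto
    show "\<exists>T\<ge>N. \<forall>z. 0 \<le> Re z \<longrightarrow> Re z \<le> b \<longrightarrow> \<bar>Im z\<bar> = T \<longrightarrow> norm (H z) \<le> exp (\<epsilon> * T\<^sup>2)"
    proof (intro exI[of _ T] conjI allI impI)
      show "N \<le> T" using T by simp
      fix z assume z: "0 \<le> Re z" "Re z \<le> b" "\<bar>Im z\<bar> = T"
      show "norm (H z) \<le> exp (\<epsilon> * T\<^sup>2)"
      proof (cases "L z = 0")
        case False
        have "norm z \<le> 1 + T"
          using cmod_le[of z] z b by simp
        hence "(1 + norm z) powr (3/2) \<le> (2 + T) powr (3/2)"
          by (intro powr_mono2) auto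
        hence "C * (1 + norm z) powr (3/2) \<le> C * (2 + T) powr (3/2)"
          using C by simp
        also have "\<dots> \<le> \<epsilon> / 2 * T\<^sup>2"
          using N'[of T] T by (simp add: pos_divide_less_eq)
        finally have "norm (L z) \<le> exp (\<epsilon> / 2 * T\<^sup>2)"
          using C(2)[of z] by (meson exp_le_cancel_iff order_trans)
        moreover have "exp (- (\<epsilon> / 2) * T\<^sup>2) \<le> norm (deriv L z)"
          using z b by (intro dT) auto
        ultimately have "norm (L z) / norm (deriv L z) \<le> exp (\<epsilon> / 2 * T\<^sup>2) / exp (- (\<epsilon> / 2) * T\<^sup>2)"
          by (intro frac_le) auto
        also have "\<dots> = exp (\<epsilon> * T\<^sup>2)"
          unfolding exp_diff[symmetric] by (simp add: algebra_simps)
        finally show ?thesis using False by (simp add: H_def norm_divide)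
      qed (auto simp: H_def)
    qed
  qed (use bdH c in auto)
  \<comment> \<open>A nonpositive real part means that the exponential has modulus at most 1. The
    growth condition for the exponential is met because \<open>H\<close> is already known to be
    bounded.\<close>
  have Re_H: "norm (exp (H z)) \<le> 1" if "0 \<le> Re z" "Re z \<le> b" for z
  proof (rule Phragmen_Lindelof_strip[OF _ _ b _ _ _ that])
    show "(\<lambda>z. exp (H z)) holomorphic_on {z. 0 < Re z \<and> Re z < b}"
      by (intro holomorphic_intros hol)
    show "continuous_on {z. 0 \<le> Re z \<and> Re z \<le> b} (\<lambda>z. exp (H z))"
      by (intro continuous_intros cont)
    fix \<epsilon> N :: real assume eps: "\<epsilon> > 0"
    have "\<forall>\<^sub>F T in at_top. 1 / c \<le> \<epsilon> * T\<^sup>2"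
      using eps by real_asymp
    then obtain N' where N': "\<And>T. T \<ge> N' \<Longrightarrow> 1 / c \<le> \<epsilon> * T\<^sup>2"
      by (auto simp: eventually_at_top_linorder)
    show "\<exists>T\<ge>N. \<forall>z. 0 \<le> Re z \<longrightarrow> Re z \<le> b \<longrightarrow> \<bar>Im z\<bar> = T \<longrightarrow> norm (exp (H z)) \<le> exp (\<epsilon> * T\<^sup>2)"
    proof (intro exI[of _ "max N N'"] conjI allI impI)
      fix z assume "0 \<le> Re z" "Re z \<le> b"
      hence "Re (H z) \<le> 1 / c"
        using H_le[of z] complex_Re_le_cmod[of "H z"] by linarith
      also have "\<dots> \<le> \<epsilon> * (max N N')\<^sup>2" by (rule N') simp
      finally show "norm (exp (H z)) \<le> exp (\<epsilon> * (max N N')\<^sup>2)" by simp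
    qed auto
  qed (use bdH in auto)
  define S where "S = {z. 0 < Re z \<and> Re z < b}"
  have S: "open S" "connected S"
  proof -
    have *: "S = {z. Re z > 0} \<inter> {z. Re z < b}" by (auto simp: S_def)
    show "open S" unfolding * by (intro open_Int open_halfspace_Re_gt open_halfspace_Re_lt)
    show "connected S" unfolding * by (intro convex_connected convex_Int convex_halfspace_Re_gt convex_halfspace_Re_lt)
  qed
  \<comment> \<open>\<open>H\<close> vanishes at the supposed zero \<open>s\<close>, so the modulus
    of \<open>exp (H z)\<close> attains its upper bound 1 at an interior point.\<close>
  have "(\<lambda>z. exp (H z)) constant_on S"
  proof (rule maximum_modulus_principle[where U = S and \<xi> = s])
    show "(\<lambda>z. exp (H z)) holomorphic_on S"
      unfolding S_def by (intro holomorphic_intros hol)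
    show "s \<in> S" using s by (simp add: S_def)
    fix z assume "z \<in> S"
    thus "norm (exp (H z)) \<le> norm (exp (H s))"
      using Re_H[of z] Ls by (auto simp: S_def H_def)
  qed (use S in auto)
  hence "exp (H z) = exp (H s)" if "z \<in> S" for z
    using that s unfolding constant_on_def S_def by auto
  hence expH: "exp (H z) = 1" if "z \<in> S" for z
    using that Ls by (auto simp: H_def)
  have holS: "H holomorphic_on S" using hol by (simp add: S_def)
  have "(H has_field_derivative 0) (at z)" if z: "z \<in> S" for z
  proof -
    have "\<forall>\<^sub>F u in nhds z. u \<in> S" using S z by (intro eventually_nhds_in_open)
    hence ev: "\<forall>\<^sub>F u in nhds z. exp (H u) = 1" by eventually_elim (rule expH)
    have dH: "(H has_field_derivative deriv H z) (at z)"
      by (rule holomorphic_derivI[OF holS S(1) z])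
    hence "((\<lambda>u. exp (H u)) has_field_derivative exp (H z) * deriv H z) (at z)"
      by (rule DERIV_fun_exp)
    hence "exp (H z) * deriv H z = deriv (\<lambda>u. exp (H u)) z"
      by (rule DERIV_imp_deriv[symmetric])
    also have "\<dots> = deriv (\<lambda>_. 1) z"
      by (rule deriv_cong_ev[OF ev refl])
    finally show ?thesis using dH by simp
  qed
  hence "\<forall>z\<in>S - {}. (H has_field_derivative 0) (at z)" by blast
  then obtain d where d: "\<And>z. z \<in> S \<Longrightarrow> H z = d"
    using DERIV_zero_connected_constant[OF S(2) S(1) finite.emptyI
        holomorphic_on_imp_continuous_on[OF holS]] by metis
  have "d = 0"
    using d[of s] s Ls by (simp add: S_def H_def)
  with d have H0: "H z = 0" if "z \<in> S" for z
    using that by simp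
  \<comment> \<open>Off the zeros of \<open>L\<close> the quotient is nonzero, as
    \<open>deriv L\<close> does not vanish in the strip. So \<open>H = 0\<close> makes
    \<open>L\<close> vanish on the whole strip and hence everywhere.\<close>
  have "L z = 0" if "z \<in> S" for z
    using H0[OF that] dnz[of z] that by (auto simp: H_def S_def split: if_splits)
  have "L w = 0"
  proof (rule analytic_continuation[OF L open_UNIV connected_UNIV subset_UNIV UNIV_I])
    show "s islimpt S"
      using S s by (intro interior_limit_point) (auto simp: S_def interior_open)
  qed (use \<open>\<And>z. z \<in> S \<Longrightarrow> L z = 0\<close> in auto)
  with nz show False by simp
qed

subsection \<open>Dirichlet series with periodic coefficients\<close>

lemma holomorphic_suminf_local:
  fixes f :: "nat \<Rightarrow> complex \<Rightarrow> complex"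
  assumes S: "open S" and f: "\<And>n. f n holomorphic_on S"
    and h: "\<And>x. x \<in> S \<Longrightarrow> \<exists>d>0. \<exists>h. summable h \<and> (\<forall>n. \<forall>y\<in>ball x d \<inter> S. norm (f n y) \<le> h n)"
  shows "(\<lambda>x. \<Sum>n. f n x) holomorphic_on S" and "\<And>x. x \<in> S \<Longrightarrow> summable (\<lambda>n. f n x)"
    and "\<And>x. x \<in> S \<Longrightarrow> (\<lambda>n. deriv (f n) x) sums deriv (\<lambda>x. \<Sum>n. f n x) x"
proof -
  have "\<exists>g g'. \<forall>x \<in> S. ((\<lambda>n. f n x) sums g x) \<and> ((\<lambda>n. deriv (f n) x) sums g' x) \<and> (g has_field_derivative g' x) (at x)"
  proof (rule series_and_derivative_comparison_local[OF S])
    show "(f n has_field_derivative deriv (f n) x) (at x)" if "x \<in> S" for n x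
      by (rule holomorphic_derivI[OF f S that])
    fix x assume "x \<in> S"
    then obtain d h where "d > 0" "summable h" "\<forall>n. \<forall>y\<in>ball x d \<inter> S. norm (f n y) \<le> h n"
      using h by blast
    thus "\<exists>d h. 0 < d \<and> summable h \<and> (\<forall>\<^sub>F n in sequentially. \<forall>y\<in>ball x d \<inter> S. norm (f n y) \<le> h n)"
      by (intro exI[of _ d] exI[of _ h]) auto
  qed
  then obtain g g' where g: "\<And>x. x \<in> S \<Longrightarrow> (\<lambda>n. f n x) sums g x"
    "\<And>x. x \<in> S \<Longrightarrow> (\<lambda>n. deriv (f n) x) sums g' x"
    "\<And>x. x \<in> S \<Longrightarrow> (g has_field_derivative g' x) (at x)"
    by metis
  have eq: "(\<Sum>n. f n x) = g x" if "x \<in> S" for x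
    using g(1)[OF that] by (simp add: sums_iff)
  have "(g has_field_derivative g' x) (at x within S)" if "x \<in> S" for x
    by (rule has_field_derivative_at_within[OF g(3)[OF that]])
  hence "g holomorphic_on S"
    unfolding holomorphic_on_def field_differentiable_def by blast
  thus "(\<lambda>x. \<Sum>n. f n x) holomorphic_on S"
    by (rule holomorphic_transform) (simp add: eq)
  show "summable (\<lambda>n. f n x)" if "x \<in> S" for x
    using g(1)[OF that] by (simp add: sums_iff)
  show "(\<lambda>n. deriv (f n) x) sums deriv (\<lambda>x. \<Sum>n. f n x) x" if "x \<in> S" for x
  proof -
    have "\<forall>\<^sub>F y in nhds x. y \<in> S"
      using S that by (intro eventually_nhds_in_open)
    hence "\<forall>\<^sub>F y in nhds x. (\<Sum>n. f n y) = g y"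
      by eventually_elim (rule eq)
    hence "deriv (\<lambda>x. \<Sum>n. f n x) x = deriv g x"
      by (rule deriv_cong_ev) simp
    also have "\<dots> = g' x"
      by (rule DERIV_imp_deriv[OF g(3)[OF that]])
    finally show ?thesis using g(2)[OF that] by simp
  qed
qed

text \<open>Mean value estimate along the real segment. For \<open>Re s\<close> at least -1 the
  modulus of the derivative decreases, so it is largest at the left end \<open>a\<close>.\<close>

lemma powr_diff_bound:
  fixes a b :: real
  assumes a: "0 < a" and ab: "a \<le> b" and s: "Re s \<ge> -1"
  shows "norm (of_real b powr (-s) - of_real a powr (-s)) \<le> norm s * (b - a) * a powr (-Re s - 1)"
proof -
  let ?S = "closed_segment (complex_of_real a) (complex_of_real b)"
  have seg: "\<exists>x. z = of_real x \<and> a \<le> x" if z: "z \<in> ?S" for z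
  proof -
    obtain x where "x \<in> closed_segment a b" "z = of_real x"
      using z closed_segment_of_real[of a b, where ?'a = complex] by auto
    thus ?thesis using ab by (auto simp: closed_segment_eq_real_ivl)
  qed
  have "norm (of_real b powr (-s) - of_real a powr (-s)) \<le>
          (norm s * a powr (-Re s - 1)) * norm (complex_of_real b - complex_of_real a)"
  proof (rule field_differentiable_bound[of ?S _ "\<lambda>z. - s * z powr (-s - 1)"])
    fix z assume "z \<in> ?S"
    then obtain x where x: "z = of_real x" "a \<le> x" using seg by blast
    show "((\<lambda>z. z powr (-s)) has_field_derivative - s * z powr (-s - 1)) (at z within ?S)"
      using x a by (intro has_field_derivative_at_within[OF has_field_derivative_powr]) (auto simp: complex_nonpos_Reals_iff)
    have "norm (z powr (-s - 1)) = x powr (-Re s - 1)"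
      using x a by (simp add: norm_powr_real_powr)
    also have "\<dots> \<le> a powr (-Re s - 1)"
      using x a s by (intro powr_mono2') auto
    finally show "norm (- s * z powr (-s - 1)) \<le> norm s * a powr (-Re s - 1)"
      by (simp add: norm_mult mult_left_mono)
  qed auto
  also have "norm (complex_of_real b - complex_of_real a) = b - a"
    using ab by (metis abs_of_nonneg diff_ge_0_iff_ge norm_of_real of_real_diff)
  finally show ?thesis by (simp add: mult_ac)
qed

definition dterm :: "(nat \<Rightarrow> complex) \<Rightarrow> complex \<Rightarrow> nat \<Rightarrow> complex" where
  "dterm c s n = c (Suc n) * of_nat (Suc n) powr (-s)"

lemma norm_nat_powr: "norm (of_nat (Suc n) powr (s :: complex)) = real (Suc n) powr Re s"
  by (subst norm_powr_real_powr) (auto simp del: of_nat_Suc)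

lemma summable_Suc_powr: "\<sigma> > 1 \<Longrightarrow> summable (\<lambda>n. real (Suc n) powr (-\<sigma>))"
  using summable_real_powr_iff[of "-\<sigma>"] summable_Suc_iff[of "\<lambda>n. real n powr (-\<sigma>)"] by simp

lemma norm_dterm_le:
  assumes "\<And>n. norm (c n) \<le> M" "\<sigma> \<le> Re s"
  shows "norm (dterm c s n) \<le> M * real (Suc n) powr (-\<sigma>)"
  unfolding dterm_def norm_mult norm_nat_powr
  using assms order_trans[OF norm_ge_zero assms(1)]
  by (intro mult_mono powr_mono) auto

lemma holomorphic_dterm: "(\<lambda>s. dterm c s n) holomorphic_on A"
  unfolding dterm_def by (intro holomorphic_intros) (auto simp del: of_nat_Suc)

lemma
  assumes M: "\<And>n. norm (c n) \<le> M"
  shows summable_norm_dterm: "Re s > 1 \<Longrightarrow> summable (\<lambda>n. norm (dterm c s n))"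
    and summable_dterm: "Re s > 1 \<Longrightarrow> summable (dterm c s)"
    and holomorphic_dseries: "(\<lambda>s. \<Sum>n. dterm c s n) holomorphic_on {s. Re s > 1}"
    and deriv_dseries: "Re s > 1 \<Longrightarrow> (\<lambda>n. deriv (\<lambda>s. dterm c s n) s) sums deriv (\<lambda>s. \<Sum>n. dterm c s n) s"
proof -
  show *: "summable (\<lambda>n. norm (dterm c s n))" if "Re s > 1" for s
    by (rule summable_comparison_test'[OF summable_mult[OF summable_Suc_powr[OF that]]])
       (use norm_dterm_le[OF M order_refl] in auto)
  thus "Re s > 1 \<Longrightarrow> summable (dterm c s)"
    by (rule summable_norm_cancel)
  have ex: "\<exists>d>0. \<exists>h. summable h \<and> (\<forall>n. \<forall>y\<in>ball x d \<inter> {s. Re s > 1}. norm (dterm c y n) \<le> h n)"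
    if x: "x \<in> {s. Re s > 1}" for x
  proof (intro exI conjI allI ballI)
    define d where "d = (Re x - 1) / 2"
    show "d > 0" using x by (simp add: d_def)
    show "summable (\<lambda>n. M * real (Suc n) powr (-((Re x + 1) / 2)))"
      using x by (intro summable_mult summable_Suc_powr) auto
    fix n y assume "y \<in> ball x d \<inter> {s. Re s > 1}"
    hence "\<bar>Re (x - y)\<bar> < d"
      using abs_Re_le_cmod[of "x - y"] by (simp add: dist_norm)
    hence "(Re x + 1) / 2 \<le> Re y"
      using abs_ge_self[of "Re (x - y)"] by (simp add: d_def field_simps)
    thus "norm (dterm c y n) \<le> M * real (Suc n) powr (-((Re x + 1) / 2))"
      by (rule norm_dterm_le[OF M])
  qed
  show "(\<lambda>s. \<Sum>n. dterm c s n) holomorphic_on {s. Re s > 1}"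
    by (rule holomorphic_suminf_local(1)[OF open_halfspace_Re_gt holomorphic_dterm ex])
  show "(\<lambda>n. deriv (\<lambda>s. dterm c s n) s) sums deriv (\<lambda>s. \<Sum>n. dterm c s n) s" if "Re s > 1"
    by (rule holomorphic_suminf_local(3)[OF open_halfspace_Re_gt holomorphic_dterm ex]) (use that in auto)
qed

lemma deriv_dterm: "deriv (\<lambda>s. dterm c s n) s = - of_real (ln (real (Suc n))) * dterm c s n"
proof (rule DERIV_imp_deriv)
  have "((\<lambda>z. of_nat (Suc n) powr z) has_field_derivative
      Ln (of_nat (Suc n)) * of_nat (Suc n) powr (-s)) (at (-s))"
    by (rule has_field_derivative_powr_right) (simp del: of_nat_Suc)
  moreover have "(uminus has_field_derivative -1) (at s)"
    by (auto intro!: derivative_eq_intros)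
  ultimately have "((\<lambda>s. of_nat (Suc n) powr (-s)) has_field_derivative
      Ln (of_nat (Suc n)) * of_nat (Suc n) powr (-s) * (-1)) (at s)"
    by (rule DERIV_chain2)
  from DERIV_cmult[OF this, of "c (Suc n)"]
  show "((\<lambda>s. dterm c s n) has_field_derivative - of_real (ln (real (Suc n))) * dterm c s n) (at s)"
    by (simp add: dterm_def Ln_of_nat mult_ac del: of_nat_Suc)
qed

text \<open>Collects what makes a Dirichlet series continue to \<open>Re s > 0\<close>: cancellation
  over each period. It is instantiated with a character, with its conjugate, and with the square of
  a character minus its mean value.\<close>

locale periodic_mean_zero =
  fixes c :: "nat \<Rightarrow> complex" and q :: nat and M :: real
  assumes q_pos: "q > 0" and periodic: "\<And>n. c (n + q) = c n"
    and c_le: "\<And>n. norm (c n) \<le> M" and mean_zero: "(\<Sum>i<q. c (Suc i)) = 0"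
begin

lemma M_nonneg: "M \<ge> 0"
  using order_trans[OF norm_ge_zero c_le] .

lemma periodic_mult: "c (n * q + i) = c i"
proof (induction n)
  case (Suc n)
  have "c (Suc n * q + i) = c ((n * q + i) + q)" by (simp add: algebra_simps)
  thus ?case using Suc periodic by simp
qed simp

lemma periodic_Suc: "c (Suc (n * q + i)) = c (Suc i)"
  using periodic_mult[of n "Suc i"] by simp

text \<open>Summing over whole periods gives a series that converges absolutely for
  \<open>Re s > 0\<close>, although the ungrouped terms do so only for
  \<open>Re s > 1\<close>.\<close>

definition block :: "complex \<Rightarrow> nat \<Rightarrow> complex" where
  "block s n = (\<Sum>i<q. c (Suc i) * of_nat (Suc (n * q + i)) powr (-s))"

lemma block_eq: "block s n = sum (dterm c s) {n * q..<n * q + q}"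
proof -
  have "sum (dterm c s) {n * q..<n * q + q} = (\<Sum>i<q. dterm c s (n * q + i))"
    using sum.shift_bounds_nat_ivl[of "dterm c s" 0 "n * q" q]
    by (simp add: add.commute atLeast0LessThan)
  thus ?thesis by (simp add: block_def dterm_def periodic_Suc)
qed

lemma block_sum_diff:
  fixes g :: "nat \<Rightarrow> complex"
  shows "(\<Sum>i<q. c (Suc i) * g i) = (\<Sum>i<q. c (Suc i) * (g i - g 0))"
  using mean_zero by (simp add: algebra_simps sum_subtractf flip: sum_distrib_left sum_distrib_right)

text \<open>As the coefficients of a period add up to 0, the first power of the block may be
  subtracted from every power; the differences gain a factor \<open>1 / n\<close>.\<close>

lemma norm_block_le:
  assumes s: "Re s \<ge> -1"
  shows "norm (block s n) \<le> (M * real q ^ 2 * norm s) * real (Suc n) powr (-Re s - 1)"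
proof -
  have "block s n = (\<Sum>i<q. c (Suc i) * (of_nat (Suc (n * q + i)) powr (-s) - of_nat (Suc (n * q + 0)) powr (-s)))"
    unfolding block_def by (rule block_sum_diff)
  also have "norm \<dots> \<le> (\<Sum>i<q. M * (norm s * real q * real (Suc n) powr (-Re s - 1)))"
  proof (rule sum_norm_le)
    fix i assume i: "i \<in> {..<q}"
    have "norm (of_real (real (Suc (n * q + i))) powr (-s) - of_real (real (Suc (n * q + 0))) powr (-s)) \<le>
       norm s * (real (Suc (n * q + i)) - real (Suc (n * q + 0))) * real (Suc (n * q + 0)) powr (-Re s - 1)"
      by (rule powr_diff_bound) (use s in \<open>auto intro!: add_pos_nonneg\<close>)
    also have "\<dots> \<le> norm s * real q * real (Suc n) powr (-Re s - 1)"
    proof (intro mult_mono)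
      have "n * 1 \<le> n * q" using q_pos by (intro mult_left_mono) auto
      hence "real (Suc n) \<le> real (Suc (n * q + 0))" unfolding of_nat_le_iff by simp
      thus "real (Suc (n * q + 0)) powr (-Re s - 1) \<le> real (Suc n) powr (-Re s - 1)"
        using s by (intro powr_mono2') auto
    qed (use i in auto)
    finally show "norm (c (Suc i) * (of_nat (Suc (n * q + i)) powr (-s) - of_nat (Suc (n * q + 0)) powr (-s)))
       \<le> M * (norm s * real q * real (Suc n) powr (-Re s - 1))"
      unfolding norm_mult using c_le M_nonneg by (intro mult_mono) (auto simp del: of_nat_Suc of_nat_add of_nat_mult)
  qed
  also have "\<dots> = (M * real q ^ 2 * norm s) * real (Suc n) powr (-Re s - 1)"
    by (simp add: power2_eq_square)
  finally show ?thesis .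
qed

definition D :: "complex \<Rightarrow> complex" where
  "D s = (\<Sum>n. block s n)"

lemma
  shows holomorphic_D: "D holomorphic_on {s. Re s > 0}"
    and summable_block: "Re s > 0 \<Longrightarrow> summable (block s)"
proof -
  have hol: "(\<lambda>s. block s n) holomorphic_on {s. Re s > 0}" for n
    unfolding block_def by (intro holomorphic_intros) (auto simp del: of_nat_Suc)
  have ex: "\<exists>d>0. \<exists>h. summable h \<and> (\<forall>n. \<forall>y\<in>ball x d \<inter> {s. Re s > 0}. norm (block y n) \<le> h n)"
    if x: "x \<in> {s. Re s > 0}" for x
  proof (intro exI conjI allI ballI)
    define d where "d = Re x / 2"
    show "d > 0" using x by (simp add: d_def)
    have "summable (\<lambda>n. real (Suc n) powr (-(Re x / 2 + 1)))"
      using x by (intro summable_Suc_powr) auto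
    thus "summable (\<lambda>n. (M * real q ^ 2 * (norm x + d)) * real (Suc n) powr (-(Re x / 2 + 1)))"
      by (intro summable_mult)
    fix n y assume y: "y \<in> ball x d \<inter> {s. Re s > 0}"
    hence "\<bar>Re (x - y)\<bar> < d"
      using abs_Re_le_cmod[of "x - y"] by (simp add: dist_norm)
    hence Rey: "Re x / 2 \<le> Re y"
      using abs_ge_self[of "Re (x - y)"] by (simp add: d_def field_simps)
    have ny: "norm y \<le> norm x + d"
      using y norm_triangle_ineq2[of y x] by (simp add: dist_norm norm_minus_commute)
    have "norm (block y n) \<le> (M * real q ^ 2 * norm y) * real (Suc n) powr (-Re y - 1)"
      using y by (intro norm_block_le) auto
    also have "\<dots> \<le> (M * real q ^ 2 * (norm x + d)) * real (Suc n) powr (-(Re x / 2 + 1))"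
      using Rey ny M_nonneg order_trans[OF norm_ge_zero ny]
      by (intro mult_mono powr_mono mult_nonneg_nonneg) auto
    finally show "norm (block y n) \<le> (M * real q ^ 2 * (norm x + d)) * real (Suc n) powr (-(Re x / 2 + 1))" .
  qed
  show "D holomorphic_on {s. Re s > 0}"
    unfolding D_def using holomorphic_suminf_local(1)[OF open_halfspace_Re_gt hol ex] by simp
  show "Re s > 0 \<Longrightarrow> summable (block s)"
    using holomorphic_suminf_local(2)[OF open_halfspace_Re_gt hol ex] by simp
qed

lemma D_eq_dseries:
  assumes "Re s > 1"
  shows "D s = (\<Sum>n. dterm c s n)"
proof -
  have "dterm c s sums (\<Sum>n. dterm c s n)"
    using summable_dterm[OF c_le assms] by (simp add: summable_sums)
  from sums_group[OF this q_pos] show ?thesis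
    unfolding D_def block_eq by (simp add: sums_iff)
qed

text \<open>From the critical line to the right the block bound is uniformly of order
  \<open>n powr (-3/2)\<close>, so \<open>D\<close> grows at most linearly there; the other
  half-plane is reached by the functional equation.\<close>

lemma norm_D_le: "\<exists>K>0. \<forall>s. Re s \<ge> 1/2 \<longrightarrow> norm (D s) \<le> K * norm s"
proof -
  have summ: "summable (\<lambda>n. real (Suc n) powr (-(3/2)))"
    by (rule summable_Suc_powr) simp
  define S where "S = (\<Sum>n. real (Suc n) powr (-(3/2)))"
  have S: "S \<ge> 0" unfolding S_def by (intro suminf_nonneg summ) auto
  show ?thesis
  proof (intro exI[of _ "M * real q ^ 2 * S + 1"] conjI allI impI)
    show "M * real q ^ 2 * S + 1 > 0"
      using M_nonneg S by (simp add: add_nonneg_pos)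
    fix s assume s: "Re s \<ge> 1/2"
    have b: "norm (block s n) \<le> (M * real q ^ 2 * norm s) * real (Suc n) powr (-(3/2))" for n
    proof -
      have "norm (block s n) \<le> (M * real q ^ 2 * norm s) * real (Suc n) powr (-Re s - 1)"
        using s by (intro norm_block_le) auto
      also have "\<dots> \<le> (M * real q ^ 2 * norm s) * real (Suc n) powr (-(3/2))"
        using s M_nonneg by (intro mult_left_mono powr_mono) auto
      finally show ?thesis .
    qed
    have "norm (D s) \<le> (\<Sum>n. (M * real q ^ 2 * norm s) * real (Suc n) powr (-(3/2)))"
      unfolding D_def using b summ by (intro norm_suminf_le summable_mult) auto
    also have "\<dots> = (M * real q ^ 2 * norm s) * S"
      unfolding S_def by (rule suminf_mult[OF summ])
    also have "\<dots> \<le> (M * real q ^ 2 * S + 1) * norm s"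
      by (simp add: algebra_simps)
    finally show "norm (D s) \<le> (M * real q ^ 2 * S + 1) * norm s" .
  qed
qed

end

text \<open>
  The regularised zeta function \<open>(s - 1) \<zeta>(s)\<close>: each summand of \<open>\<zeta>(s)\<close> is compared with
  the integral of \<open>x powr (-s)\<close> over \<open>{n..n+1}\<close>.
\<close>
definition zterm :: "complex \<Rightarrow> nat \<Rightarrow> complex" where
  "zterm s n = (s - 1) * of_nat (Suc n) powr (-s) -
     (of_nat (Suc n) powr (1 - s) - of_nat (Suc (Suc n)) powr (1 - s))"

definition zreg :: "complex \<Rightarrow> complex" where
  "zreg s = 1 + (\<Sum>n. zterm s n)"

lemma norm_zterm_le:
  assumes s: "Re s \<ge> -1"
  shows "norm (zterm s n) \<le> norm (s - 1) * norm s * real (Suc n) powr (-Re s - 1)"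
proof -
  define a where "a = real (Suc n)"
  have a: "a > 0" by (simp add: a_def)
  let ?S = "closed_segment (complex_of_real a) (complex_of_real (a + 1))"
  \<comment> \<open>A function whose increment over the segment is \<open>zterm s n\<close> and
    whose derivative vanishes at the left end, which gives the extra factor
    \<open>1 / n\<close>.\<close>
  define f where "f = (\<lambda>z. z powr (1 - s) + (s - 1) * z * of_real a powr (-s))"
  have "norm (f (of_real (a + 1)) - f (of_real a)) \<le>
          (norm (s - 1) * (norm s * a powr (-Re s - 1))) * norm (complex_of_real (a + 1) - complex_of_real a)"
  proof (rule field_differentiable_bound[of ?S _ "\<lambda>z. (1 - s) * (z powr (-s) - of_real a powr (-s))"])
    fix z assume "z \<in> ?S"
    then obtain x where "x \<in> closed_segment a (a + 1)" "z = of_real x"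
      using closed_segment_of_real[of a "a + 1", where ?'a = complex] by auto
    hence x: "z = of_real x" "a \<le> x" "x \<le> a + 1" by (auto simp: closed_segment_eq_real_ivl)
    show "(f has_field_derivative (1 - s) * (z powr (-s) - of_real a powr (-s))) (at z within ?S)"
      unfolding f_def using x a
      by (auto intro!: derivative_eq_intros simp: complex_nonpos_Reals_iff algebra_simps)
    have "norm (z powr (-s) - of_real a powr (-s)) \<le> norm s * (x - a) * a powr (-Re s - 1)"
      unfolding x(1) by (rule powr_diff_bound) (use a x s in auto)
    also have "\<dots> \<le> norm s * 1 * a powr (-Re s - 1)"
      using x by (intro mult_mono) auto
    finally show "norm ((1 - s) * (z powr (-s) - of_real a powr (-s))) \<le> norm (s - 1) * (norm s * a powr (-Re s - 1))"
      by (simp add: norm_mult norm_minus_commute mult_left_mono)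
  qed auto
  moreover have "f (of_real (a + 1)) - f (of_real a) = zterm s n"
    unfolding f_def zterm_def a_def by (simp add: algebra_simps)
  ultimately show ?thesis by (simp add: a_def mult.assoc)
qed

lemma holomorphic_zreg: "zreg holomorphic_on {s. Re s > 0}"
proof -
  have hol: "(\<lambda>s. zterm s n) holomorphic_on {s. Re s > 0}" for n
    unfolding zterm_def by (intro holomorphic_intros) (auto simp del: of_nat_Suc)
  have ex: "\<exists>d>0. \<exists>h. summable h \<and> (\<forall>n. \<forall>y\<in>ball x d \<inter> {s. Re s > 0}. norm (zterm y n) \<le> h n)"
    if x: "x \<in> {s. Re s > 0}" for x
  proof (intro exI conjI allI ballI)
    define d where "d = Re x / 2"
    show "d > 0" using x by (simp add: d_def)
    have "summable (\<lambda>n. real (Suc n) powr (-(Re x / 2 + 1)))"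
      using x by (intro summable_Suc_powr) auto
    thus "summable (\<lambda>n. ((norm x + d + 1) * (norm x + d)) * real (Suc n) powr (-(Re x / 2 + 1)))"
      by (intro summable_mult)
    fix n y assume y: "y \<in> ball x d \<inter> {s. Re s > 0}"
    hence "\<bar>Re (x - y)\<bar> < d"
      using abs_Re_le_cmod[of "x - y"] by (simp add: dist_norm)
    hence Rey: "Re x / 2 \<le> Re y"
      using abs_ge_self[of "Re (x - y)"] by (simp add: d_def field_simps)
    have ny: "norm y \<le> norm x + d"
      using y norm_triangle_ineq2[of y x] by (simp add: dist_norm norm_minus_commute)
    hence ny1: "norm (y - 1) \<le> norm x + d + 1"
      using norm_triangle_ineq4[of y 1] by simp
    have "norm (zterm y n) \<le> norm (y - 1) * norm y * real (Suc n) powr (-Re y - 1)"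
      using y by (intro norm_zterm_le) auto
    also have "\<dots> \<le> ((norm x + d + 1) * (norm x + d)) * real (Suc n) powr (-(Re x / 2 + 1))"
      using Rey ny ny1 order_trans[OF norm_ge_zero ny] order_trans[OF norm_ge_zero ny1]
      by (intro mult_mono powr_mono) auto
    finally show "norm (zterm y n) \<le> ((norm x + d + 1) * (norm x + d)) * real (Suc n) powr (-(Re x / 2 + 1))" .
  qed
  show ?thesis
    unfolding zreg_def by (intro holomorphic_intros holomorphic_suminf_local(1)[OF open_halfspace_Re_gt hol ex])
qed

lemma zreg_eq:
  assumes s: "Re s > 1"
  shows "zreg s = (s - 1) * (\<Sum>n. dterm (\<lambda>_. 1) s n)"
proof -
  have "(\<lambda>n. dterm (\<lambda>_. 1) s n) sums (\<Sum>n. dterm (\<lambda>_. 1) s n)"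
    using summable_dterm[of "\<lambda>_. 1" 1 s] s by (simp add: summable_sums)
  hence 1: "(\<lambda>n. (s - 1) * dterm (\<lambda>_. 1) s n) sums ((s - 1) * (\<Sum>n. dterm (\<lambda>_. 1) s n))"
    by (rule sums_mult)
  have "(\<lambda>n. norm (of_nat (Suc n) powr (1 - s) :: complex)) \<longlonglongrightarrow> 0"
  proof -
    have "(\<lambda>n. real (Suc n) powr (1 - Re s)) \<longlonglongrightarrow> 0"
      using s by real_asymp
    thus ?thesis by (simp only: norm_nat_powr) simp
  qed
  hence "(\<lambda>n. of_nat (Suc n) powr (1 - s) :: complex) \<longlonglongrightarrow> 0"
    by (rule tendsto_norm_zero_cancel)
  \<comment> \<open>The integrals telescope to the value 1 at the first integer, which the summand 1
    in \<open>zreg\<close> compensates.\<close>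
  hence "(\<lambda>n. of_nat (Suc n) powr (1 - s) - of_nat (Suc (Suc n)) powr (1 - s) :: complex) sums (of_nat (Suc 0) powr (1 - s) - 0)"
    by (rule telescope_sums')
  from sums_diff[OF 1 this] have "zterm s sums ((s - 1) * (\<Sum>n. dterm (\<lambda>_. 1) s n) - 1)"
    unfolding zterm_def dterm_def by simp
  thus ?thesis by (simp add: zreg_def sums_iff)
qed

subsection \<open>Nonvanishing on the line of real part one\<close>

text \<open>\<open>k\<close> is the order of vanishing at \<open>s0\<close>, read off as a limit
  along the positive real direction. In this form orders can be compared with inequalities between
  Dirichlet series to the right of \<open>s0\<close>.\<close>

lemma logderiv_limit:
  assumes F: "F holomorphic_on U" and U: "open U" "connected U" and s0: "s0 \<in> U"
    and w: "w \<in> U" "F w \<noteq> 0"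
  obtains k :: nat where
    "((\<lambda>t. of_real t * (deriv F (s0 + of_real t) / F (s0 + of_real t))) \<longlongrightarrow> of_nat k) (at_right 0)"
    "F s0 = 0 \<Longrightarrow> k > 0"
proof -
  have dF: "deriv F holomorphic_on U"
    by (rule holomorphic_deriv[OF F U(1)])
  have lim: "((\<lambda>t::real. s0 + of_real t) \<longlongrightarrow> s0) (at_right 0)"
    by (rule tendsto_eq_intros refl)+ simp
  have lim_comp: "((\<lambda>t. g (s0 + of_real t)) \<longlongrightarrow> g s0) (at_right 0)" if "isCont g s0" for g :: "complex \<Rightarrow> complex"
    by (rule isCont_tendsto_compose[OF that lim])
  have cont: "isCont g s0" if "g holomorphic_on V" "open V" "s0 \<in> V" for g :: "complex \<Rightarrow> complex" and V
    using that by (metis continuous_on_eq_continuous_at holomorphic_on_imp_continuous_on)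
  have t0: "((\<lambda>t::real. complex_of_real t) \<longlongrightarrow> 0) (at_right 0)"
    by (rule tendsto_eq_intros refl)+ simp
  show ?thesis
  proof (cases "F s0 = 0")
    case False
    have "((\<lambda>t. of_real t * (deriv F (s0 + of_real t) / F (s0 + of_real t))) \<longlongrightarrow> 0 * (deriv F s0 / F s0)) (at_right 0)"
      by (intro tendsto_intros t0 lim_comp cont[OF F U(1) s0] cont[OF dF U(1) s0] False)
    thus ?thesis using False that[of 0] by simp
  next
    case True
    have nc: "\<not> F constant_on U"
      using True w s0 by (metis constant_on_def)
    obtain g r n where n: "0 < n" and r: "0 < r" "ball s0 r \<subseteq> U" and g: "g holomorphic_on ball s0 r"
      and Fg: "\<And>z. z \<in> ball s0 r \<Longrightarrow> F z = (z - s0) ^ n * g z"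
      and gnz: "\<And>z. z \<in> ball s0 r \<Longrightarrow> g z \<noteq> 0"
      by (rule holomorphic_factor_zero_nonconstant[OF F U s0 True nc]) metis
    have dg: "deriv g holomorphic_on ball s0 r"
      by (rule holomorphic_deriv[OF g open_ball])
    have s0r: "s0 \<in> ball s0 r" using r by simp
    have "((\<lambda>t. of_nat n + of_real t * (deriv g (s0 + of_real t) / g (s0 + of_real t))) \<longlongrightarrow>
        of_nat n + 0 * (deriv g s0 / g s0)) (at_right 0)"
      by (intro tendsto_intros t0 lim_comp cont[OF g open_ball s0r] cont[OF dg open_ball s0r] gnz[OF s0r])
    moreover have "\<forall>\<^sub>F t in at_right 0. of_real t * (deriv F (s0 + of_real t) / F (s0 + of_real t)) =
        of_nat n + of_real t * (deriv g (s0 + of_real t) / g (s0 + of_real t))"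
      using eventually_at_right_less[of "0::real"] eventually_at_right_real[of 0 r, OF r(1)]
    proof eventually_elim
      case (elim t)
      define z where "z = s0 + of_real t"
      have z: "z \<in> ball s0 r" using elim by (simp add: z_def dist_norm)
      have zs: "z - s0 = of_real t" by (simp add: z_def)
      have "\<forall>\<^sub>F u in nhds z. u \<in> ball s0 r"
        using z by (intro eventually_nhds_in_open) auto
      hence "\<forall>\<^sub>F u in nhds z. F u = (u - s0) ^ n * g u"
        by eventually_elim (rule Fg)
      hence "deriv F z = deriv (\<lambda>u. (u - s0) ^ n * g u) z"
        by (rule deriv_cong_ev) simp
      also have "((\<lambda>u. (u - s0) ^ n * g u) has_field_derivative
          of_nat n * (z - s0) ^ (n - 1) * g z + deriv g z * (z - s0) ^ n) (at z)"
        using holomorphic_derivI[OF g open_ball z] by (auto intro!: derivative_eq_intros)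
      hence "deriv (\<lambda>u. (u - s0) ^ n * g u) z = of_nat n * (z - s0) ^ (n - 1) * g z + deriv g z * (z - s0) ^ n"
        by (rule DERIV_imp_deriv)
      finally have 1: "deriv F z = of_nat n * (z - s0) ^ (n - 1) * g z + deriv g z * (z - s0) ^ n" .
      have 2: "(z - s0) ^ n = (z - s0) * (z - s0) ^ (n - 1)"
        using n by (simp add: power_eq_if)
      have nz: "(z - s0) \<noteq> 0" "(z - s0) ^ (n - 1) \<noteq> 0" "g z \<noteq> 0"
        using elim gnz[OF z] by (auto simp: zs)
      have "(z - s0) * (deriv F z / F z) = of_nat n + (z - s0) * (deriv g z / g z)"
        unfolding 1 Fg[OF z] 2 using nz by (simp add: divide_simps) (simp add: algebra_simps)
      thus ?case unfolding zs z_def by simp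
    qed
    ultimately have "((\<lambda>t. of_real t * (deriv F (s0 + of_real t) / F (s0 + of_real t))) \<longlongrightarrow> of_nat n) (at_right 0)"
      by (subst tendsto_cong) auto
    thus ?thesis using that n by blast
  qed
qed

section \<open>Logarithmic derivatives of Dirichlet series and the von Mangoldt function\<close>

lemma has_sum_divisors:
  fixes F :: "nat \<times> nat \<Rightarrow> 'a :: {topological_comm_monoid_add, t3_space}"
  assumes "(F has_sum S) ({1..} \<times> {1..})"
  shows "((\<lambda>n. \<Sum>k | k dvd n. F (n div k, k)) has_sum S) {1..}"
proof (rule has_sum_SigmaD)
  have "((\<lambda>(n, k). F (n div k, k)) has_sum S) (Sigma {1..} (\<lambda>n. {k. k dvd n})) \<longleftrightarrow>
        (F has_sum S) ({1..} \<times> {1..})"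
    by (rule has_sum_reindex_bij_witness[where i = "\<lambda>(m, k). (m * k, k)" and j = "\<lambda>(n, k). (n div k, k)"])
       (auto simp: Suc_le_eq dvd_pos_nat div_greater_zero_iff dvd_imp_le)
  thus "((\<lambda>(n, k). F (n div k, k)) has_sum S) (Sigma {1..} (\<lambda>n. {k. k dvd n}))"
    using assms by blast
  fix n :: nat assume "n \<in> {1..}"
  hence "finite {k. k dvd n}" by (intro finite_divisors_nat) auto
  from has_sum_finite[OF this]
  show "((\<lambda>k. case (n, k) of (n, k) \<Rightarrow> F (n div k, k)) has_sum (\<Sum>k | k dvd n. F (n div k, k))) {k. k dvd n}"
    by simp
qed

lemma has_sum_mult_Times:
  fixes a :: "'a \<Rightarrow> complex" and b :: "'b \<Rightarrow> complex"
  assumes a: "(a has_sum A) X" "(\<lambda>x. norm (a x)) summable_on X" and b: "(b has_sum B) Y" "(\<lambda>x. norm (b x)) summable_on Y"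
  shows "((\<lambda>(x, y). a x * b y) has_sum (A * B)) (X \<times> Y)"
proof (rule has_sum_SigmaI)
  show "((\<lambda>y. case (x, y) of (x, y) \<Rightarrow> a x * b y) has_sum (a x * B)) Y" for x
    using has_sum_cmult_right[OF b(1)] by simp
  show "((\<lambda>x. a x * B) has_sum A * B) X"
    using has_sum_cmult_left[OF a(1)] by simp
  have "(\<lambda>z. norm (case z of (x, y) \<Rightarrow> a x * b y)) summable_on X \<times> Y"
    unfolding Infinite_Sum.abs_summable_on_Sigma_iff
  proof (intro conjI ballI)
    show "(\<lambda>y. norm (case (x, y) of (x, y) \<Rightarrow> a x * b y)) summable_on Y" for x
      using b(2) by (auto simp: norm_mult intro: summable_on_cmult_right)
    show "(\<lambda>x. norm (\<Sum>\<^sub>\<infinity>y\<in>Y. norm (case (x, y) of (x, y) \<Rightarrow> a x * b y))) summable_on X"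
      using a(2) by (simp add: norm_mult infsum_cmult_right' summable_on_cmult_left abs_mult)
  qed
  thus "(\<lambda>(x, y). a x * b y) summable_on X \<times> Y"
    by (rule abs_summable_summable)
qed

lemma sums_imp_has_sum_atLeast_1:
  fixes f :: "nat \<Rightarrow> 'a :: banach"
  assumes "summable (\<lambda>n. norm (f (Suc n)))" "(\<lambda>n. f (Suc n)) sums S"
  shows "(f has_sum S) {1..}"
proof -
  have bij: "bij_betw Suc UNIV {1..}"
    by (rule bij_betwI[of _ _ _ "\<lambda>n. n - 1"]) auto
  have "((\<lambda>n. f (Suc n)) has_sum S) UNIV"
    by (rule norm_summable_imp_has_sum[OF assms])
  thus ?thesis using has_sum_reindex_bij_betw[OF bij, of f S] by simp
qed

lemma has_sum_atLeast_1_imp_sums: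
  fixes f :: "nat \<Rightarrow> 'a :: banach"
  assumes "(f has_sum S) {1..}"
  shows "(\<lambda>n. f (Suc n)) sums S"
proof -
  have bij: "bij_betw Suc UNIV {1..}"
    by (rule bij_betwI[of _ _ _ "\<lambda>n. n - 1"]) auto
  show ?thesis
    using assms has_sum_reindex_bij_betw[OF bij, of f S] has_sum_imp_sums by blast
qed

text \<open>The von Mangoldt function is at most \<open>ln n\<close>, hence at most
  \<open>n powr e / e\<close>; taking for \<open>e\<close> half of the distance of
  \<open>Re s\<close> from 1 leaves an exponent that still converges.\<close>

lemma summable_Lambda:
  assumes c: "\<And>n. norm (c n) \<le> 1" and s: "Re s > 1"
  shows "summable (\<lambda>n. norm (mangoldt (Suc n) * dterm c s n))"
proof -
  define e where "e = (Re s - 1) / 2"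
  have e: "e > 0" using s by (simp add: e_def)
  have "summable (\<lambda>n. 1 / e * real (Suc n) powr (-(Re s - e)))"
    using s e by (intro summable_mult summable_Suc_powr) (simp add: e_def field_simps)
  thus ?thesis
  proof (rule summable_comparison_test')
    fix n :: nat
    have "norm (mangoldt (Suc n) :: complex) = mangoldt (Suc n)"
      using mangoldt_nonneg[of "Suc n"] of_real_mangoldt[of "Suc n", where ?'a = complex]
      by (metis abs_of_nonneg norm_of_real)
    also have "\<dots> \<le> ln (real (Suc n))"
      by (rule mangoldt_le) simp
    also have "\<dots> \<le> real (Suc n) powr e / e"
      by (rule ln_powr_bound) (use e in auto)
    finally have "norm (mangoldt (Suc n) :: complex) \<le> real (Suc n) powr e / e" .
    moreover have "norm (dterm c s n) \<le> 1 * real (Suc n) powr (-Re s)"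
      by (rule norm_dterm_le[OF c order_refl])
    ultimately have "norm (mangoldt (Suc n) * dterm c s n) \<le> (real (Suc n) powr e / e) * (1 * real (Suc n) powr (-Re s))"
      unfolding norm_mult using e by (intro mult_mono) auto
    also have "\<dots> = 1 / e * real (Suc n) powr (-(Re s - e))"
      by (simp add: powr_add[symmetric] del: of_nat_Suc)
    finally show "norm (norm (mangoldt (Suc n) * dterm c s n)) \<le> 1 / e * real (Suc n) powr (-(Re s - e))"
      by simp
  qed
qed

text \<open>The divisor sum of the von Mangoldt function is the logarithm, and complete
  multiplicativity carries this identity over to the twisted series. It is stated as a product,
  without division, because the nonvanishing of the series is itself deduced from it.\<close>

lemma deriv_dseries_eq:
  assumes c: "\<And>n. norm (c n) \<le> 1" and mult: "\<And>m n. c (m * n) = c m * c n" and s: "Re s > 1"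
  shows "deriv (\<lambda>s. \<Sum>n. dterm c s n) s = - (\<Sum>n. dterm c s n) * (\<Sum>n. mangoldt (Suc n) * dterm c s n)"
proof -
  define a where "a = (\<lambda>n. c n * of_nat n powr (-s))"
  define b where "b = (\<lambda>n. mangoldt n * a n)"
  have a_Suc: "a (Suc n) = dterm c s n" for n by (simp add: a_def dterm_def)
  have b_Suc: "b (Suc n) = mangoldt (Suc n) * dterm c s n" for n by (simp add: b_def a_Suc)
  have sa: "summable (\<lambda>n. norm (a (Suc n)))"
    unfolding a_Suc by (rule summable_norm_dterm[OF c s])
  have sb: "summable (\<lambda>n. norm (b (Suc n)))"
    unfolding b_Suc by (rule summable_Lambda[OF c s])
  define A where "A = (\<Sum>n. a (Suc n))"
  define B where "B = (\<Sum>n. b (Suc n))"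
  have a: "(a has_sum A) {1..}"
    unfolding A_def by (intro sums_imp_has_sum_atLeast_1 sa summable_sums summable_norm_cancel)
  have b: "(b has_sum B) {1..}"
    unfolding B_def by (intro sums_imp_has_sum_atLeast_1 sb summable_sums summable_norm_cancel)
  have "(\<lambda>n. norm (a n)) summable_on {1..}"
    using a summable_on_iff_abs_summable_on_complex has_sum_imp_summable by blast
  moreover have "(\<lambda>n. norm (b n)) summable_on {1..}"
    using b summable_on_iff_abs_summable_on_complex has_sum_imp_summable by blast
  ultimately have "((\<lambda>(m, k). a m * b k) has_sum (A * B)) ({1..} \<times> {1..})"
    by (intro has_sum_mult_Times a b)
  from has_sum_divisors[OF this]
  have "((\<lambda>n. \<Sum>k | k dvd n. a (n div k) * b k) has_sum (A * B)) {1..}" by simp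
  hence sums: "(\<lambda>n. \<Sum>k | k dvd Suc n. a (Suc n div k) * b k) sums (A * B)"
    by (rule has_sum_atLeast_1_imp_sums)
  have "(\<Sum>k | k dvd Suc n. a (Suc n div k) * b k) = of_real (ln (real (Suc n))) * dterm c s n" for n
  proof -
    have "a (Suc n div k) * b k = mangoldt k * a (Suc n)" if "k dvd Suc n" for k
    proof -
      obtain m where m: "Suc n = m * k" using \<open>k dvd Suc n\<close> by (metis dvd_def mult.commute)
      have k: "k > 0" "m > 0" using m by (auto intro!: Nat.gr0I)
      have "of_nat (m * k) powr (-s) = of_nat m powr (-s) * of_nat k powr (-s)"
        unfolding of_nat_mult using powr_times_real[of "of_nat m" "of_nat k" "-s"] by simp
      thus ?thesis using m k by (simp add: a_def b_def mult mult_ac del: of_nat_mult)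
    qed
    hence "(\<Sum>k | k dvd Suc n. a (Suc n div k) * b k) = (\<Sum>k | k dvd Suc n. mangoldt k * a (Suc n))"
      by (intro sum.cong) auto
    also have "\<dots> = of_real (ln (real (Suc n))) * dterm c s n"
      unfolding sum_distrib_right[symmetric] by (subst mangoldt_sum) (auto simp: a_Suc)
    finally show ?thesis .
  qed
  with sums have 1: "(\<lambda>n. of_real (ln (real (Suc n))) * dterm c s n) sums (A * B)" by simp
  have "(\<lambda>n. - (of_real (ln (real (Suc n))) * dterm c s n)) sums deriv (\<lambda>s. \<Sum>n. dterm c s n) s"
    using deriv_dseries[OF c s] by (simp add: deriv_dterm)
  with sums_minus[OF 1] have "deriv (\<lambda>s. \<Sum>n. dterm c s n) s = - (A * B)"
    using sums_unique2 by blast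
  thus ?thesis by (simp add: A_def B_def a_Suc b_Suc)
qed

text \<open>The term of 1 dominates: the remaining terms are bounded by a telescoping series with
  sum 1/2. The point 3 then certifies that the functions of this development do not vanish
  identically.\<close>

lemma dseries_3_nonzero:
  assumes c: "\<And>n. norm (c n) \<le> 1" and c1: "c (Suc 0) = 1"
  shows "(\<Sum>n. dterm c 3 n) \<noteq> 0"
proof
  assume 0: "(\<Sum>n. dterm c 3 n) = 0"
  have summ: "summable (dterm c 3)" by (rule summable_dterm[OF c]) simp
  have tele: "(\<lambda>n. 1 / real (Suc n) - 1 / real (Suc (Suc n))) sums (1 / real (Suc 0) - 0)"
    by (rule telescope_sums') (use LIMSEQ_inverse_real_of_nat in \<open>simp add: inverse_eq_divide\<close>)
  hence tele2: "(\<lambda>n. (1 / real (Suc n) - 1 / real (Suc (Suc n))) / 2) sums (1/2)"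
    using sums_divide[OF tele, of 2] by simp
  have b: "norm (dterm c 3 (Suc n)) \<le> (1 / real (Suc n) - 1 / real (Suc (Suc n))) / 2" for n
  proof -
    have "norm (dterm c 3 (Suc n)) \<le> 1 * real (Suc (Suc n)) powr (-3)"
      by (rule norm_dterm_le[OF c]) simp
    also have "\<dots> = 1 / real (Suc (Suc n)) ^ 3"
      by (simp add: powr_minus_divide powr_numeral del: of_nat_Suc)
    also have "\<dots> \<le> 1 / (2 * real (Suc n) * real (Suc (Suc n)))"
    proof (rule divide_left_mono)
      have "2 * real (Suc n) \<le> real (Suc (Suc n)) * real (Suc (Suc n))"
        by (simp add: algebra_simps)
      hence "2 * real (Suc n) * real (Suc (Suc n)) \<le> (real (Suc (Suc n)) * real (Suc (Suc n))) * real (Suc (Suc n))"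
        by (intro mult_right_mono) auto
      thus "2 * real (Suc n) * real (Suc (Suc n)) \<le> real (Suc (Suc n)) ^ 3"
        by (simp add: power3_eq_cube)
    qed auto
    also have "\<dots> = (1 / real (Suc n) - 1 / real (Suc (Suc n))) / 2"
      by (simp add: field_simps)
    finally show ?thesis .
  qed
  have "norm (\<Sum>n. dterm c 3 (Suc n)) \<le> (\<Sum>n. (1 / real (Suc n) - 1 / real (Suc (Suc n))) / 2)"
    using b tele2 by (intro norm_suminf_le) (auto simp: sums_iff)
  also have "\<dots> = 1/2" using tele2 by (simp add: sums_iff)
  finally have "norm (\<Sum>n. dterm c 3 (Suc n)) \<le> 1/2" .
  moreover have "(\<Sum>n. dterm c 3 (Suc n)) = (\<Sum>n. dterm c 3 n) - dterm c 3 0"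
    by (rule suminf_split_head[OF summ])
  ultimately show False using 0 c1 by (simp add: dterm_def)
qed

lemma halfplane_Re_gt: "open {s::complex. Re s > a}" "connected {s::complex. Re s > a}"
  by (simp_all add: open_halfspace_Re_gt convex_connected convex_halfspace_Re_gt)

text \<open>No Euler product is used. To the right of a zero the logarithmic derivative would be
  bounded by the absolutely convergent von Mangoldt series, so \<open>t\<close> times it tends to 0;
  at a zero the limit is the positive order.\<close>

lemma dseries_nonzero:
  assumes c: "\<And>n. norm (c n) \<le> 1" and mult: "\<And>m n. c (m * n) = c m * c n" and c1: "c (Suc 0) = 1"
    and s: "Re s > 1"
  shows "(\<Sum>n. dterm c s n) \<noteq> 0"
proof
  assume 0: "(\<Sum>n. dterm c s n) = 0"
  define F where "F = (\<lambda>s. \<Sum>n. dterm c s n)"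
  define B where "B = (\<Sum>n. norm (mangoldt (Suc n) * dterm (\<lambda>_. 1) (of_real (Re s)) n))"
  obtain k :: nat where k: "((\<lambda>t. of_real t * (deriv F (s + of_real t) / F (s + of_real t))) \<longlongrightarrow> of_nat k) (at_right 0)"
    "F s = 0 \<Longrightarrow> k > 0"
  proof (rule logderiv_limit[OF _ halfplane_Re_gt])
    show "F holomorphic_on {s. Re s > 1}"
      unfolding F_def by (rule holomorphic_dseries[OF c])
    show "F 3 \<noteq> 0" unfolding F_def by (rule dseries_3_nonzero[of c]) (fact c c1)+
  qed (use s in auto)
  have bnd: "norm (of_real t * (deriv F (s + of_real t) / F (s + of_real t))) \<le> t * B" if t: "t > 0" for t
  proof -
    define z where "z = s + of_real t"
    have z: "Re z > 1" "Re z \<ge> Re s" using t s by (auto simp: z_def)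
    \<comment> \<open>If \<open>F z\<close> vanishes, the quotient is 0 by convention, so the
      estimate presupposes no nonvanishing.\<close>
    have "norm (deriv F z / F z) \<le> norm (\<Sum>n. mangoldt (Suc n) * dterm c z n)"
      unfolding F_def deriv_dseries_eq[OF c mult z(1)] by (simp add: norm_divide norm_mult)
    also have "\<dots> \<le> B"
      unfolding B_def
    proof (rule norm_suminf_le)
      show "summable (\<lambda>n. norm (mangoldt (Suc n) * dterm (\<lambda>_. 1) (of_real (Re s)) n))"
        using s by (intro summable_Lambda) auto
      fix n
      have "norm (dterm c z n) \<le> 1 * real (Suc n) powr (-Re s)"
        by (rule norm_dterm_le[OF c z(2)])
      also have "\<dots> = norm (dterm (\<lambda>_. 1) (of_real (Re s)) n)"
        unfolding dterm_def norm_mult norm_nat_powr by simp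
      finally show "norm (mangoldt (Suc n) * dterm c z n) \<le> norm (mangoldt (Suc n) * dterm (\<lambda>_. 1) (of_real (Re s)) n)"
        unfolding norm_mult by (intro mult_left_mono norm_ge_zero)
    qed
    finally have "t * norm (deriv F z / F z) \<le> t * B" using t by simp
    thus ?thesis unfolding norm_mult z_def using t by simp
  qed
  have "((\<lambda>t. of_real t * (deriv F (s + of_real t) / F (s + of_real t))) \<longlongrightarrow> 0) (at_right 0)"
  proof (rule Lim_null_comparison)
    show "\<forall>\<^sub>F t in at_right 0. norm (of_real t * (deriv F (s + of_real t) / F (s + of_real t))) \<le> t * B"
      using eventually_at_right_less[of "0::real"] by eventually_elim (rule bnd)
    have "((\<lambda>t. t * B) \<longlongrightarrow> 0 * B) (at_right 0)" by (intro tendsto_intros)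
    thus "((\<lambda>t. t * B) \<longlongrightarrow> 0) (at_right 0)" by simp
  qed
  with k(1) have "(of_nat k :: complex) = 0"
    by (intro tendsto_unique[OF trivial_limit_at_right_real])
  with k(2) 0 show False by (simp add: F_def)
qed

lemma logderiv_dseries:
  assumes "\<And>n. norm (c n) \<le> 1" and "\<And>m n. c (m * n) = c m * c n" and "c (Suc 0) = 1" "Re s > 1"
  shows "deriv (\<lambda>s. \<Sum>n. dterm c s n) s / (\<Sum>n. dterm c s n) = - (\<Sum>n. mangoldt (Suc n) * dterm c s n)"
proof -
  have "(\<Sum>n. dterm c s n) \<noteq> 0"
    by (rule dseries_nonzero) (fact assms)+
  moreover have "deriv (\<lambda>s. \<Sum>n. dterm c s n) s = - (\<Sum>n. dterm c s n) * (\<Sum>n. mangoldt (Suc n) * dterm c s n)"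
    by (rule deriv_dseries_eq) (fact assms)+
  ultimately show ?thesis by simp
qed

text \<open>For \<open>z\<close> on the unit circle \<open>3 + 4 * Re z + Re (z^2)\<close> equals
  \<open>2 * (1 + Re z)^2\<close>; where the coefficient vanishes, the expression is 3.\<close>

lemma Re_Lambda_3_4_1:
  assumes c: "\<And>n. norm (c n) = 0 \<or> norm (c n) = 1" and x: "x > 1"
  shows "3 * Re (\<Sum>n. mangoldt (Suc n) * dterm (\<lambda>_. 1) (of_real x) n) +
         4 * Re (\<Sum>n. mangoldt (Suc n) * dterm c (Complex x u) n) +
         Re (\<Sum>n. mangoldt (Suc n) * dterm (\<lambda>n. c n ^ 2) (Complex x (2 * u)) n) \<ge> 0"
proof -
  have c': "norm (c n) \<le> 1" for n using c[of n] by auto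
  define f1 where "f1 = (\<lambda>n. mangoldt (Suc n) * dterm (\<lambda>_. 1) (of_real x) n)"
  define f2 where "f2 = (\<lambda>n. mangoldt (Suc n) * dterm c (Complex x u) n)"
  define f3 where "f3 = (\<lambda>n. mangoldt (Suc n) * dterm (\<lambda>n. c n ^ 2) (Complex x (2 * u)) n)"
  have 1: "f1 sums (\<Sum>n. f1 n)"
    unfolding f1_def using x by (intro summable_sums[OF summable_norm_cancel[OF summable_Lambda]]) auto
  have 2: "f2 sums (\<Sum>n. f2 n)"
    unfolding f2_def using x c' by (intro summable_sums[OF summable_norm_cancel[OF summable_Lambda]]) auto
  have 3: "f3 sums (\<Sum>n. f3 n)"
    unfolding f3_def using x c' by (intro summable_sums[OF summable_norm_cancel[OF summable_Lambda]]) (auto simp: norm_power power_le_one)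
  have sums: "(\<lambda>n. 3 * Re (f1 n) + 4 * Re (f2 n) + Re (f3 n)) sums
     (3 * Re (\<Sum>n. f1 n) + 4 * Re (\<Sum>n. f2 n) + Re (\<Sum>n. f3 n))"
    by (intro sums_add sums_mult sums_Re 1 2 3)
  have nonneg: "3 * Re (f1 n) + 4 * Re (f2 n) + Re (f3 n) \<ge> 0" for n
  proof -
    define w where "w = of_nat (Suc n) powr (-Complex 0 u)"
    define r where "r = (of_nat (Suc n) :: complex) powr (- of_real x)"
    have r: "r = of_real (real (Suc n) powr (-x))"
      unfolding r_def using powr_of_real[of "real (Suc n)" "-x"] by simp
    have nw: "norm w = 1" unfolding w_def norm_nat_powr by simp
    define z where "z = c (Suc n) * w"
    have z: "norm z = 0 \<or> norm z = 1" using c[of "Suc n"] nw by (simp add: z_def norm_mult)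
    have e2: "- Complex x u = - of_real x + (- Complex 0 u)" by (simp add: complex_eq_iff)
    have e3: "- Complex x (2 * u) = - of_real x + (- Complex 0 u) + (- Complex 0 u)" by (simp add: complex_eq_iff)
    have m: "(mangoldt (Suc n) :: complex) = of_real (mangoldt (Suc n))" by simp
    have "f1 n = of_real (mangoldt (Suc n) * real (Suc n) powr (-x)) * 1"
      unfolding f1_def dterm_def m r_def[symmetric] r by simp
    moreover have "f2 n = of_real (mangoldt (Suc n) * real (Suc n) powr (-x)) * z"
      unfolding f2_def dterm_def m e2 powr_add r_def[symmetric] r w_def[symmetric] z_def by simp
    moreover have "f3 n = of_real (mangoldt (Suc n) * real (Suc n) powr (-x)) * z ^ 2"
      unfolding f3_def dterm_def m e3 powr_add r_def[symmetric] r w_def[symmetric] z_def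
      by (simp add: power2_eq_square)
    ultimately have "3 * Re (f1 n) + 4 * Re (f2 n) + Re (f3 n) =
        (mangoldt (Suc n) * real (Suc n) powr (-x)) * (3 + 4 * Re z + Re (z ^ 2))"
      by (simp add: algebra_simps del: of_nat_Suc)
    moreover have "3 + 4 * Re z + Re (z ^ 2) \<ge> 0"
      using z
    proof
      assume "norm z = 1"
      hence "(Re z)\<^sup>2 + (Im z)\<^sup>2 = 1" by (metis cmod_power2 one_power2)
      hence "3 + 4 * Re z + Re (z ^ 2) = 2 * (1 + Re z)\<^sup>2"
        by (simp add: power2_eq_square algebra_simps)
      thus ?thesis by simp
    qed auto
    ultimately show ?thesis using mangoldt_nonneg[of "Suc n"] by simp
  qed
  show ?thesis
    using sums_le[OF nonneg sums_zero sums] unfolding f1_def f2_def f3_def .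
qed

lemma logderiv_regularised:
  assumes s: "Re s > 1" and R: "\<And>z. Re z > 1 \<Longrightarrow> R z = (z - 1) * Z z"
    and Z: "Z holomorphic_on {s. Re s > 1}" "Z s \<noteq> 0"
  shows "deriv Z s / Z s = deriv R s / R s - 1 / (s - 1)"
proof -
  have s1: "s - 1 \<noteq> 0" using s by auto
  have "\<forall>\<^sub>F z in nhds s. z \<in> {s. Re s > 1}"
    using s by (intro eventually_nhds_in_open) (auto simp: open_halfspace_Re_gt)
  hence "\<forall>\<^sub>F z in nhds s. R z = (z - 1) * Z z"
    by eventually_elim (use R in auto)
  hence "deriv R s = deriv (\<lambda>z. (z - 1) * Z z) s"
    by (rule deriv_cong_ev) simp
  also have "((\<lambda>z. (z - 1) * Z z) has_field_derivative Z s + deriv Z s * (s - 1)) (at s)"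
    using holomorphic_derivI[OF Z(1) open_halfspace_Re_gt, of s] s
    by (auto intro!: derivative_eq_intros)
  hence "deriv (\<lambda>z. (z - 1) * Z z) s = Z s + deriv Z s * (s - 1)"
    by (rule DERIV_imp_deriv)
  finally show ?thesis
    unfolding R[OF s] using s1 Z(2) by (simp add: divide_simps)
qed

text \<open>The argument with 3, 4, 1: a zero at \<open>1 + i u\<close> contributes at least -4,
  which the simple pole of zeta, with weight 3, cannot balance unless the series of the squares has
  a pole at \<open>1 + 2 i u\<close>. The assumption on \<open>u\<close> excludes exactly this: a
  pole occurs only at the point 1, and only if the squares have nonzero mean.\<close>

lemma (in periodic_mean_zero) D_line_nonzero:
  assumes c01: "\<And>n. norm (c n) = 0 \<or> norm (c n) = 1" and mult: "\<And>m n. c (m * n) = c m * c n"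
    and c1: "c (Suc 0) = 1" and u: "u \<noteq> 0 \<or> (\<Sum>i<q. c (Suc i) ^ 2) = 0"
  shows "D (Complex 1 u) \<noteq> 0"
proof
  assume D0: "D (Complex 1 u) = 0"
  have c_le1: "norm (c n) \<le> 1" for n using c01[of n] by auto
  define c2 where "c2 = (\<lambda>n. c n ^ 2)"
  have c2_le1: "norm (c2 n) \<le> 1" for n using c_le1[of n] by (simp add: c2_def norm_power power_le_one)
  have c2_mult: "c2 (m * n) = c2 m * c2 n" for m n by (simp add: c2_def mult power_mult_distrib)
  have c2_1: "c2 (Suc 0) = 1" by (simp add: c2_def c1)
  \<comment> \<open>\<open>C\<close> is the mean of the squared coefficients. Subtracting it leaves
    a periodic sequence of mean zero, so the series of the squares is \<open>C\<close> times zeta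
    plus a function holomorphic for \<open>Re s > 0\<close>.\<close>
  define C where "C = (\<Sum>i<q. c2 (Suc i)) / of_nat q"
  have C_le: "norm C \<le> 1"
  proof -
    have "norm (\<Sum>i<q. c2 (Suc i)) \<le> (\<Sum>i<q. 1)" by (rule sum_norm_le) (rule c2_le1)
    thus ?thesis using q_pos by (simp add: C_def norm_divide)
  qed
  interpret P2: periodic_mean_zero "\<lambda>n. c2 n - C" q 2
  proof
    show "norm (c2 n - C) \<le> 2" for n
      using norm_triangle_ineq4[of "c2 n" C] c2_le1[of n] C_le by linarith
    show "(\<Sum>i<q. c2 (Suc i) - C) = 0"
      using q_pos by (simp add: sum_subtractf C_def)
  qed (use q_pos periodic in \<open>auto simp: c2_def\<close>)
  define Z where "Z = (\<lambda>s. \<Sum>n. dterm (\<lambda>_. 1) s n)"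
  define F2 where "F2 = (\<lambda>s. \<Sum>n. dterm c2 s n)"
  define R where "R = (\<lambda>s. C * zreg s + (s - 1) * P2.D s)"
  have R_hol: "R holomorphic_on {s. Re s > 0}"
    unfolding R_def by (intro holomorphic_intros holomorphic_zreg P2.holomorphic_D)
  have R_eq: "R s = (s - 1) * F2 s" if s: "Re s > 1" for s
  proof -
    have 1: "dterm (\<lambda>_. 1) s sums Z s"
      unfolding Z_def using summable_dterm[of "\<lambda>_. 1" 1 s] s by (simp add: summable_sums)
    have 2: "dterm c2 s sums F2 s"
      unfolding F2_def using summable_dterm[OF c2_le1 s] by (simp add: summable_sums)
    have "(\<lambda>n. dterm c2 s n - C * dterm (\<lambda>_. 1) s n) sums (F2 s - C * Z s)"
      by (intro sums_diff sums_mult 1 2)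
    moreover have "dterm c2 s n - C * dterm (\<lambda>_. 1) s n = dterm (\<lambda>n. c2 n - C) s n" for n
      by (simp add: dterm_def algebra_simps)
    ultimately have PD: "P2.D s = F2 s - C * Z s"
      using P2.D_eq_dseries[OF s] by (simp add: sums_iff)
    have z: "zreg s = (s - 1) * Z s" using zreg_eq[OF s] by (simp add: Z_def)
    show ?thesis unfolding R_def PD z by (simp add: algebra_simps)
  qed
  have nz3: "zreg 3 \<noteq> 0" "D 3 \<noteq> 0" "R 3 \<noteq> 0"
  proof -
    show "zreg 3 \<noteq> 0" using dseries_3_nonzero[of "\<lambda>_. 1"] zreg_eq[of 3] by simp
    show "D 3 \<noteq> 0" using dseries_3_nonzero[of c] c_le1 c1 D_eq_dseries[of 3] by simp
    show "R 3 \<noteq> 0" using dseries_3_nonzero[of c2] c2_le1 c2_1 R_eq[of 3] by (simp add: F2_def)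
  qed
  obtain k1 :: nat where k1:
    "((\<lambda>t. of_real t * (deriv zreg (1 + of_real t) / zreg (1 + of_real t))) \<longlongrightarrow> of_nat k1) (at_right 0)"
    by (rule logderiv_limit[OF holomorphic_zreg halfplane_Re_gt, of 1 3]) (use nz3 in auto)
  obtain k2 :: nat where k2:
    "((\<lambda>t. of_real t * (deriv D (Complex 1 u + of_real t) / D (Complex 1 u + of_real t))) \<longlongrightarrow> of_nat k2) (at_right 0)"
    "k2 > 0"
    by (rule logderiv_limit[OF holomorphic_D halfplane_Re_gt, of "Complex 1 u" 3]) (use nz3 D0 in auto)
  obtain k3 :: nat where k3:
    "((\<lambda>t. of_real t * (deriv R (Complex 1 (2 * u) + of_real t) / R (Complex 1 (2 * u) + of_real t))) \<longlongrightarrow> of_nat k3) (at_right 0)"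
    "R (Complex 1 (2 * u)) = 0 \<Longrightarrow> k3 > 0"
    by (rule logderiv_limit[OF R_hol halfplane_Re_gt, of "Complex 1 (2 * u)" 3]) (use nz3 in auto)
  \<comment> \<open>\<open>e\<close> is the order at \<open>1 + 2 i u\<close> of the factor
    \<open>s - 1\<close> that regularises the series of the squares. When \<open>u = 0\<close> the
    mean \<open>C\<close> is 0, so \<open>R\<close> vanishes there too and \<open>k3\<close> makes
    up for \<open>e\<close>.\<close>
  define e :: nat where "e = (if u = 0 then 1 else 0)"
  have e: "((\<lambda>t. of_real t / (of_real t + Complex 0 (2 * u))) \<longlongrightarrow> of_nat e) (at_right 0)"
  proof (cases "u = 0")
    case True
    have "\<forall>\<^sub>F t in at_right (0::real). of_real t / (of_real t + Complex 0 (2 * u)) = 1"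
      using eventually_at_right_less[of "0::real"]
    proof eventually_elim
      case (elim t)
      hence "of_real t + Complex 0 (2 * u) = of_real t" by (simp add: True complex_eq_iff)
      thus ?case using elim by simp
    qed
    thus ?thesis using True by (simp add: e_def tendsto_eventually)
  next
    case False
    have "((\<lambda>t. of_real t / (of_real t + Complex 0 (2 * u))) \<longlongrightarrow> of_real 0 / (of_real 0 + Complex 0 (2 * u))) (at_right 0)"
      using False by (intro tendsto_intros) (auto simp: complex_eq_iff)
    thus ?thesis using False by (simp add: e_def)
  qed
  have e_k3: "e \<le> k3"
  proof (cases "u = 0")
    case True
    hence "C = 0" using u by (simp add: C_def c2_def)
    hence "R (Complex 1 (2 * u)) = 0" using True by (simp add: R_def Complex_eq_1)
    thus ?thesis using k3(2) True by (simp add: e_def Suc_leI)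
  qed (simp add: e_def)
  \<comment> \<open>\<open>T t\<close> is \<open>t\<close> times the combination of the three von
    Mangoldt series with weights 3, 4, 1, written by means of holomorphic functions so that every
    term has a limit.\<close>
  define T where "T = (\<lambda>t. 3 * (1 - of_real t * (deriv zreg (1 + of_real t) / zreg (1 + of_real t)))
      - 4 * (of_real t * (deriv D (Complex 1 u + of_real t) / D (Complex 1 u + of_real t)))
      - of_real t * (deriv R (Complex 1 (2 * u) + of_real t) / R (Complex 1 (2 * u) + of_real t))
      + of_real t / (of_real t + Complex 0 (2 * u)))"
  have "(T \<longlongrightarrow> 3 * (1 - of_nat k1) - 4 * of_nat k2 - of_nat k3 + of_nat e) (at_right 0)"
    unfolding T_def by (intro tendsto_intros k1 k2(1) k3(1) e)
  hence "((\<lambda>t. Re (T t)) \<longlongrightarrow> Re (3 * (1 - of_nat k1) - 4 * of_nat k2 - of_nat k3 + of_nat e)) (at_right 0)"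
    by (rule tendsto_Re)
  moreover have "\<forall>\<^sub>F t in at_right 0. 0 \<le> Re (T t)"
    using eventually_at_right_less[of "0::real"]
  proof eventually_elim
    case (elim t)
    define s1 where "s1 = (1 :: complex) + of_real t"
    define s2 where "s2 = Complex 1 u + of_real t"
    define s3 where "s3 = Complex 1 (2 * u) + of_real t"
    have s: "Re s1 > 1" "Re s2 > 1" "Re s3 > 1" using elim by (auto simp: s1_def s2_def s3_def)
    define S1 where "S1 = (\<Sum>n. mangoldt (Suc n) * dterm (\<lambda>_. 1) s1 n)"
    define S2 where "S2 = (\<Sum>n. mangoldt (Suc n) * dterm c s2 n)"
    define S3 where "S3 = (\<Sum>n. mangoldt (Suc n) * dterm c2 s3 n)"
    have Zhol: "Z holomorphic_on {s. Re s > 1}"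
      unfolding Z_def by (rule holomorphic_dseries[of _ 1]) simp
    have F2hol: "F2 holomorphic_on {s. Re s > 1}"
      unfolding F2_def by (rule holomorphic_dseries[of _ 1]) (rule c2_le1)
    have Znz: "Z s1 \<noteq> 0"
      unfolding Z_def by (rule dseries_nonzero) (use s in auto)
    have F2nz: "F2 s3 \<noteq> 0"
      unfolding F2_def by (rule dseries_nonzero) (use s c2_le1 c2_mult c2_1 in auto)
    have "deriv Z s1 / Z s1 = - S1"
      unfolding Z_def S1_def by (rule logderiv_dseries) (use s in auto)
    moreover have "deriv Z s1 / Z s1 = deriv zreg s1 / zreg s1 - 1 / (s1 - 1)"
      by (rule logderiv_regularised[OF s(1) _ Zhol Znz]) (simp add: zreg_eq Z_def)
    ultimately have S1_eq: "S1 = 1 / of_real t - deriv zreg s1 / zreg s1"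
      by (simp add: s1_def algebra_simps minus_equation_iff[of S1])
    have 1: "of_real t * S1 = 1 - of_real t * (deriv zreg s1 / zreg s1)"
      unfolding S1_eq using elim by (simp add: right_diff_distrib)
    have "deriv F2 s3 / F2 s3 = - S3"
      unfolding F2_def S3_def by (rule logderiv_dseries) (use s c2_le1 c2_mult c2_1 in auto)
    moreover have "deriv F2 s3 / F2 s3 = deriv R s3 / R s3 - 1 / (s3 - 1)"
      by (rule logderiv_regularised[OF s(3) R_eq F2hol F2nz])
    moreover have "s3 - 1 = of_real t + Complex 0 (2 * u)" by (simp add: s3_def complex_eq_iff)
    ultimately have S3_eq: "S3 = 1 / (of_real t + Complex 0 (2 * u)) - deriv R s3 / R s3"
      by (simp add: algebra_simps minus_equation_iff[of S3])
    have 3: "of_real t * S3 = of_real t / (of_real t + Complex 0 (2 * u)) - of_real t * (deriv R s3 / R s3)"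
      unfolding S3_eq by (simp add: right_diff_distrib)
    have "\<forall>\<^sub>F z in nhds s2. z \<in> {s. Re s > 1}"
      using s by (intro eventually_nhds_in_open) (auto simp: open_halfspace_Re_gt)
    hence ev: "\<forall>\<^sub>F z in nhds s2. D z = (\<Sum>n. dterm c z n)"
      by eventually_elim (simp add: D_eq_dseries)
    have "deriv D s2 = deriv (\<lambda>s. \<Sum>n. dterm c s n) s2"
      by (rule deriv_cong_ev[OF ev refl])
    hence "deriv D s2 / D s2 = - S2"
      unfolding S2_def D_eq_dseries[OF s(2)]
      using logderiv_dseries[of c s2] c_le1 mult c1 s(2) by simp
    hence 2: "of_real t * S2 = - (of_real t * (deriv D s2 / D s2))" by simp
    have "of_real t * (3 * S1 + 4 * S2 + S3) = 3 * (of_real t * S1) + 4 * (of_real t * S2) + of_real t * S3"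
      by (simp add: algebra_simps)
    hence "T t = of_real t * (3 * S1 + 4 * S2 + S3)"
      unfolding T_def s1_def[symmetric] s2_def[symmetric] s3_def[symmetric] 1 2 3 by simp
    moreover have "3 * Re S1 + 4 * Re S2 + Re S3 \<ge> 0"
    proof -
      have "s1 = of_real (1 + t)" "s2 = Complex (1 + t) u" "s3 = Complex (1 + t) (2 * u)"
        by (auto simp: s1_def s2_def s3_def complex_eq_iff)
      thus ?thesis unfolding S1_def S2_def S3_def c2_def
        using Re_Lambda_3_4_1[of c "1 + t" u] c01 elim by simp
    qed
    ultimately show ?case using elim by simp
  qed
  ultimately have "Re (3 * (1 - of_nat k1) - 4 * of_nat k2 - of_nat k3 + of_nat e) \<ge> 0"
    by (intro tendsto_lowerbound[OF _ _ trivial_limit_at_right_real])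
  hence "3 * (1 - real k1) - 4 * real k2 - real k3 + real e \<ge> 0"
    by simp
  \<comment> \<open>The limit is at most \<open>3 - 4\<close>, whereas it should be
    nonnegative.\<close>
  moreover have "real e \<le> real k3" "real k2 \<ge> 1" "real k1 \<ge> 0" using e_k3 k2(2) by auto
  ultimately show False by argo
qed

section \<open>The value at 1 for real characters\<close>

definition dsum :: "(nat \<Rightarrow> real) \<Rightarrow> nat \<Rightarrow> real" where
  "dsum h n = (\<Sum>k | k dvd n. h k)"

text \<open>The divisors of \<open>p^a * m\<close> are the products \<open>p^j * d\<close> with
  \<open>d\<close> dividing \<open>m\<close>, each obtained once since \<open>p\<close> does not
  divide \<open>m\<close>.\<close>

lemma dsum_prime_power_mult:
  assumes mult: "\<And>m n. h (m * n) = h m * h n" and h1: "h (Suc 0) = 1"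
    and p: "prime p" and pm: "\<not> p dvd m"
  shows "dsum h (p ^ a * m) = (\<Sum>j\<le>a. h p ^ j) * dsum h m"
proof -
  have p0: "p > 0" using p by (simp add: prime_gt_0_nat)
  have hp: "h (p ^ j) = h p ^ j" for j
    by (induction j) (use h1 mult in auto)
  define g where "g = (\<lambda>(j, d). p ^ j * d :: nat)"
  have inj: "inj_on g ({..a} \<times> {d. d dvd m})"
  proof (rule inj_onI, clarify)
    fix i d j d' assume d: "d dvd m" "d' dvd m" and eq: "g (i, d) = g (j, d')"
    have pd: "\<not> p dvd d" "\<not> p dvd d'" using d pm dvd_trans by blast+
    have mu: "multiplicity p (p ^ i * d) = i" if "\<not> p dvd d" for i d
      by (rule multiplicity_eqI) (use that p0 in \<open>simp_all add: power_Suc2 del: power_Suc\<close>)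
    have "i = j" using eq mu[OF pd(1), of i] mu[OF pd(2), of j] by (simp add: g_def)
    thus "i = j \<and> d = d'" using eq p0 by (simp add: g_def)
  qed
  have img: "g ` ({..a} \<times> {d. d dvd m}) = {k. k dvd p ^ a * m}"
  proof (intro equalityI subsetI)
    fix k assume "k \<in> g ` ({..a} \<times> {d. d dvd m})"
    thus "k \<in> {k. k dvd p ^ a * m}"
      by (auto simp: g_def intro!: mult_dvd_mono le_imp_power_dvd)
  next
    fix k assume "k \<in> {k. k dvd p ^ a * m}"
    then obtain b d where bd: "k = b * d" "b dvd p ^ a" "d dvd m"
      using division_decomp[of k "p ^ a" m] by blast
    moreover obtain j where "j \<le> a" "b = p ^ j"
      using bd(2) divides_primepow_nat[OF p] by blast
    ultimately show "k \<in> g ` ({..a} \<times> {d. d dvd m})"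
      by (auto simp: g_def intro!: image_eqI[of _ _ "(j, d)"])
  qed
  have "dsum h (p ^ a * m) = (\<Sum>z\<in>{..a} \<times> {d. d dvd m}. h (g z))"
    unfolding dsum_def img[symmetric] sum.reindex[OF inj] by simp
  also have "\<dots> = (\<Sum>j\<le>a. \<Sum>d | d dvd m. h p ^ j * h d)"
    unfolding g_def by (subst sum.cartesian_product) (simp add: mult hp case_prod_unfold)
  finally show ?thesis
    by (simp add: dsum_def sum_product)
qed

lemma geometric_sum_signs:
  assumes "e \<in> {-1, 0, 1 :: real}"
  shows "(\<Sum>j\<le>a. e ^ j) \<ge> 0" "even a \<Longrightarrow> (\<Sum>j\<le>a. e ^ j) \<ge> 1"
proof -
  have m1: "(\<Sum>j\<le>a. (-1) ^ j) = (if even a then 1 else 0 :: real)" for a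
    by (induction a) auto
  have z: "(\<Sum>j\<le>a. 0 ^ j) = (1 :: real)" for a
    by (induction a) auto
  show "(\<Sum>j\<le>a. e ^ j) \<ge> 0" "even a \<Longrightarrow> (\<Sum>j\<le>a. e ^ j) \<ge> 1"
    using assms by (auto simp: m1 z)
qed

text \<open>Prime powers are split off one at a time. The local factor
  \<open>1 + e + ... + e^a\<close> with \<open>e\<close> in -1, 0, 1 is never negative, and it is at
  least 1 for even \<open>a\<close>, which is the case at every prime when \<open>n\<close> is a
  square.\<close>

lemma dsum_nonneg_square:
  assumes mult: "\<And>m n. h (m * n) = h m * h n" and h1: "h (Suc 0) = 1"
    and h: "\<And>n. h n \<in> {-1, 0, 1}" and n: "n > 0"
  shows "dsum h n \<ge> 0 \<and> ((\<exists>j. n = j ^ 2) \<longrightarrow> dsum h n \<ge> 1)"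
  using n
proof (induction n rule: less_induct)
  case (less n)
  show ?case
  proof (cases "n = 1")
    case True
    thus ?thesis by (simp add: dsum_def h1)
  next
    case False
    then obtain p where p: "prime p" "p dvd n"
      using prime_factor_nat by blast
    define a where "a = multiplicity p n"
    obtain m where m: "n = p ^ a * m" "\<not> p dvd m"
      using multiplicity_decompose'[of n p] less.prems p unfolding a_def by (metis not_prime_unit neq0_conv)
    have m0: "m > 0" using m less.prems by (cases m) auto
    have "a > 0" unfolding a_def using p less.prems by (simp add: prime_multiplicity_gt_zero_iff)
    hence "p ^ a > 1" using one_less_power[OF prime_gt_1_nat[OF p(1)]] by simp
    hence mn: "m < n" using m m0 by simp
    note IH = less.IH[OF mn m0]
    have eq: "dsum h n = (\<Sum>j\<le>a. h p ^ j) * dsum h m"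
      unfolding m(1) by (rule dsum_prime_power_mult[OF mult h1 p(1) m(2)])
    have 1: "dsum h n \<ge> 0"
      unfolding eq using IH geometric_sum_signs(1)[OF h] by simp
    have 2: "dsum h n \<ge> 1" if j: "n = j ^ 2" for j
    proof -
      have j0: "j > 0" using j less.prems by (cases j) auto
      have a: "a = 2 * multiplicity p j"
        unfolding a_def j using p(1) j0 by (simp add: prime_elem_multiplicity_power_distrib)
      obtain j' where j': "j = p ^ multiplicity p j * j'"
        using multiplicity_dvd[of p j] by (auto simp: dvd_def)
      have "p ^ a * m = p ^ a * j' ^ 2"
        using m(1) j j' a by (metis power_mult power_mult_distrib mult.commute)
      hence "m = j' ^ 2" using p(1) by (simp add: prime_gt_0_nat)
      hence "dsum h m \<ge> 1" using IH by blast
      moreover have "(\<Sum>j\<le>a. h p ^ j) \<ge> 1" using geometric_sum_signs(2)[OF h] a by simp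
      ultimately show ?thesis unfolding eq using mult_mono[of 1 "\<Sum>j\<le>a. h p ^ j" 1 "dsum h m"] by simp
    qed
    show ?thesis using 1 2 by blast
  qed
qed

text \<open>The comparison sequence of the argument for real characters: the harmonic term scaled by
  \<open>1 / (1 - x)\<close> minus the Lambert kernel. The scaling makes its value at
  \<open>n = 1\<close> equal to 1.\<close>

definition lambert_gap :: "real \<Rightarrow> nat \<Rightarrow> real" where
  "lambert_gap x n = 1 / (1 - x) * (1 / real n) - x ^ n / (1 - x ^ n)"

text \<open>The terms with indices \<open>i\<close> and \<open>n - 1 - i\<close> have the constant
  geometric mean \<open>y^(n - 1)\<close>.\<close>

lemma geometric_AM_GM:
  fixes y :: real
  assumes "y \<ge> 0"
  shows "real n * y ^ (n - 1) \<le> (\<Sum>i<n. (y\<^sup>2) ^ i)"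
proof -
  have "2 * (\<Sum>i<n. (y\<^sup>2) ^ i) = (\<Sum>i<n. (y\<^sup>2) ^ i) + (\<Sum>i<n. (y\<^sup>2) ^ (n - Suc i))"
    using sum.nat_diff_reindex[of "\<lambda>i. (y\<^sup>2) ^ i" n] by simp
  also have "\<dots> = (\<Sum>i<n. (y ^ i)\<^sup>2 + (y ^ (n - Suc i))\<^sup>2)"
    by (simp add: sum.distrib flip: power_mult) (simp add: mult.commute)
  also have "\<dots> \<ge> (\<Sum>i<n. 2 * y ^ (n - 1))"
  proof (rule sum_mono)
    fix i assume "i \<in> {..<n}"
    hence "y ^ (n - 1) = y ^ i * y ^ (n - Suc i)"
      unfolding power_add[symmetric] by simp
    thus "2 * y ^ (n - 1) \<le> (y ^ i)\<^sup>2 + (y ^ (n - Suc i))\<^sup>2"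
      using sum_squares_bound[of "y ^ i" "y ^ (n - Suc i)"] by simp
  qed
  finally show ?thesis by simp
qed

text \<open>With \<open>S n = 1 + x + ... + x^(n - 1)\<close> the decrease amounts to
  \<open>n * (n + 1) * x^n\<close> being at most \<open>S n * S (n + 1)\<close>, and the geometric
  mean bound for \<open>y = sqrt x\<close> yields this.\<close>

lemma
  assumes x: "0 < x" "x < 1" and n: "n > 0"
  shows lambert_gap_antimono: "lambert_gap x (Suc n) \<le> lambert_gap x n"
    and lambert_gap_nonneg: "lambert_gap x n \<ge> 0"
proof -
  define y where "y = sqrt x"
  have y: "y > 0" "y < 1" "y\<^sup>2 = x" using x by (auto simp: y_def)
  define S where "S = (\<lambda>n. \<Sum>i<n. x ^ i)"
  have S_ge: "real n * y ^ (n - 1) \<le> S n" for n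
    unfolding S_def using geometric_AM_GM[of y n] y by simp
  have S_pos: "S n > 0" if "n > 0" for n
  proof -
    have "0 < real n * y ^ (n - 1)" using that y by simp
    thus ?thesis using S_ge[of n] by linarith
  qed
  have geo: "1 - x ^ n = (1 - x) * S n" for n
    unfolding S_def by (rule one_diff_power_eq)
  have eq: "lambert_gap x n = 1 / (1 - x) * (1 / real n - x ^ n / S n)" if "n > 0" for n
    unfolding lambert_gap_def geo by (simp add: right_diff_distrib)
  have Suc2: "S (Suc n) = 1 + x * S n"
    unfolding S_def by (subst sum.lessThan_Suc_shift) (simp add: sum_distrib_left)
  have "x ^ n = y ^ (2 * n)" using y by (simp add: power_mult)
  also have "\<dots> \<le> y ^ ((n - 1) + n)" using y by (intro power_decreasing) auto
  finally have "real n * real (Suc n) * x ^ n \<le> (real n * y ^ (n - 1)) * (real (Suc n) * y ^ (Suc n - 1))"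
    unfolding power_add using mult_left_mono[of "x ^ n" "y ^ (n - 1) * y ^ n" "real n * real (Suc n)"]
    by (simp add: mult_ac)
  also have "\<dots> \<le> S n * S (Suc n)"
    using S_ge[of n] S_ge[of "Suc n"] y S_pos[OF n] by (intro mult_mono) auto
  finally have key: "real n * real (Suc n) * x ^ n \<le> S n * S (Suc n)" .
  have "x ^ n / S n - x ^ Suc n / S (Suc n) = x ^ n * (S (Suc n) - x * S n) / (S n * S (Suc n))"
    using S_pos[OF n] S_pos[of "Suc n"] by (simp add: field_simps)
  also have "S (Suc n) - x * S n = 1" by (simp add: Suc2)
  also have "x ^ n * 1 / (S n * S (Suc n)) \<le> 1 / (real n * real (Suc n))"
    using key S_pos[OF n] S_pos[of "Suc n"] n by (simp add: divide_simps mult_ac)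
  also have "\<dots> = 1 / real n - 1 / real (Suc n)" using n by (simp add: field_simps)
  finally have "1 / real (Suc n) - x ^ Suc n / S (Suc n) \<le> 1 / real n - x ^ n / S n" by linarith
  thus "lambert_gap x (Suc n) \<le> lambert_gap x n"
    using x n eq[OF n] eq[of "Suc n"] by (simp add: divide_right_mono)
  have "real n * x ^ n \<le> S n"
  proof -
    have "(\<Sum>i<n. x ^ n) \<le> S n"
      unfolding S_def using x by (intro sum_mono power_decreasing) auto
    thus ?thesis by simp
  qed
  hence "x ^ n / S n \<le> 1 / real n"
    using S_pos[OF n] n by (simp add: divide_simps mult_ac)
  thus "lambert_gap x n \<ge> 0" using x eq[OF n] by simp
qed

text \<open>Monsky's proof of the nonvanishing of \<open>L(1, \<chi>)\<close> for real characters.\<close>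
lemma (in periodic_mean_zero) D_1_nonzero_real:
  assumes real: "\<And>n. c n \<in> {-1, 0, 1}" and mult: "\<And>m n. c (m * n) = c m * c n"
    and c1: "c (Suc 0) = 1"
  shows "D 1 \<noteq> 0"
proof
  assume D1: "D 1 = 0"
  define h where "h = (\<lambda>n. Re (c n))"
  have ch: "c n = of_real (h n)" for n using real[of n] by (auto simp: h_def)
  have h: "h n \<in> {-1, 0, 1}" for n using real[of n] by (auto simp: h_def)
  have h_mult: "h (m * n) = h m * h n" for m n
    using mult[of m n] unfolding ch by (metis of_real_eq_iff of_real_mult)
  have h1: "h (Suc 0) = 1" by (simp add: h_def c1)
  have h_le: "\<bar>h n\<bar> \<le> 1" for n using h[of n] by auto
  have h_per: "h (Suc (n * q + i)) = h (Suc i)" for n i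
    by (simp add: h_def periodic_Suc)
  have h_mean: "(\<Sum>i<q. h (Suc i)) = 0"
    using mean_zero unfolding h_def Re_sum[symmetric] by simp
  \<comment> \<open>The bound is uniform in \<open>x\<close> and \<open>K\<close>. It comes from
    estimating the Lambert series \<open>f\<close> of \<open>h\<close> in two ways: from above by
    \<open>q\<close>, using \<open>D 1 = 0\<close>, and from below by its terms at squares.\<close>
  have bound: "(\<Sum>j<K. x ^ (Suc j)\<^sup>2) \<le> real q" if x: "0 < x" "x < 1" for x K
  proof -
    define g where "g = (\<lambda>n. h (Suc n) * (x ^ Suc n / (1 - x ^ Suc n)))"
    have xn: "x ^ Suc n < 1" for n using x by (intro power_Suc_less_one) auto
    have g_le: "norm (g n) \<le> x ^ Suc n / (1 - x)" for n
    proof -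
      have "x ^ Suc n \<le> x ^ 1" using x by (intro power_decreasing) auto
      hence "x ^ Suc n / (1 - x ^ Suc n) \<le> x ^ Suc n / (1 - x)"
        using x xn[of n] by (intro divide_left_mono) auto
      moreover have "norm (g n) \<le> 1 * (x ^ Suc n / (1 - x ^ Suc n))"
        unfolding g_def norm_mult using h_le[of "Suc n"] xn[of n] x by (intro mult_mono) auto
      ultimately show ?thesis by simp
    qed
    have geo: "summable (\<lambda>n. x ^ Suc n / (1 - x))"
      using x by (intro summable_divide) (simp add: summable_geometric summable_mult)
    have g_summ: "summable g" "summable (\<lambda>n. norm (g n))"
      using summable_comparison_test'[OF geo, of 0 g] g_le
        summable_comparison_test'[OF geo, of 0 "\<lambda>n. norm (g n)"] by auto
    define f where "f = (\<Sum>n. g n)"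
    have "(\<lambda>n. sum g {n * q..<n * q + q}) sums f"
      unfolding f_def by (intro sums_group summable_sums g_summ q_pos)
    moreover have "sum g {n * q..<n * q + q} = (\<Sum>i<q. g (n * q + i))" for n
      using sum.shift_bounds_nat_ivl[of g 0 "n * q" q]
      by (simp add: add.commute atLeast0LessThan)
    ultimately have g_sums: "(\<lambda>n. \<Sum>i<q. g (n * q + i)) sums f" by simp
    have "block 1 sums 0"
      using summable_sums[OF summable_block[of 1]] D1 by (simp add: D_def)
    hence "(\<lambda>n. Re (block 1 n)) sums 0" using sums_Re by fastforce
    moreover have "Re (block 1 n) = (\<Sum>i<q. h (Suc i) * (1 / real (Suc (n * q + i))))" for n
    proof -
      have "(of_nat N :: complex) powr (-1) = of_real (1 / real N)" for N
        by (cases "N = 0") (simp_all add: powr_minus_divide)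
      thus ?thesis unfolding block_def Re_sum ch
        by (simp only: of_real_mult[symmetric] Re_complex_of_real)
    qed
    ultimately have "(\<lambda>n. \<Sum>i<q. h (Suc i) * (1 / real (Suc (n * q + i)))) sums 0" by simp
    \<comment> \<open>Because \<open>D 1 = 0\<close>, a multiple of the harmonic series weighted by
      \<open>h\<close> can be added for free; this replaces the Lambert kernel by the monotone gap
      sequence.\<close>
    from sums_diff[OF sums_mult[OF this, of "1 / (1 - x)"] g_sums]
    have gap_sums: "(\<lambda>n. \<Sum>i<q. h (Suc i) * lambert_gap x (Suc (n * q + i))) sums (- f)"
      by (simp add: lambert_gap_def g_def h_per sum_distrib_left sum_subtractf right_diff_distrib mult_ac del: of_nat_Suc power_Suc)
    define b where "b = (\<lambda>n. lambert_gap x (Suc n))"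
    have b_anti: "decseq b"
      unfolding decseq_Suc_iff b_def using lambert_gap_antimono[OF x] by simp
    have b_nonneg: "b n \<ge> 0" for n unfolding b_def by (rule lambert_gap_nonneg[OF x]) simp
    have b0: "b 0 = 1" using x by (simp add: b_def lambert_gap_def field_simps)
    \<comment> \<open>Mean zero permits subtracting the first value of the block, and monotonicity
      bounds what remains by the drop over one period. These drops telescope to at most
      \<open>b 0 = 1\<close>.\<close>
    have blk: "norm (\<Sum>i<q. h (Suc i) * lambert_gap x (Suc (n * q + i))) \<le> real q * (b (n * q) - b (Suc n * q))" for n
    proof -
      have "(\<Sum>i<q. h (Suc i) * lambert_gap x (Suc (n * q + i))) = (\<Sum>i<q. h (Suc i) * (b (n * q + i) - b (n * q)))"
        unfolding right_diff_distrib sum_subtractf sum_distrib_right[symmetric] h_mean by (simp add: b_def)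
      also have "norm \<dots> \<le> (\<Sum>i<q. b (n * q) - b (Suc n * q))"
      proof (rule sum_norm_le)
        fix i assume "i \<in> {..<q}"
        hence "b (n * q + i) \<le> b (n * q)" "b (Suc n * q) \<le> b (n * q + i)"
          by (intro decseqD[OF b_anti]; simp)+
        moreover have "norm (h (Suc i) * (b (n * q + i) - b (n * q))) \<le> 1 * \<bar>b (n * q + i) - b (n * q)\<bar>"
          unfolding norm_mult unfolding real_norm_def using h_le by (intro mult_right_mono) auto
        ultimately show "norm (h (Suc i) * (b (n * q + i) - b (n * q))) \<le> b (n * q) - b (Suc n * q)"
          unfolding mult_1 by argo
      qed
      finally show ?thesis by simp
    qed
    have "norm (- f) \<le> real q"
    proof (rule LIMSEQ_le_const2)
      show "(\<lambda>N. norm (\<Sum>n<N. \<Sum>i<q. h (Suc i) * lambert_gap x (Suc (n * q + i)))) \<longlonglongrightarrow> norm (- f)"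
        using gap_sums unfolding sums_def by (rule tendsto_norm)
      have "norm (\<Sum>n<N. \<Sum>i<q. h (Suc i) * lambert_gap x (Suc (n * q + i))) \<le> real q" for N
      proof -
        have "norm (\<Sum>n<N. \<Sum>i<q. h (Suc i) * lambert_gap x (Suc (n * q + i))) \<le> (\<Sum>n<N. real q * (b (n * q) - b (Suc n * q)))"
          by (rule sum_norm_le) (rule blk)
        also have "\<dots> = real q * (b (0 * q) - b (N * q))"
          unfolding sum_distrib_left[symmetric] by (subst sum_lessThan_telescope'[of "\<lambda>n. b (n * q)"]) simp
        also have "\<dots> \<le> real q * 1"
          using b0 b_nonneg[of "N * q"] by (intro mult_left_mono) auto
        finally show ?thesis by simp
      qed
      thus "\<exists>N. \<forall>n\<ge>N. norm (\<Sum>n<n. \<Sum>i<q. h (Suc i) * lambert_gap x (Suc (n * q + i))) \<le> real q" by blast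
    qed
    hence f_le: "f \<le> real q" by simp
    have inner: "((\<lambda>m. h k * x ^ (m * k)) has_sum (h k * (x ^ k / (1 - x ^ k)))) {1..}" 
      "(\<lambda>m. norm (h k * x ^ (m * k))) summable_on {1..}" if k: "k \<in> {1..}" for k
    proof -
      have xk: "0 < x ^ k" "x ^ k < 1" using x k by (auto simp: power_less_one_iff)
      have "(\<lambda>m. x ^ k * (x ^ k) ^ m) sums (x ^ k * (1 / (1 - x ^ k)))"
        using xk by (intro sums_mult geometric_sums) auto
      hence s: "(\<lambda>m. x ^ (Suc m * k)) sums (x ^ k / (1 - x ^ k))"
        by (simp add: power_add power_mult mult.commute[of _ k])
      hence "(\<lambda>m. norm (x ^ (Suc m * k))) sums (x ^ k / (1 - x ^ k))" using x by simp
      hence hs: "((\<lambda>m. x ^ (m * k)) has_sum (x ^ k / (1 - x ^ k))) {1..}"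
        using s by (intro sums_imp_has_sum_atLeast_1) (auto simp: sums_iff)
      show hs': "((\<lambda>m. h k * x ^ (m * k)) has_sum (h k * (x ^ k / (1 - x ^ k)))) {1..}"
        by (rule has_sum_cmult_right[OF hs])
      show "(\<lambda>m. norm (h k * x ^ (m * k))) summable_on {1..}"
        by (rule iffD1[OF summable_on_iff_abs_summable_on_real has_sum_imp_summable[OF hs']])
    qed
    have outer: "((\<lambda>k. h k * (x ^ k / (1 - x ^ k))) has_sum f) {1..}"
      unfolding f_def using g_summ by (intro sums_imp_has_sum_atLeast_1 summable_sums) (auto simp: g_def)
    have "(\<lambda>z. norm (case z of (k, m) \<Rightarrow> h k * x ^ (m * k))) summable_on ({1..} \<times> {1..})"
      unfolding Infinite_Sum.abs_summable_on_Sigma_iff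
    proof (intro conjI ballI)
      fix k :: nat assume k: "k \<in> {1..}"
      show "(\<lambda>m. norm (case (k, m) of (k, m) \<Rightarrow> h k * x ^ (m * k))) summable_on {1..}"
        using inner(2)[OF k] by simp
    next
      have "(\<lambda>k. h k * (x ^ k / (1 - x ^ k))) summable_on {1..}"
        using outer by (rule has_sum_imp_summable)
      hence "(\<lambda>k. norm (h k * (x ^ k / (1 - x ^ k)))) summable_on {1..}"
        by (rule iffD1[OF summable_on_iff_abs_summable_on_real])
      moreover have "norm (\<Sum>\<^sub>\<infinity>m\<in>{1..}. norm (case (k, m) of (k, m) \<Rightarrow> h k * x ^ (m * k))) = norm (h k * (x ^ k / (1 - x ^ k)))"
        if k: "k \<in> {1..}" for k
      proof -
        have "(\<Sum>\<^sub>\<infinity>m\<in>{1..}. norm (case (k, m) of (k, m) \<Rightarrow> h k * x ^ (m * k))) = (\<Sum>\<^sub>\<infinity>m\<in>{1..}. \<bar>h k\<bar> * x ^ (m * k))"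
          using x by (simp add: abs_mult)
        also have "\<dots> = \<bar>h k\<bar> * (x ^ k / (1 - x ^ k))"
        proof (rule infsumI)
          have "((\<lambda>m. h k * x ^ (m * k)) has_sum (h k * (x ^ k / (1 - x ^ k)))) {1..}"
            by (rule inner(1)[OF k])
          hence "((\<lambda>m. sgn (h k) * (h k * x ^ (m * k))) has_sum (sgn (h k) * (h k * (x ^ k / (1 - x ^ k))))) {1..}"
            by (rule has_sum_cmult_right)
          thus "((\<lambda>m. \<bar>h k\<bar> * x ^ (m * k)) has_sum (\<bar>h k\<bar> * (x ^ k / (1 - x ^ k)))) {1..}"
            by (simp add: mult.assoc[symmetric] abs_sgn[symmetric] mult.commute[of "sgn (h k)"])
        qed
        finally show ?thesis by (simp only: abs_mult real_norm_def abs_abs)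
      qed
      ultimately show "(\<lambda>k. norm (\<Sum>\<^sub>\<infinity>m\<in>{1..}. norm (case (k, m) of (k, m) \<Rightarrow> h k * x ^ (m * k)))) summable_on {1..}"
        by (subst summable_on_cong) auto
    qed
    hence "(\<lambda>(k, m). h k * x ^ (m * k)) summable_on ({1..} \<times> {1..})"
      by (rule abs_summable_summable)
    hence "((\<lambda>(k, m). h k * x ^ (m * k)) has_sum f) ({1..} \<times> {1..})"
      using inner(1) outer by (intro has_sum_SigmaI) auto
    hence "((\<lambda>(m, k). h k * x ^ (m * k)) has_sum f) ({1..} \<times> {1..})"
      by (subst has_sum_reindex_bij_witness[where i = prod.swap and j = prod.swap and T = "{1..} \<times> {1..}"
            and h = "\<lambda>(k, m). h k * x ^ (m * k)" and s' = f]) auto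
    \<comment> \<open>Expanding each Lambert kernel geometrically and collecting equal exponents
      turns \<open>f\<close> into the power series whose coefficients are the divisor sums of
      \<open>h\<close>.\<close>
    from has_sum_divisors[OF this]
    have "((\<lambda>n. \<Sum>k | k dvd n. h k * x ^ (n div k * k)) has_sum f) {1..}" by simp
    hence f_sum: "((\<lambda>n. dsum h n * x ^ n) has_sum f) {1..}"
      by (subst (asm) has_sum_cong[where g = "\<lambda>n. dsum h n * x ^ n"]) (simp_all add: dsum_def sum_distrib_right)
    define A where "A = (\<lambda>j. (Suc j)\<^sup>2) ` {..<K}"
    have A: "finite A" "A \<subseteq> {1..}" by (auto simp: A_def)
    have inj: "inj_on (\<lambda>j. (Suc j)\<^sup>2) {..<K}" by (rule inj_onI) simp
    have "(\<Sum>j<K. x ^ (Suc j)\<^sup>2) = (\<Sum>n\<in>A. 1 * x ^ n)"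
      unfolding A_def by (simp add: sum.reindex[OF inj])
    also have "\<dots> \<le> (\<Sum>n\<in>A. dsum h n * x ^ n)"
    proof (rule sum_mono)
      fix n assume "n \<in> A"
      hence "n > 0" "\<exists>j. n = j\<^sup>2" by (auto simp: A_def)
      hence "dsum h n \<ge> 1" using dsum_nonneg_square[of h n, OF h_mult h1 h] by blast
      thus "1 * x ^ n \<le> dsum h n * x ^ n" using x by (intro mult_right_mono) auto
    qed
    also have "\<dots> \<le> f"
    proof (rule finite_sum_le_has_sum[OF f_sum A])
      fix n assume "n \<in> {1..} - A"
      hence "n > 0" by auto
      hence "dsum h n \<ge> 0" using dsum_nonneg_square[of h n, OF h_mult h1 h] by blast
      thus "0 \<le> dsum h n * x ^ n" using x by simp
    qed
    finally show ?thesis using f_le by linarith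
  qed
  \<comment> \<open>With \<open>q + 1\<close> squares the sum tends to \<open>q + 1\<close> as
    \<open>x\<close> tends to 1 from the left, which exceeds the bound \<open>q\<close>.\<close>
  have "((\<lambda>x. \<Sum>j<Suc q. x ^ (Suc j)\<^sup>2) \<longlongrightarrow> (\<Sum>j<Suc q. 1 ^ (Suc j)\<^sup>2)) (at_left (1::real))"
    by (intro tendsto_intros)
  moreover have "\<forall>\<^sub>F x in at_left (1::real). (\<Sum>j<Suc q. x ^ (Suc j)\<^sup>2) \<le> real q"
    using eventually_at_left_real[of 0 "1::real", OF zero_less_one]
    by eventually_elim (intro bound, auto)
  ultimately have "(\<Sum>j<Suc q. 1 ^ (Suc j)\<^sup>2) \<le> real q"
    by (rule tendsto_upperbound) auto
  thus False by simp
qed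

subsection \<open>Dirichlet characters and Gauss sums\<close>

lemma dirichlet_character_cong:
  assumes "dirichlet_character q chi" "[a = b] (mod int q)"
  shows "chi a = chi b"
proof -
  have per: "chi (a + int q) = chi a" for a using assms(1) by (simp add: dirichlet_character_def)
  have nat: "chi (a + int n * int q) = chi a" for a n
  proof (induction n)
    case (Suc n)
    have "chi (a + int (Suc n) * int q) = chi ((a + int n * int q) + int q)" by (simp add: algebra_simps)
    thus ?case using per Suc by simp
  qed simp
  obtain k where k: "b = a + int q * k" using assms(2) by (auto simp: cong_iff_lin)
  show ?thesis
  proof (cases "k \<ge> 0")
    case True
    thus ?thesis using nat[of a "nat k"] k by (simp add: mult.commute)
  next
    case False
    have "a = b + int (nat (-k)) * int q" using False k by (simp add: algebra_simps)
    thus ?thesis using nat[of b "nat (-k)"] by simp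
  qed
qed

locale dirichlet_char =
  fixes q :: nat and chi :: "int \<Rightarrow> complex"
  assumes chi: "dirichlet_character q chi"
begin

lemma q_pos: "q > 0" and mult: "chi (a * b) = chi a * chi b"
  and nonzero_iff: "chi a \<noteq> 0 \<longleftrightarrow> coprime a (int q)"
  using chi by (auto simp: dirichlet_character_def)

lemmas cong = dirichlet_character_cong[OF chi]

lemma chi_1: "chi 1 = 1"
  using mult[of 1 1] nonzero_iff[of 1] by simp

lemma power: "chi (a ^ n) = chi a ^ n"
  by (induction n) (simp_all add: chi_1 mult)

text \<open>By Euler's theorem the values at units are roots of unity.\<close>

lemma norm_chi: "norm (chi a) = (if coprime a (int q) then 1 else 0)"
proof (cases "coprime a (int q)")
  case True
  define b where "b = nat (a mod int q)"
  have ab: "[a = int b] (mod int q)" using q_pos by (simp add: b_def cong_def)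
  have "coprime (int b) (int q)" using cong_imp_coprime[OF ab True] .
  hence "coprime b q" by simp
  hence "[b ^ totient q = 1] (mod q)" by (rule euler_theorem)
  hence "[int b ^ totient q = 1] (mod int q)" by (metis cong_int_iff of_nat_1 of_nat_power)
  hence "chi (int b ^ totient q) = 1" using cong chi_1 by metis
  hence "norm (chi (int b)) ^ totient q = 1" by (metis norm_one norm_power power)
  hence "norm (chi (int b)) = 1" using q_pos power_eq_iff_eq_base[of "totient q" "norm (chi (int b))" 1] by simp
  thus ?thesis using cong[OF ab] True by simp
qed (use nonzero_iff[of a] in auto)

lemma mult_cnj: "coprime a (int q) \<Longrightarrow> cnj (chi a) * chi a = 1"
  using norm_chi[of a] complex_norm_square[of "chi a"] by (simp add: mult.commute)

lemma sum_reindex_mult: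
  fixes f :: "int \<Rightarrow> complex"
  assumes f: "\<And>a b. [a = b] (mod int q) \<Longrightarrow> f a = f b" and a: "coprime a (int q)"
  shows "(\<Sum>b\<in>{0..<int q}. f (a * b)) = (\<Sum>b\<in>{0..<int q}. f b)"
proof -
  define g where "g = (\<lambda>b. (a * b) mod int q)"
  have inj: "inj_on g {0..<int q}"
  proof (rule inj_onI)
    fix x y assume xy: "x \<in> {0..<int q}" "y \<in> {0..<int q}" "g x = g y"
    hence "[a * x = a * y] (mod int q)" by (simp add: g_def cong_def)
    hence "[x = y] (mod int q)" using a by (simp add: cong_mult_lcancel coprime_commute)
    thus "x = y" using xy by (simp add: cong_def)
  qed
  have "g ` {0..<int q} \<subseteq> {0..<int q}" using q_pos by (auto simp: g_def)
  hence img: "g ` {0..<int q} = {0..<int q}"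
    using inj by (intro endo_inj_surj) auto
  have "(\<Sum>b\<in>{0..<int q}. f b) = (\<Sum>b\<in>{0..<int q}. f (g b))"
    using sum.reindex[OF inj, of f] img by simp
  also have "\<dots> = (\<Sum>b\<in>{0..<int q}. f (a * b))"
    by (intro sum.cong refl f) (simp add: g_def cong_def)
  finally show ?thesis by simp
qed

section \<open>Additive characters and Gauss sums\<close>

definition ee :: "int \<Rightarrow> complex" where
  "ee a = exp (2 * of_real pi * \<i> * of_int a / of_nat q)"

lemma ee_add: "ee (a + b) = ee a * ee b"
  by (simp add: ee_def exp_add[symmetric] algebra_simps add_divide_distrib)

lemma ee_q_mult: "ee (int q * k) = 1"
proof -
  have "2 * of_real pi * \<i> * of_int (int q * k) / of_nat q = 2 * of_real pi * \<i> * of_int k"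
    using q_pos by simp
  hence "ee (int q * k) = exp (2 * of_real pi * \<i> * of_int k)"
    unfolding ee_def by (rule arg_cong)
  also have "\<dots> = 1"
    unfolding exp_eq_1 by (auto intro!: exI[of _ k])
  finally show ?thesis .
qed

lemma ee_cong: assumes "[a = b] (mod int q)" shows "ee a = ee b"
proof -
  obtain k where "b = a + int q * k" using assms by (auto simp: cong_iff_lin)
  thus ?thesis by (simp add: ee_add ee_q_mult)
qed

lemma ee_power: "ee (int n * a) = ee a ^ n"
  unfolding ee_def exp_of_nat_mult[symmetric] by (simp add: mult_ac)

lemma ee_eq_1: assumes "ee a = 1" shows "int q dvd a"
proof -
  obtain n :: int where "Im (2 * of_real pi * \<i> * of_int a / of_nat q) = real_of_int (2 * n) * pi"
    using assms unfolding ee_def exp_eq_1 by blast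
  hence "2 * pi * of_int a / real q = real_of_int (2 * n) * pi" by (simp add: Im_divide_of_nat)
  hence "real_of_int a = real_of_int (n * int q)" using q_pos by (simp add: field_simps)
  hence "a = n * int q" by linarith
  thus ?thesis by simp
qed

lemma ee_orthogonal: "(\<Sum>b\<in>{0..<int q}. ee (b * a)) = (if int q dvd a then of_nat q else 0)"
proof -
  have "(\<Sum>b\<in>{0..<int q}. ee (b * a)) = (\<Sum>n<q. ee (int n * a))"
    by (rule sum.reindex_bij_witness[of _ int nat]) auto
  also have "\<dots> = (\<Sum>n<q. ee a ^ n)"
    by (simp only: ee_power)
  also have "\<dots> = (if int q dvd a then of_nat q else 0)"
  proof (cases "int q dvd a")
    case True
    then obtain k where "a = int q * k" by (auto simp: dvd_def)
    hence "ee a = 1" by (simp only: ee_q_mult)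
    hence "(\<Sum>n<q. ee a ^ n) = of_nat q" by simp
    thus ?thesis using True by simp
  next
    case False
    hence "ee a \<noteq> 1" using ee_eq_1[of a] by blast
    hence "(\<Sum>n<q. ee a ^ n) = (ee a ^ q - 1) / (ee a - 1)" by (rule geometric_sum)
    also have "ee a ^ q = 1" unfolding ee_power[of q a, symmetric] by (rule ee_q_mult)
    finally show ?thesis using False by simp
  qed
  finally show ?thesis .
qed

text \<open>Formed with the conjugate character, so that as a function of \<open>n\<close> it is
  proportional to \<open>chi\<close> itself.\<close>

definition gauss :: "int \<Rightarrow> complex" where
  "gauss n = (\<Sum>b\<in>{0..<int q}. cnj (chi b) * ee (b * n))"

lemma gauss_reindex:
  assumes a: "coprime a (int q)"
  shows "gauss n = cnj (chi a) * gauss (a * n)"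
proof -
  have "gauss n = (\<Sum>b\<in>{0..<int q}. cnj (chi (a * b)) * ee (a * b * n))"
    unfolding gauss_def
    by (rule sum_reindex_mult[OF _ a, symmetric]) (metis cong ee_cong cong_scalar_right)
  also have "\<dots> = cnj (chi a) * gauss (a * n)"
    by (simp add: gauss_def mult sum_distrib_left mult_ac)
  finally show ?thesis .
qed

lemma gauss_coprime:
  assumes "coprime n (int q)"
  shows "gauss n = chi n * gauss 1"
  using gauss_reindex[OF assms, of 1] mult_cnj[OF assms] by (simp add: mult_ac)

text \<open>Take \<open>b = a + d * t\<close> with \<open>t\<close> the product of the primes of
  \<open>q\<close> not dividing \<open>a\<close>. A prime of \<open>q\<close> dividing
  \<open>a\<close> divides neither \<open>d\<close> nor \<open>t\<close>; any other prime of
  \<open>q\<close> divides \<open>t\<close> but not \<open>a\<close>. So none divides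
  \<open>b\<close>.\<close>

lemma coprime_lift:
  assumes d: "d dvd q" and a: "coprime a (int d)"
  shows "\<exists>b. [b = a] (mod int d) \<and> coprime b (int q)"
proof -
  define t where "t = \<Prod>{p \<in> prime_factors q. \<not> int p dvd a}"
  have fin: "finite {p \<in> prime_factors q. \<not> int p dvd a}" by simp
  define b where "b = a + int d * int t"
  have "coprime b (int q)"
  proof (rule ccontr)
    assume "\<not> coprime b (int q)"
    then obtain p' :: int where p': "prime p'" "p' dvd b" "p' dvd int q"
    proof -
      have "\<not> is_unit (gcd b (int q))" "gcd b (int q) \<noteq> 0"
        using \<open>\<not> coprime b (int q)\<close> q_pos by (auto simp: coprime_iff_gcd_eq_1)
      then obtain p' where "prime p'" "p' dvd gcd b (int q)" by (meson prime_divisor_exists)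
      thus ?thesis using that by auto
    qed
    define p where "p = nat p'"
    have p: "prime p" "int p = p'" using p' by (auto simp: p_def prime_ge_0_int)
    have pq: "p dvd q" "int p dvd b" using p' p by auto
    show False
    proof (cases "int p dvd a")
      case True
      hence "int p dvd int d * int t" using pq(2) by (simp add: b_def dvd_add_right_iff)
      hence "p dvd d * t" by (metis int_dvd_int_iff of_nat_mult)
      hence "p dvd d \<or> p dvd t" using p(1) by (simp add: prime_dvd_mult_iff)
      moreover have "\<not> p dvd d"
      proof
        assume "p dvd d"
        hence "int p dvd 1" using True a coprime_common_divisor[of a "int d" "int p"] by simp
        thus False using p(1) by (metis int_dvd_int_iff not_prime_unit of_nat_1)
      qed
      moreover have "\<not> p dvd t"
      proof
        assume "p dvd t"
        then obtain r where "r \<in> {p \<in> prime_factors q. \<not> int p dvd a}" "p dvd r"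
          unfolding t_def using prime_dvd_prod_iff[OF fin p(1), of "\<lambda>x. x"] by auto
        hence r: "prime r" "\<not> int r dvd a" "p dvd r" by auto
        hence "p = r" using p(1) primes_dvd_imp_eq by blast
        thus False using True r(2) by simp
      qed
      ultimately show False by blast
    next
      case False
      have "p \<in> {p \<in> prime_factors q. \<not> int p dvd a}"
        using False p(1) pq(1) q_pos by (simp add: prime_factors_dvd)
      hence "p dvd t" unfolding t_def by (rule dvd_prodI[OF fin])
      hence "int p dvd int d * int t" by simp
      hence "int p dvd a" using pq(2) unfolding b_def by (metis dvd_add_left_iff)
      with False show False by blast
    qed
  qed
  moreover have "[b = a] (mod int d)" by (simp add: b_def cong_def)
  ultimately show ?thesis by blast
qed

text \<open>Let \<open>d = q / gcd n q\<close>. A unit \<open>c\<close> congruent to 1 modulo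
  \<open>d\<close> satisfies \<open>c * n = n\<close> modulo \<open>q\<close>, so a nonzero Gauss
  sum at \<open>n\<close> forces \<open>chi c = 1\<close>. Then \<open>chi\<close> is induced from
  the proper divisor \<open>d\<close>, against primitivity.\<close>

lemma primitive_gauss_zero:
  assumes prim: "conductor q chi = q" and n: "\<not> coprime n (int q)"
  shows "gauss n = 0"
proof (rule ccontr)
  assume nz: "gauss n \<noteq> 0"
  define g where "g = nat (gcd n (int q))"
  have g: "int g = gcd n (int q)" by (simp add: g_def)
  have g_dvd: "g dvd q" by (metis g gcd_dvd2 int_dvd_int_iff)
  define d where "d = q div g"
  have qd: "q = g * d" using g_dvd by (simp add: d_def)
  have g1: "g > 1"
  proof -
    have "g \<noteq> 0" using qd q_pos by (metis mult_0 less_irrefl)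
    moreover have "g \<noteq> 1" using g n by (metis coprime_iff_gcd_eq_1 of_nat_1)
    ultimately show ?thesis by linarith
  qed
  have d0: "d > 0" using qd q_pos by (metis mult_0_right neq0_conv)
  have dq: "d < q" using qd g1 d0 by simp
  have d_dvd: "d dvd q" using qd by simp
  have one: "chi c = 1" if c: "coprime c (int q)" "[c = 1] (mod int d)" for c
  proof -
    obtain k where k: "c - 1 = int d * k" using c(2) by (metis cong_iff_dvd_diff dvdE)
    obtain m where m: "n = int g * m" using g by (metis dvdE gcd_dvd1)
    have "c * n - n = (c - 1) * n" by (simp add: algebra_simps)
    also have "\<dots> = int q * (k * m)" by (simp add: k m qd)
    finally have "[c * n = n] (mod int q)" by (metis cong_iff_dvd_diff dvd_triv_left)
    hence "gauss (c * n) = gauss n"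
      unfolding gauss_def by (intro sum.cong refl arg_cong2[of _ _ _ _ "(*)"] ee_cong cong_scalar_left)
    hence "cnj (chi c) = 1" using gauss_reindex[OF c(1), of n] nz by simp
    thus ?thesis by (metis complex_cnj_cnj complex_cnj_one)
  qed
  have eq: "chi a = chi b" if ab: "coprime a (int q)" "coprime b (int q)" "[a = b] (mod int d)" for a b
  proof -
    obtain b' where b': "[b * b' = 1] (mod int q)" using ab(2) cong_solve_coprime_int by blast
    have cb': "coprime b' (int q)" using b' by (metis coprime_iff_invertible_int mult.commute)
    have "[b * b' = 1] (mod int d)" using b' d_dvd by (meson cong_dvd_modulus int_dvd_int_iff)
    moreover have "[a * b' = b * b'] (mod int d)" using ab(3) by (rule cong_scalar_right)
    ultimately have "[a * b' = 1] (mod int d)" using cong_trans by blast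
    hence "chi (a * b') = 1" using ab(1) cb' by (intro one) auto
    moreover have "chi (b * b') = 1" using cong[OF b'] chi_1 by simp
    ultimately have "chi a * chi b' = chi b * chi b'" by (simp add: mult)
    thus ?thesis using nonzero_iff[of b'] cb' by simp
  qed
  \<comment> \<open>The choice is harmless: by \<open>eq\<close> the value of \<open>chi\<close> at
    a unit depends only on its class modulo \<open>d\<close>.\<close>
  define lift where "lift = (\<lambda>a. SOME b. [b = a] (mod int d) \<and> coprime b (int q))"
  have lift: "[lift a = a] (mod int d)" "coprime (lift a) (int q)" if "coprime a (int d)" for a
    using someI_ex[OF coprime_lift[OF d_dvd that]] by (auto simp: lift_def)
  define \<psi> where "\<psi> = (\<lambda>a. if coprime a (int d) then chi (lift a) else 0)"
  have \<psi>_cong: "\<psi> a = \<psi> b" if ab: "[a = b] (mod int d)" for a b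
  proof (cases "coprime a (int d)")
    case True
    hence b: "coprime b (int d)" using ab cong_imp_coprime by blast
    have "[lift a = lift b] (mod int d)" using lift(1)[OF True] lift(1)[OF b] ab by (meson cong_sym cong_trans)
    thus ?thesis using True b eq lift by (simp add: \<psi>_def)
  next
    case False
    hence "\<not> coprime b (int d)" using ab cong_imp_coprime cong_sym by blast
    thus ?thesis using False by (simp add: \<psi>_def)
  qed
  have "dirichlet_character d \<psi>"
    unfolding dirichlet_character_def
  proof (intro conjI allI)
    show "\<psi> (a * b) = \<psi> a * \<psi> b" for a b
    proof (cases "coprime a (int d) \<and> coprime b (int d)")
      case True
      hence ab: "coprime (a * b) (int d)" by simp
      have "[lift (a * b) = lift a * lift b] (mod int d)"
        using lift(1)[OF ab] lift(1)[of a] lift(1)[of b] True cong_mult cong_sym cong_trans by meson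
      hence "chi (lift (a * b)) = chi (lift a * lift b)"
        using lift(2) True ab by (intro eq) auto
      thus ?thesis using True ab by (simp add: \<psi>_def mult)
    qed (auto simp: \<psi>_def)
    show "\<psi> (a + int d) = \<psi> a" for a by (rule \<psi>_cong) (simp add: cong_def)
    show "\<psi> a \<noteq> 0 \<longleftrightarrow> coprime a (int d)" for a
      using lift(2) nonzero_iff by (auto simp: \<psi>_def)
  qed (rule d0)
  moreover have "chi a = \<psi> a" if a: "coprime a (int q)" for a
  proof -
    have "coprime a (int d)" using a d_dvd by (meson coprime_divisors dvd_refl int_dvd_int_iff)
    thus ?thesis using a lift[of a] eq[of a "lift a"] by (simp add: \<psi>_def cong_sym)
  qed
  ultimately have "induced_from q chi d" using d_dvd by (auto simp: induced_from_def)
  hence "conductor q chi \<le> d" unfolding conductor_def by (rule Least_le)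
  thus False using prim dq by simp
qed

text \<open>Inversion of the finite Fourier transform, followed by conjugation. Primitivity makes
  the Gauss sum proportional to \<open>chi\<close> at all integers, also at those not coprime to
  \<open>q\<close>.\<close>

lemma primitive_expansion:
  assumes prim: "conductor q chi = q"
  shows "chi m = cnj (gauss 1) / of_nat q * gauss m"
proof -
  have g: "gauss n = chi n * gauss 1" for n
    using gauss_coprime[of n] primitive_gauss_zero[OF prim, of n] nonzero_iff[of n] by auto
  have cnj_ee: "cnj (ee a) = ee (-a)" for a by (simp add: ee_def exp_cnj)
  have "(\<Sum>n\<in>{0..<int q}. gauss n * ee (- (n * m))) =
      (\<Sum>n\<in>{0..<int q}. \<Sum>b\<in>{0..<int q}. cnj (chi b) * ee (n * (b - m)))"
    unfolding gauss_def sum_distrib_right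
    by (intro sum.cong refl) (simp add: ee_add[symmetric] algebra_simps)
  also have "\<dots> = (\<Sum>b\<in>{0..<int q}. cnj (chi b) * (\<Sum>n\<in>{0..<int q}. ee (n * (b - m))))"
    by (subst sum.swap) (simp add: sum_distrib_left)
  also have "\<dots> = (\<Sum>b\<in>{0..<int q}. if b = m mod int q then cnj (chi b) * of_nat q else 0)"
  proof (intro sum.cong refl)
    fix b assume "b \<in> {0..<int q}"
    hence "int q dvd (b - m) \<longleftrightarrow> b = m mod int q"
      by (auto simp: mod_eq_dvd_iff[symmetric])
    thus "cnj (chi b) * (\<Sum>n\<in>{0..<int q}. ee (n * (b - m))) = (if b = m mod int q then cnj (chi b) * of_nat q else 0)"
      by (simp add: ee_orthogonal)
  qed
  also have "\<dots> = cnj (chi m) * of_nat q"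
    using q_pos cong[of "m mod int q" m] by simp
  finally have inv: "(\<Sum>n\<in>{0..<int q}. gauss n * ee (- (n * m))) = cnj (chi m) * of_nat q" .
  have "(\<Sum>n\<in>{0..<int q}. gauss n * ee (- (n * m))) = gauss 1 * (\<Sum>n\<in>{0..<int q}. chi n * ee (- (n * m)))"
    unfolding sum_distrib_left
  proof (rule sum.cong[OF refl])
    show "gauss n * ee (- (n * m)) = gauss 1 * (chi n * ee (- (n * m)))" for n
      unfolding g[of n] by (simp only: mult_ac)
  qed
  with inv have "cnj (cnj (chi m) * of_nat q) = cnj (gauss 1 * (\<Sum>n\<in>{0..<int q}. chi n * ee (- (n * m))))"
    by (simp only:)
  hence "chi m * of_nat q = cnj (gauss 1) * gauss m"
    unfolding gauss_def[of m] complex_cnj_mult cnj_sum cnj_ee minus_minus complex_cnj_cnj complex_cnj_of_nat .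
  moreover have "(of_nat q :: complex) \<noteq> 0" using q_pos by simp
  ultimately show ?thesis by (metis nonzero_mult_div_cancel_right times_divide_eq_left)
qed

end

subsection \<open>Partial fractions\<close>

lemma not_Ints_sin_nonzero: "u \<notin> \<int> \<Longrightarrow> sin (of_real pi * u :: complex) \<noteq> 0"
  using sin_eq_0[of "of_real pi * u"] by (auto simp: mult.commute)

text \<open>Differentiation of the reflection formula of Gamma, with the common factor
  \<open>Gamma u * Gamma (1 - u)\<close> cancelled.\<close>

lemma Digamma_reflection:
  assumes u: "(u :: complex) \<notin> \<int>"
  shows "Digamma (1 - u) - Digamma u = of_real pi * (cos (of_real pi * u) / sin (of_real pi * u))"
proof -
  have nz: "sin (of_real pi * u) \<noteq> 0" by (rule not_Ints_sin_nonzero[OF u])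
  have u1: "u \<notin> \<int>\<^sub>\<le>\<^sub>0" using u nonpos_Ints_subset_Ints by blast
  have u2: "1 - u \<notin> \<int>\<^sub>\<le>\<^sub>0"
  proof
    assume "1 - u \<in> \<int>\<^sub>\<le>\<^sub>0"
    hence "1 - (1 - u) \<in> \<int>" using nonpos_Ints_subset_Ints by (intro Ints_diff) auto
    with u show False by simp
  qed
  have "((\<lambda>z. Gamma z * Gamma (1 - z)) has_field_derivative
      Gamma u * Gamma (1 - u) * (Digamma u - Digamma (1 - u))) (at u)"
    using u1 u2 by (auto intro!: derivative_eq_intros simp: algebra_simps)
  moreover have "((\<lambda>z. of_real pi / sin (of_real pi * z)) has_field_derivative
      - (of_real pi * (cos (of_real pi * u) * of_real pi)) / (sin (of_real pi * u))\<^sup>2) (at u)"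
    using nz by (auto intro!: derivative_eq_intros simp: power2_eq_square)
  moreover have "(\<lambda>z. Gamma z * Gamma (1 - z)) = (\<lambda>z :: complex. of_real pi / sin (of_real pi * z))"
    by (intro ext Gamma_reflection_complex)
  ultimately have "Gamma u * Gamma (1 - u) * (Digamma u - Digamma (1 - u)) =
      - (of_real pi * (cos (of_real pi * u) * of_real pi)) / (sin (of_real pi * u))\<^sup>2"
    using DERIV_unique by metis
  hence "(of_real pi / sin (of_real pi * u)) * (Digamma u - Digamma (1 - u)) =
      (of_real pi / sin (of_real pi * u)) * (- (of_real pi * (cos (of_real pi * u) / sin (of_real pi * u))))"
    unfolding Gamma_reflection_complex by (simp add: power2_eq_square)
  hence "Digamma u - Digamma (1 - u) = - (of_real pi * (cos (of_real pi * u) / sin (of_real pi * u)))"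
    using nz by (subst (asm) mult_cancel_left) simp
  thus ?thesis by (simp add: algebra_simps)
qed

text \<open>Subtracting the Digamma series at \<open>u\<close> from that at \<open>1 - u\<close>
  cancels Euler's constant and the harmonic terms. The two-sided expansion is folded to nonnegative
  \<open>n\<close>, pairing \<open>u + n\<close> with \<open>1 - u + n\<close>.\<close>

lemma cot_partial_fractions:
  assumes u: "(u :: complex) \<notin> \<int>"
  shows "(\<lambda>n. 1 / (u + of_nat n) - 1 / (1 - u + of_nat n)) sums
           (of_real pi * (cos (of_real pi * u) / sin (of_real pi * u)))"
proof -
  have S: "(\<lambda>n. inverse (of_nat (Suc n)) - inverse (z + of_nat n)) sums (Digamma z + euler_mascheroni)"
    if "z \<noteq> 0" for z :: complex
    using summable_sums[OF summable_Digamma[OF that]] by (simp add: Digamma_def)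
  have "u \<noteq> 0" "1 - u \<noteq> 0" using u by auto
  from sums_diff[OF S[OF this(2)] S[OF this(1)]]
  show ?thesis
    by (simp add: inverse_eq_divide Digamma_reflection[OF u] algebra_simps)
qed

text \<open>The cotangent is a fractional linear function of \<open>w\<close>, so the geometric
  series can be expressed by it. The factor \<open>pi\<close> is kept so that the expression matches
  the partial fractions.\<close>

lemma geometric_cot:
  assumes u: "Im u > 0"
  defines "w \<equiv> exp (2 * of_real pi * \<i> * u)"
  shows "(\<lambda>n. w ^ Suc n) sums (- (1/2) + \<i> / (2 * of_real pi) * (of_real pi * (cos (of_real pi * u) / sin (of_real pi * u))))"
proof -
  have w1: "norm w < 1" using u by (simp add: w_def)
  hence w1': "w \<noteq> 1" by auto
  have "u \<notin> \<int>" using u by (auto elim!: Ints_cases)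
  hence nz: "sin (of_real pi * u) \<noteq> 0" by (rule not_Ints_sin_nonzero)
  define E where "E = exp (\<i> * (of_real pi * u))"
  have E0: "E \<noteq> 0" by (simp add: E_def)
  have E: "exp (- (\<i> * (of_real pi * u))) = 1 / E" by (simp add: E_def exp_minus field_simps)
  have wE: "w = E * E" by (simp add: w_def E_def exp_add[symmetric] mult_ac)
  have s: "sin (of_real pi * u) = (E - 1 / E) / (2 * \<i>)"
    unfolding sin_exp_eq E_def[symmetric] E by simp
  have c: "cos (of_real pi * u) = (E + 1 / E) / 2"
    unfolding cos_exp_eq E_def[symmetric] E by simp
  have E1: "E - 1 / E \<noteq> 0" using nz s by auto
  have ratio: "\<i> * ((a / 2) / (b / (2 * \<i>))) = - (a / b)" if "b \<noteq> 0" for a b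
    using that by (simp add: field_simps)
  have "\<i> * (cos (of_real pi * u) / sin (of_real pi * u)) = - ((E + 1 / E) / (E - 1 / E))"
    unfolding s c using E1 ratio by blast
  also have "(E + 1 / E) / (E - 1 / E) = (w + 1) / (w - 1)"
  proof -
    have "E + 1 / E = (w + 1) / E" "E - 1 / E = (w - 1) / E"
      unfolding wE using E0 by (simp_all add: field_simps)
    thus ?thesis using E0 by simp
  qed
  finally have cot: "\<i> * (cos (of_real pi * u) / sin (of_real pi * u)) = - ((w + 1) / (w - 1))" .
  have 1: "(\<lambda>n. w * w ^ n) sums (w * (1 / (1 - w)))"
    by (intro sums_mult geometric_sums w1)
  have 2: "w * (1 / (1 - w)) = - (1/2) + (\<i> * (cos (of_real pi * u) / sin (of_real pi * u))) / 2"
    unfolding cot using w1' by (simp add: field_simps)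
  have 3: "(\<i> * (cos (of_real pi * u) / sin (of_real pi * u))) / 2 =
      \<i> / (2 * of_real pi) * (of_real pi * (cos (of_real pi * u) / sin (of_real pi * u)))"
    by simp
  show ?thesis using 1 unfolding 2 3 power_Suc .
qed

locale odd_primitive = dirichlet_char +
  assumes prim: "conductor q chi = q" and odd: "chi (-1) = -1"
begin

lemma chi_minus: "chi (- a) = - chi a"
  using mult[of "-1" a] odd by simp

lemma q_gt_1: "q > 1"
proof (rule ccontr)
  assume "\<not> q > 1"
  hence "q = 1" using q_pos by simp
  hence "chi (-1) = chi 1" by (intro cong) simp
  thus False using odd chi_1 by simp
qed

lemma chi_0: "chi 0 = 0" and chi_q: "chi (int q) = 0"
  using nonzero_iff[of 0] nonzero_iff[of "int q"] q_gt_1 by auto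

lemma sum_chi: "(\<Sum>b\<in>{0..<int q}. chi b) = 0"
proof -
  have "(\<Sum>b\<in>{0..<int q}. chi (-1 * b)) = (\<Sum>b\<in>{0..<int q}. chi b)"
    by (rule sum_reindex_mult[OF cong]) auto
  thus ?thesis by (simp add: chi_minus sum_negf)
qed

lemma sum_Suc_eq:
  fixes f :: "int \<Rightarrow> complex"
  assumes "f (int q) = f 0"
  shows "(\<Sum>i<q. f (int (Suc i))) = (\<Sum>b\<in>{0..<int q}. f b)"
proof -
  have "(\<Sum>i<q. f (int (Suc i))) = (\<Sum>b\<in>{1..int q}. f b)"
    by (rule sum.reindex_bij_witness[of _ "\<lambda>b. nat (b - 1)" "\<lambda>i. int (Suc i)"]) auto
  also have "{1..int q} = insert (int q) {1..<int q}" using q_pos by auto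
  also have "(\<Sum>b\<in>\<dots>. f b) = f 0 + (\<Sum>b\<in>{1..<int q}. f b)" using assms by simp
  also have "\<dots> = (\<Sum>b\<in>insert 0 {1..<int q}. f b)" by simp
  also have "insert 0 {1..<int q} = {0..<int q}" using q_pos by auto
  finally show ?thesis .
qed

lemma sum_chi_Suc: "(\<Sum>i<q. chi (int (Suc i))) = 0"
  using sum_Suc_eq[of chi] chi_0 chi_q sum_chi by simp

sublocale X: periodic_mean_zero "\<lambda>n. chi (int n)" q 1
proof
  show "chi (int (n + q)) = chi (int n)" for n by (rule cong) (simp add: cong_def)
qed (use q_pos norm_chi sum_chi_Suc in auto)

sublocale Y: periodic_mean_zero "\<lambda>n. cnj (chi (int n))" q 1
proof
  show "(\<Sum>i<q. cnj (chi (int (Suc i)))) = 0"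
    using arg_cong[OF sum_chi_Suc, of cnj] by simp
qed (use q_pos X.periodic X.c_le in auto)

lemma Y_block: "Y.block s n = cnj (X.block (cnj s) n)"
proof -
  have "cnj (of_nat (Suc m) powr (- cnj s)) = of_nat (Suc m) powr (-s)" for m
    by (subst cnj_powr) (auto simp del: of_nat_Suc)
  thus ?thesis by (simp add: Y.block_def X.block_def del: of_nat_Suc of_nat_add of_nat_mult)
qed

lemma Y_D: assumes "Re s > 0" shows "Y.D s = cnj (X.D (cnj s))"
proof -
  have "X.block (cnj s) sums X.D (cnj s)"
    unfolding X.D_def using assms by (intro summable_sums X.summable_block) simp
  hence "(\<lambda>n. cnj (X.block (cnj s) n)) sums cnj (X.D (cnj s))" by (simp add: sums_cnj)
  thus ?thesis unfolding Y.D_def Y_block by (simp add: sums_iff)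
qed

text \<open>With \<open>v = m / q\<close> this is \<open>1 / (v + i y) + 1 / (v - i y)\<close>, the
  two pole terms that oddness of the character brings together.\<close>

definition rt :: "nat \<Rightarrow> real \<Rightarrow> real" where
  "rt m y = 2 * (real m / real q) / ((real m / real q)\<^sup>2 + y\<^sup>2)"

text \<open>Plays the part of the theta transformation. Expanding \<open>chi\<close> by Gauss sums
  turns the exponential series into geometric series at \<open>b / q + i y\<close>, hence into
  cotangents, and their partial fractions give a series over the conjugate character.
  \<open>S\<close> is the common limit that links the two sides.\<close>

lemma exp_series_partial_fractions:
  assumes y: "y > 0"
  obtains S where
    "(\<lambda>n. \<Sum>i<q. chi (int (Suc i)) * of_real (exp (- 2 * pi * real (Suc (n * q + i)) * y)))
       sums (cnj (gauss 1) / of_nat q * (\<i> / (2 * of_real pi)) * S)"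
    "(\<lambda>n. \<Sum>i<q. cnj (chi (int (Suc i))) * of_real (rt (Suc (n * q + i)) y)) sums S"
proof -
  define C where "C = cnj (gauss 1) / of_nat q"
  define u where "u = (\<lambda>b::int. of_int b / of_nat q + \<i> * of_real y :: complex)"
  define w where "w = (\<lambda>b. exp (2 * of_real pi * \<i> * u b))"
  have Im_u: "Im (u b) > 0" for b using y by (simp add: u_def Im_divide_of_nat)
  have u_nint: "u b \<notin> \<int>" for b using Im_u[of b] by (auto elim!: Ints_cases)
  define ct where "ct = (\<lambda>b. of_real pi * (cos (of_real pi * u b) / sin (of_real pi * u b)))"
  define f where "f = (\<lambda>n. chi (int (Suc n)) * of_real (exp (- 2 * pi * real (Suc n) * y)))"
  have f_eq: "f n = C * (\<Sum>b\<in>{0..<int q}. cnj (chi b) * w b ^ Suc n)" for n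
  proof -
    have ew: "ee (b * int (Suc n)) * of_real (exp (- 2 * pi * real (Suc n) * y)) = w b ^ Suc n" for b
    proof -
      have "of_real (exp (- 2 * pi * real (Suc n) * y)) = exp (of_real (- 2 * pi * real (Suc n) * y) :: complex)"
        by (rule exp_of_real[symmetric])
      moreover have "2 * of_real pi * \<i> * of_int (b * int (Suc n)) / of_nat q + of_real (- 2 * pi * real (Suc n) * y) =
          of_nat (Suc n) * (2 * of_real pi * \<i> * u b)"
      proof -
        have "2 * of_real pi * \<i> * u b = 2 * of_real pi * \<i> * (of_int b / of_nat q) + (2 * of_real pi) * (\<i> * \<i>) * of_real y"
          by (simp only: u_def distrib_left mult.assoc)
        hence uu: "2 * of_real pi * \<i> * u b = 2 * of_real pi * \<i> * (of_int b / of_nat q) - 2 * of_real pi * of_real y"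
          by simp
        show ?thesis unfolding uu by (simp add: algebra_simps del: of_nat_Suc)
      qed
      ultimately show ?thesis
        unfolding ee_def w_def exp_of_nat_mult[symmetric] by (simp only: exp_add[symmetric])
    qed
    have "f n = C * (gauss (int (Suc n)) * of_real (exp (- 2 * pi * real (Suc n) * y)))"
      unfolding f_def C_def by (subst primitive_expansion[OF prim]) (simp only: mult.assoc)
    also have "gauss (int (Suc n)) * of_real (exp (- 2 * pi * real (Suc n) * y)) =
        (\<Sum>b\<in>{0..<int q}. cnj (chi b) * w b ^ Suc n)"
      unfolding gauss_def sum_distrib_right mult.assoc[of "cnj (chi b)" for b] ew ..
    finally show ?thesis .
  qed
  have "(\<lambda>n. C * (\<Sum>b\<in>{0..<int q}. cnj (chi b) * w b ^ Suc n)) sums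
     (C * (\<Sum>b\<in>{0..<int q}. cnj (chi b) * (- (1/2) + \<i> / (2 * of_real pi) * ct b)))"
    unfolding ct_def w_def by (intro sums_mult sums_sum geometric_cot Im_u)
  \<comment> \<open>The constant -1/2 of each cotangent drops out because the conjugate character
    sums to 0 over a period.\<close>
  also have "(\<Sum>b\<in>{0..<int q}. cnj (chi b) * (- (1/2) + \<i> / (2 * of_real pi) * ct b)) =
      \<i> / (2 * of_real pi) * (\<Sum>b\<in>{0..<int q}. cnj (chi b) * ct b)"
  proof -
    have "(\<Sum>b\<in>{0..<int q}. cnj (chi b) * (- (1/2) + \<i> / (2 * of_real pi) * ct b)) =
        (\<Sum>b\<in>{0..<int q}. cnj (chi b)) * (- (1/2)) + (\<Sum>b\<in>{0..<int q}. \<i> / (2 * of_real pi) * (cnj (chi b) * ct b))"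
      unfolding sum_distrib_right sum.distrib[symmetric] by (intro sum.cong refl) (simp add: algebra_simps)
    moreover have "(\<Sum>b\<in>{0..<int q}. cnj (chi b)) = 0"
      using arg_cong[OF sum_chi, of cnj] by simp
    ultimately show ?thesis by (simp only: sum_distrib_left) simp
  qed
  finally have f_sums: "f sums (C * (\<i> / (2 * of_real pi) * (\<Sum>b\<in>{0..<int q}. cnj (chi b) * ct b)))"
    unfolding f_eq .
  have blk: "sum f {n * q..<n * q + q} = (\<Sum>i<q. chi (int (Suc i)) * of_real (exp (- 2 * pi * real (Suc (n * q + i)) * y)))" for n
  proof -
    have "sum f {n * q..<n * q + q} = (\<Sum>i<q. f (n * q + i))"
      using sum.shift_bounds_nat_ivl[of f 0 "n * q" q] by (simp add: add.commute atLeast0LessThan)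
    thus ?thesis unfolding f_def using X.periodic_Suc by simp
  qed
  from sums_group[OF f_sums q_pos]
  have LHS: "(\<lambda>n. \<Sum>i<q. chi (int (Suc i)) * of_real (exp (- 2 * pi * real (Suc (n * q + i)) * y))) sums
      (C * (\<i> / (2 * of_real pi) * (\<Sum>b\<in>{0..<int q}. cnj (chi b) * ct b)))"
    unfolding blk .
  define K where "K = (\<lambda>n. \<Sum>b\<in>{0..<int q}. cnj (chi b) * (1 / (u b + of_nat n) - 1 / (1 - u b + of_nat n)))"
  have K_sums: "K sums (\<Sum>b\<in>{0..<int q}. cnj (chi b) * ct b)"
    unfolding K_def ct_def by (intro sums_sum sums_mult cot_partial_fractions u_nint)
  have K_eq: "K n = (\<Sum>i<q. cnj (chi (int (Suc i))) * of_real (rt (Suc (n * q + i)) y))" for n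
  proof -
    define v where "v = (\<lambda>b::int. of_int b / of_nat q + of_nat n :: complex)"
    have iv: "insert 0 {1..<int q} = {0..<int q}" using q_pos by auto
    have split: "(\<Sum>b\<in>{0..<int q}. cnj (chi b) * g b) = (\<Sum>b\<in>{1..<int q}. cnj (chi b) * g b)" for g :: "int \<Rightarrow> complex"
      unfolding iv[symmetric] using chi_0 by simp
    have q0: "(of_nat q :: complex) \<noteq> 0" using q_pos by simp
    \<comment> \<open>Replacing \<open>b\<close> by \<open>q - b\<close> reverses the sign of the
      odd character, so the difference of pole terms becomes a sum.\<close>
    have refl': "(\<Sum>b\<in>{1..<int q}. cnj (chi b) * (1 / (1 - u b + of_nat n))) =
        - (\<Sum>b\<in>{1..<int q}. cnj (chi b) * (1 / (v b - \<i> * of_real y)))"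
      unfolding sum_negf[symmetric]
    proof (rule sum.reindex_bij_witness[of _ "\<lambda>b. int q - b" "\<lambda>b. int q - b"], goal_cases)
      case (5 b)
      have "chi (int q - b) = chi (- b)" by (rule cong) (simp add: cong_iff_dvd_diff)
      moreover have "v (int q - b) - \<i> * of_real y = 1 - u b + of_nat n"
        using q0 by (simp add: v_def u_def diff_divide_distrib)
      ultimately show ?case by (simp add: chi_minus)
    qed auto
    have "K n = (\<Sum>b\<in>{1..<int q}. cnj (chi b) * (1 / (v b + \<i> * of_real y))) +
        (\<Sum>b\<in>{1..<int q}. cnj (chi b) * (1 / (v b - \<i> * of_real y)))"
      unfolding K_def right_diff_distrib sum_subtractf split refl'
      by (simp add: u_def v_def algebra_simps)
    also have "\<dots> = (\<Sum>b\<in>{1..<int q}. cnj (chi b) * (1 / (v b + \<i> * of_real y) + 1 / (v b - \<i> * of_real y)))"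
      unfolding sum.distrib[symmetric] distrib_left ..
    also have "\<dots> = (\<Sum>b\<in>{1..<int q}. cnj (chi b) * of_real (rt (n * q + nat b) y))"
    proof (intro sum.cong refl arg_cong2[of _ _ _ _ "(*)"])
      fix b assume b: "b \<in> {1..<int q}"
      define r where "r = real (n * q + nat b) / real q"
      have vr: "v b = of_real r"
        using b q_pos by (simp add: v_def r_def field_simps)
      have nz: "of_real r + \<i> * of_real y \<noteq> 0" "of_real r - \<i> * of_real y \<noteq> 0"
        using y by (auto simp: complex_eq_iff)
      have "(of_real r + \<i> * of_real y) * (of_real r - \<i> * of_real y) = of_real (r\<^sup>2 + y\<^sup>2)"
        by (simp add: power2_eq_square algebra_simps)
      moreover have "1 / (of_real r + \<i> * of_real y) + 1 / (of_real r - \<i> * of_real y) =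
          2 * of_real r / ((of_real r + \<i> * of_real y) * (of_real r - \<i> * of_real y))"
        using nz by (simp add: field_simps)
      ultimately show "1 / (v b + \<i> * of_real y) + 1 / (v b - \<i> * of_real y) = of_real (rt (n * q + nat b) y)"
        unfolding vr rt_def r_def[symmetric] by simp
    qed
    also have "\<dots> = (\<Sum>b\<in>{0..<int q}. cnj (chi b) * of_real (rt (n * q + nat b) y))"
      by (rule split[symmetric])
    also have "\<dots> = (\<Sum>i<q. cnj (chi (int (Suc i))) * of_real (rt (n * q + nat (int (Suc i))) y))"
      by (rule sum_Suc_eq[symmetric]) (simp add: chi_0 chi_q)
    finally show ?thesis by (simp only: nat_int add_Suc_right)
  qed
  show ?thesis
  proof (rule that)
    show "(\<lambda>n. \<Sum>i<q. chi (int (Suc i)) * of_real (exp (- 2 * pi * real (Suc (n * q + i)) * y))) sums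
        (cnj (gauss 1) / of_nat q * (\<i> / (2 * of_real pi)) * (\<Sum>b\<in>{0..<int q}. cnj (chi b) * ct b))"
      unfolding C_def[symmetric] mult.assoc[of C] by (rule LHS)
    show "(\<lambda>n. \<Sum>i<q. cnj (chi (int (Suc i))) * of_real (rt (Suc (n * q + i)) y)) sums
        (\<Sum>b\<in>{0..<int q}. cnj (chi b) * ct b)"
      using K_sums unfolding K_eq .
  qed
qed

end

subsection \<open>Functional equation\<close>

lemma has_bochner_Gamma:
  assumes a: "a > 0" and b: "b > (0::real)"
  shows "has_bochner_integral lborel (\<lambda>y. indicator {0<..} y * (y powr (a - 1) * exp (- b * y))) (Gamma a * b powr (-a))"
proof -
  have "has_bochner_integral lborel (\<lambda>y. indicator {0..} y * y powr (a - 1) / exp y) (Gamma a)"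
  proof (rule has_bochner_integral_nn_integral)
    show "nn_integral lborel (\<lambda>y. ennreal (indicator {0..} y * y powr (a - 1) / exp y)) = ennreal (Gamma a)"
      using Gamma_conv_nn_integral_real[OF a] by simp
  qed (use a in \<open>auto intro!: Gamma_real_nonneg\<close>)
  hence "has_bochner_integral lborel (\<lambda>y. indicator {0..} (0 + b * y) * (0 + b * y) powr (a - 1) / exp (0 + b * y)) (Gamma a /\<^sub>R \<bar>b\<bar>)"
    using lborel_has_bochner_integral_real_affine_iff[of b "\<lambda>y. indicator {0..} y * y powr (a - 1) / exp y" "Gamma a" 0] b by simp
  hence "has_bochner_integral lborel (\<lambda>y. b powr (1 - a) * (indicator {0..} (0 + b * y) * (0 + b * y) powr (a - 1) / exp (0 + b * y)))
      (b powr (1 - a) * (Gamma a /\<^sub>R \<bar>b\<bar>))"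
    by (rule has_bochner_integral_mult_right)
  also have "(\<lambda>y. b powr (1 - a) * (indicator {0..} (0 + b * y) * (0 + b * y) powr (a - 1) / exp (0 + b * y))) =
      (\<lambda>y. indicator {0<..} y * (y powr (a - 1) * exp (- b * y)))"
  proof
    fix y :: real
    show "b powr (1 - a) * (indicator {0..} (0 + b * y) * (0 + b * y) powr (a - 1) / exp (0 + b * y)) =
        indicator {0<..} y * (y powr (a - 1) * exp (- b * y))"
    proof (cases "y > 0")
      case True
      have "b powr (1 - a) * b powr (a - 1) = 1" using b by (simp add: powr_add[symmetric])
      thus ?thesis using True b by (simp add: powr_mult exp_minus field_simps)
    next
      case False
      thus ?thesis using b by (cases "y = 0") (auto simp: zero_le_mult_iff)
    qed
  qed
  also have "b powr (1 - a) * (Gamma a /\<^sub>R \<bar>b\<bar>) = Gamma a * b powr (-a)"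
    using b by (simp add: powr_diff powr_minus field_simps)
  finally show ?thesis .
qed

text \<open>The substitution \<open>x = y^2 / (1 + y^2)\<close> carries the half-line to the unit
  interval and the integrand to that of \<open>Beta (t / 2) (1 - t / 2)\<close>.\<close>

lemma has_bochner_rational:
  assumes t: "0 < t" "t < (1::real)"
  shows "has_bochner_integral lborel (\<lambda>y. indicator {0<..} y * (2 * y powr (t - 1) / (1 + y\<^sup>2)))
           (Gamma (t / 2) * Gamma (1 - t / 2))"
proof -
  define \<beta> where "\<beta> = (\<lambda>x::real. x powr (t / 2 - 1) * (1 - x) powr ((1 - t / 2) - 1))"
  define g where "g = (\<lambda>y::real. y\<^sup>2 / (1 + y\<^sup>2))"
  have pos: "1 + y\<^sup>2 > 0" for y :: real by (simp add: add_pos_nonneg)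
  have img: "g ` {0<..} = {0<..<1}"
  proof (intro equalityI subsetI)
    fix x assume "x \<in> g ` {0<..}"
    thus "x \<in> {0<..<1}" using pos by (auto simp: g_def divide_less_eq)
  next
    fix x :: real assume x: "x \<in> {0<..<1}"
    define y where "y = sqrt (x / (1 - x))"
    have "y > 0" "y\<^sup>2 = x / (1 - x)" using x by (auto simp: y_def)
    moreover have "g y = x" unfolding g_def \<open>y\<^sup>2 = x / (1 - x)\<close> using x by (simp add: field_simps)
    ultimately show "x \<in> g ` {0<..}" by (auto intro!: image_eqI[of _ _ y])
  qed
  have inj: "inj_on g {0<..}"
  proof (rule inj_onI)
    fix x y assume xy: "x \<in> {0<..}" "y \<in> {0<..}" "g x = g y"
    hence "x\<^sup>2 * (1 + y\<^sup>2) = y\<^sup>2 * (1 + x\<^sup>2)"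
      using pos[of x] pos[of y] by (simp add: g_def frac_eq_eq)
    hence "x\<^sup>2 = y\<^sup>2" by (simp add: algebra_simps)
    thus "x = y" using xy by (simp add: power2_eq_iff_nonneg)
  qed
  have der: "(g has_field_derivative 2 * y / (1 + y\<^sup>2)\<^sup>2) (at y within {0<..})" if "y \<in> {0<..}" for y
    unfolding g_def using pos[of y]
    by (auto intro!: derivative_eq_intros simp: field_simps power2_eq_square)
  have int\<beta>: "(\<beta> has_integral Beta (t / 2) (1 - t / 2)) {0..1}"
    unfolding \<beta>_def by (rule has_integral_Beta_real) (use t in auto)
  have "(\<beta> has_integral Beta (t / 2) (1 - t / 2)) {0<..<1}"
    using int\<beta> by (simp add: has_integral_Icc_iff_Ioo)
  moreover have "\<beta> absolutely_integrable_on {0<..<1}"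
    using calculation by (intro nonnegative_absolutely_integrable_1) (auto simp: \<beta>_def)
  ultimately have "\<beta> absolutely_integrable_on (g ` {0<..}) \<and> integral (g ` {0<..}) \<beta> = Beta (t / 2) (1 - t / 2)"
    unfolding img by (simp add: integral_unique)
  hence *: "(\<lambda>y. \<bar>2 * y / (1 + y\<^sup>2)\<^sup>2\<bar> * \<beta> (g y)) absolutely_integrable_on {0<..} \<and>
      integral {0<..} (\<lambda>y. \<bar>2 * y / (1 + y\<^sup>2)\<^sup>2\<bar> * \<beta> (g y)) = Beta (t / 2) (1 - t / 2)"
    using has_absolute_integral_change_of_variables_1'[of "{0<..}" g "\<lambda>y. 2 * y / (1 + y\<^sup>2)\<^sup>2" \<beta> "Beta (t / 2) (1 - t / 2)"]
      der inj by simp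
  have eq: "\<bar>2 * y / (1 + y\<^sup>2)\<^sup>2\<bar> * \<beta> (g y) = 2 * y powr (t - 1) / (1 + y\<^sup>2)" if y: "y \<in> {0<..}" for y
  proof -
    define s where "s = 1 + y\<^sup>2"
    have s: "s > 0" unfolding s_def by (rule pos)
    have y0: "y > 0" using y by simp
    have "1 - g y = 1 / s" using s by (simp add: g_def s_def[symmetric] field_simps)
    hence "\<beta> (g y) = (y\<^sup>2 / s) powr (t / 2 - 1) * (1 / s) powr (- t / 2)"
      by (simp add: \<beta>_def g_def s_def)
    also have "(y\<^sup>2 / s) powr (t / 2 - 1) = (y\<^sup>2) powr (t / 2 - 1) * s powr (1 - t / 2)"
      using s y0 by (simp add: powr_divide powr_minus_divide[symmetric] divide_powr_uminus)
    also have "(y\<^sup>2) powr (t / 2 - 1) = y powr (t - 2)"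
      using y0 by (simp add: powr_numeral[symmetric] powr_powr algebra_simps del: powr_numeral)
    also have "(1 / s) powr (- t / 2) = s powr (t / 2)"
      using s by (simp add: powr_divide powr_minus_divide field_simps)
    finally have "\<beta> (g y) = y powr (t - 2) * (s powr (1 - t / 2) * s powr (t / 2))" by simp
    also have "s powr (1 - t / 2) * s powr (t / 2) = s" using s by (simp add: powr_add[symmetric])
    finally have "\<bar>2 * y / s\<^sup>2\<bar> * \<beta> (g y) = 2 * (y * y powr (t - 2)) / s"
      using s y0 by (simp add: power2_eq_square)
    also have "y * y powr (t - 2) = y powr (t - 1)"
      using y0 powr_add[of y 1 "t - 2"] by simp
    finally show ?thesis by (simp add: s_def)
  qed
  have "(\<lambda>y. \<bar>2 * y / (1 + y\<^sup>2)\<^sup>2\<bar> * \<beta> (g y)) integrable_on {0<..}"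
    by (rule set_lebesgue_integral_eq_integral(1)[OF conjunct1[OF *]])
  hence "((\<lambda>y. \<bar>2 * y / (1 + y\<^sup>2)\<^sup>2\<bar> * \<beta> (g y)) has_integral Beta (t / 2) (1 - t / 2)) {0<..}"
    using integrable_integral conjunct2[OF *] by fastforce
  hence "((\<lambda>y. 2 * y powr (t - 1) / (1 + y\<^sup>2)) has_integral Beta (t / 2) (1 - t / 2)) {0<..}"
    by (rule has_integral_eq[rotated]) (rule eq)
  moreover have "Beta (t / 2) (1 - t / 2) = Gamma (t / 2) * Gamma (1 - t / 2)"
    by (simp add: Beta_def)
  ultimately have hi: "((\<lambda>y. 2 * y powr (t - 1) / (1 + y\<^sup>2)) has_integral Gamma (t / 2) * Gamma (1 - t / 2)) {0<..}"
    by simp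
  have "nn_integral lborel (\<lambda>y. ennreal (indicator {0<..} y * (2 * y powr (t - 1) / (1 + y\<^sup>2)))) =
      ennreal (Gamma (t / 2) * Gamma (1 - t / 2))"
    by (rule nn_integral_has_integral_lebesgue[OF _ hi]) (use pos in \<open>auto intro!: divide_nonneg_nonneg\<close>)
  thus ?thesis
    using t by (intro has_bochner_integral_nn_integral) (auto intro!: mult_nonneg_nonneg Gamma_real_nonneg)
qed

lemma has_bochner_rational_scaled:
  assumes t: "0 < t" "t < (1::real)" and v: "v > 0"
  shows "has_bochner_integral lborel (\<lambda>y. indicator {0<..} y * (2 * y powr (t - 1) / (v\<^sup>2 + y\<^sup>2)))
           (Gamma (t / 2) * Gamma (1 - t / 2) * v powr (t - 2))"
proof -
  define f where "f = (\<lambda>y::real. indicator {0<..} y * (2 * y powr (t - 1) / (1 + y\<^sup>2)))"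
  define J where "J = Gamma (t / 2) * Gamma (1 - t / 2)"
  have "has_bochner_integral lborel (\<lambda>y. f (0 + (1 / v) * y)) (J /\<^sub>R \<bar>1 / v\<bar>)"
    using lborel_has_bochner_integral_real_affine_iff[of "1 / v" f J 0] v has_bochner_rational[OF t]
    by (simp add: f_def J_def)
  hence "has_bochner_integral lborel (\<lambda>y. v powr (t - 3) * f (0 + (1 / v) * y)) (v powr (t - 3) * (J /\<^sub>R \<bar>1 / v\<bar>))"
    by (rule has_bochner_integral_mult_right)
  also have "(\<lambda>y. v powr (t - 3) * f (0 + (1 / v) * y)) = (\<lambda>y. indicator {0<..} y * (2 * y powr (t - 1) / (v\<^sup>2 + y\<^sup>2)))"
  proof
    fix y :: real
    show "v powr (t - 3) * f (0 + (1 / v) * y) = indicator {0<..} y * (2 * y powr (t - 1) / (v\<^sup>2 + y\<^sup>2))"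
    proof (cases "y > 0")
      case True
      have "v powr (t - 3) = v powr (t - 1) * v powr (-2)" using v by (simp add: powr_add[symmetric])
      also have "v powr (-2) = 1 / v\<^sup>2" using v by (simp add: powr_minus_divide powr_numeral)
      finally have vp: "v powr (t - 3) = v powr (t - 1) / v\<^sup>2" by simp
      have pos: "v\<^sup>2 + y\<^sup>2 > 0" using v by (simp add: add_pos_nonneg)
      have "1 + (y / v)\<^sup>2 = (v\<^sup>2 + y\<^sup>2) / v\<^sup>2" using v by (simp add: power_divide field_simps)
      hence "f (0 + (1 / v) * y) = 2 * (y / v) powr (t - 1) * (v\<^sup>2 / (v\<^sup>2 + y\<^sup>2))"
        using True v by (simp add: f_def)
      also have "(y / v) powr (t - 1) = y powr (t - 1) / v powr (t - 1)"
        using True v by (simp add: powr_divide)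
      finally show ?thesis unfolding vp using True v pos by simp
    next
      case False
      hence "\<not> 0 < 1 / v * y" using v by (simp add: zero_less_mult_iff zero_less_divide_iff)
      thus ?thesis using False by (simp add: f_def)
    qed
  qed
  also have "v powr (t - 3) * (J /\<^sub>R \<bar>1 / v\<bar>) = J * v powr (t - 2)"
  proof -
    have "v powr (t - 2) = v powr (t - 3) * v powr 1" unfolding powr_add[symmetric] by simp
    thus ?thesis using v by simp
  qed
  finally show ?thesis unfolding J_def .
qed

text \<open>Integration is interchanged with summation over whole periods. Mean zero replaces the
  kernels in a block by their differences from the first one, and these are dominated by the
  summable \<open>g\<close>.\<close>

lemma (in periodic_mean_zero) integral_block_series:
  fixes k g :: "nat \<Rightarrow> real \<Rightarrow> real"
  assumes k: "\<And>m. has_bochner_integral lborel (\<lambda>y. indicator {0<..} y * k (Suc m) y) (K (Suc m))"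
    and g: "\<And>n. has_bochner_integral lborel (\<lambda>y. indicator {0<..} y * g n y) (G n)" and G: "summable G"
    and g_summ: "\<And>y. y > 0 \<Longrightarrow> summable (\<lambda>n. g n y)"
    and diff: "\<And>n i y. y > 0 \<Longrightarrow> i < q \<Longrightarrow> \<bar>k (Suc (n * q + i)) y - k (Suc (n * q + 0)) y\<bar> \<le> g n y"
  shows "(\<lambda>n. \<Sum>i<q. c (Suc i) * of_real (K (Suc (n * q + i)))) sums
          (LINT y|lborel. (\<Sum>n. \<Sum>i<q. c (Suc i) * of_real (indicator {0<..} y * k (Suc (n * q + i)) y)))"
proof -
  define f where "f = (\<lambda>n y. \<Sum>i<q. c (Suc i) * of_real (indicator {0<..} y * k (Suc (n * q + i)) y))"
  have f: "has_bochner_integral lborel (f n) (\<Sum>i<q. c (Suc i) * of_real (K (Suc (n * q + i))))" for n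
    unfolding f_def by (intro has_bochner_integral_sum has_bochner_integral_mult_right has_bochner_integral_of_real k)
  have f_le: "norm (f n y) \<le> (real q * M) * (indicator {0<..} y * g n y)" for n y
  proof (cases "y > 0")
    case True
    have "f n y = (\<Sum>i<q. c (Suc i) * (of_real (indicator {0<..} y * k (Suc (n * q + i)) y) - of_real (indicator {0<..} y * k (Suc (n * q + 0)) y)))"
      unfolding f_def by (rule block_sum_diff)
    also have "norm \<dots> \<le> (\<Sum>i<q. M * g n y)"
    proof (rule sum_norm_le)
      fix i assume "i \<in> {..<q}"
      hence "norm (complex_of_real (k (Suc (n * q + i)) y - k (Suc (n * q + 0)) y)) \<le> g n y"
        unfolding norm_of_real using diff[OF True, of i n] by simp
      thus "norm (c (Suc i) * (of_real (indicator {0<..} y * k (Suc (n * q + i)) y) - of_real (indicator {0<..} y * k (Suc (n * q + 0)) y))) \<le> M * g n y"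
        unfolding norm_mult using True c_le M_nonneg by (intro mult_mono) auto
    qed
    finally show ?thesis using True by simp
  qed (simp add: f_def)
  have int: "integrable lborel (f n)" for n
    using f[of n] by (rule integrable.intros)
  have "(\<lambda>n. integral\<^sup>L lborel (f n)) sums (LINT y|lborel. (\<Sum>n. f n y))"
  proof (rule sums_integral[OF int])
    show "AE y in lborel. summable (\<lambda>n. norm (f n y))"
    proof (rule AE_I2)
      fix y :: real
      show "summable (\<lambda>n. norm (f n y))"
      proof (cases "y > 0")
        case True
        have "summable (\<lambda>n. (real q * M) * (indicator {0<..} y * g n y))"
          using g_summ[OF True] True by (intro summable_mult) auto
        thus ?thesis by (rule summable_comparison_test') (use f_le in auto)
      qed (simp add: f_def)
    qed
    have "summable (\<lambda>n. (real q * M) * G n)" by (intro summable_mult G)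
    thus "summable (\<lambda>n. LINT y|lborel. norm (f n y))"
    proof (rule summable_comparison_test')
      fix n :: nat
      have hb: "has_bochner_integral lborel (\<lambda>y. (real q * M) * (indicator {0<..} y * g n y)) ((real q * M) * G n)"
        by (intro has_bochner_integral_mult_right g)
      have "(LINT y|lborel. norm (f n y)) \<le> (LINT y|lborel. (real q * M) * (indicator {0<..} y * g n y))"
        using int hb f_le by (intro integral_mono integrable_norm) (auto dest: integrable.intros)
      also have "\<dots> = (real q * M) * G n" using hb by (rule has_bochner_integral_integral_eq)
      finally show "norm (LINT y|lborel. norm (f n y)) \<le> (real q * M) * G n" by simp
    qed
  qed
  thus ?thesis
    using has_bochner_integral_integral_eq[OF f] by (simp add: f_def)
qed

lemma exp_diff_le:
  fixes a b y :: real
  assumes "a \<le> b" "y \<ge> 0"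
  shows "\<bar>exp (- b * y) - exp (- a * y)\<bar> \<le> (b - a) * y * exp (- a * y)"
proof -
  have "exp (- b * y) = exp (- a * y) * exp (- ((b - a) * y))"
    unfolding exp_add[symmetric] by (simp add: algebra_simps)
  moreover have "1 - (b - a) * y \<le> exp (- ((b - a) * y))"
    using exp_ge_add_one_self[of "- ((b - a) * y)"] by simp
  hence "exp (- a * y) * (1 - (b - a) * y) \<le> exp (- a * y) * exp (- ((b - a) * y))"
    by (intro mult_left_mono) auto
  moreover have "exp (- a * y) * exp (- ((b - a) * y)) \<le> exp (- a * y) * 1"
    using assms by (intro mult_left_mono) auto
  ultimately show ?thesis by (simp add: algebra_simps)
qed

text \<open>The difference has numerator \<open>2 * (w - v) * (y^2 - v * w)\<close>, and the last
  factor is at most \<open>w^2 + y^2\<close> in modulus, which cancels one denominator.\<close>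

lemma rational_diff_le:
  fixes v w y :: real
  assumes v: "0 < v" "v \<le> w" "w \<le> v + 1"
  shows "\<bar>2 * w / (w\<^sup>2 + y\<^sup>2) - 2 * v / (v\<^sup>2 + y\<^sup>2)\<bar> \<le> 2 / (v\<^sup>2 + y\<^sup>2)"
proof -
  have pos: "w\<^sup>2 + y\<^sup>2 > 0" "v\<^sup>2 + y\<^sup>2 > 0" using v by (auto intro!: add_pos_nonneg)
  have eq: "2 * w / (w\<^sup>2 + y\<^sup>2) - 2 * v / (v\<^sup>2 + y\<^sup>2) = 2 * ((w - v) * (y\<^sup>2 - v * w)) / ((w\<^sup>2 + y\<^sup>2) * (v\<^sup>2 + y\<^sup>2))"
  proof -
    have "2 * w / (w\<^sup>2 + y\<^sup>2) - 2 * v / (v\<^sup>2 + y\<^sup>2) =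
        (2 * w * (v\<^sup>2 + y\<^sup>2) - 2 * v * (w\<^sup>2 + y\<^sup>2)) / ((w\<^sup>2 + y\<^sup>2) * (v\<^sup>2 + y\<^sup>2))"
      by (rule diff_frac_eq) (use pos in auto)
    also have "2 * w * (v\<^sup>2 + y\<^sup>2) - 2 * v * (w\<^sup>2 + y\<^sup>2) = 2 * ((w - v) * (y\<^sup>2 - v * w))"
      by (simp add: power2_eq_square algebra_simps)
    finally show ?thesis .
  qed
  have "\<bar>y\<^sup>2 - v * w\<bar> \<le> w\<^sup>2 + y\<^sup>2"
  proof -
    have "0 \<le> v * w" "v * w \<le> w * w" using v by (auto intro: mult_right_mono)
    thus ?thesis
      unfolding abs_le_iff power2_eq_square using zero_le_square[of y] by (intro conjI; linarith)
  qed
  hence "\<bar>w - v\<bar> * \<bar>y\<^sup>2 - v * w\<bar> \<le> 1 * (w\<^sup>2 + y\<^sup>2)"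
    using v by (intro mult_mono) auto
  hence "2 * (\<bar>w - v\<bar> * \<bar>y\<^sup>2 - v * w\<bar>) / ((w\<^sup>2 + y\<^sup>2) * (v\<^sup>2 + y\<^sup>2)) \<le> 2 * (w\<^sup>2 + y\<^sup>2) / ((w\<^sup>2 + y\<^sup>2) * (v\<^sup>2 + y\<^sup>2))"
    using pos by (intro divide_right_mono) auto
  also have "\<dots> = 2 / (v\<^sup>2 + y\<^sup>2)"
    using pos(1) nonzero_mult_divide_mult_cancel_left[of "w\<^sup>2 + y\<^sup>2" 2 "v\<^sup>2 + y\<^sup>2"]
    by (simp only: mult.commute[of 2])
  finally show ?thesis unfolding eq using pos by (simp add: abs_mult)
qed

lemma Suc_le_Suc_mult: "q > 0 \<Longrightarrow> real (Suc n) \<le> real (Suc (n * q + 0))"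
  by (cases q) auto

context odd_primitive
begin

text \<open>The identity between the exponential series and its partial fractions is multiplied by
  \<open>y powr (t - 1)\<close> and integrated over the positive half-line. The exponential side
  yields the series at \<open>t\<close>; the rational side yields powers with exponent
  \<open>t - 1\<close>, that is the conjugate series at \<open>1 - t\<close>.\<close>

lemma functional_equation_aux:
  assumes t: "0 < t" "t < 1"
  shows "of_real (Gamma t * (2 * pi) powr (-t)) * X.D (of_real t) =
         cnj (gauss 1) / of_nat q * (\<i> / (2 * of_real pi)) *
         (of_real (Gamma (t / 2) * Gamma (1 - t / 2) * real q powr (1 - t)) * Y.D (of_real (1 - t)))"
proof -
  define J where "J = Gamma (t / 2) * Gamma (1 - t / 2)"
  have q_powr: "(r / real q) powr a = real q powr (-a) * r powr a" if "r \<ge> 0" for r a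
    using that q_pos by (subst powr_divide) (simp_all add: powr_minus_divide)
  define k1 where "k1 = (\<lambda>m y. y powr (t - 1) * exp (- (2 * pi * real m) * y))"
  \<comment> \<open>Differences of exponentials gain a factor \<open>y\<close>, so the integrals of
    \<open>g1\<close> decay like \<open>n powr (-(t + 1))\<close> and can be summed.\<close>
  define g1 where "g1 = (\<lambda>n y. 2 * pi * real q * (y powr (t + 1 - 1) * exp (- (2 * pi * real (Suc n)) * y)))"
  define k2 where "k2 = (\<lambda>m y. y powr (t - 1) * rt m y)"
  \<comment> \<open>Differences of the rational kernels lose the numerator, so the integrals of
    \<open>g2\<close> decay like \<open>n powr (t - 2)\<close>, summable for
    \<open>t < 1\<close>.\<close>
  define g2 where "g2 = (\<lambda>n y. 2 * y powr (t - 1) / ((real (Suc n) / real q)\<^sup>2 + y\<^sup>2))"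
  define I1 where "I1 = (LINT y|lborel. (\<Sum>n. \<Sum>i<q. chi (int (Suc i)) * of_real (indicator {0<..} y * k1 (Suc (n * q + i)) y)))"
  define I2 where "I2 = (LINT y|lborel. (\<Sum>n. \<Sum>i<q. cnj (chi (int (Suc i))) * of_real (indicator {0<..} y * k2 (Suc (n * q + i)) y)))"
  have s1: "(\<lambda>n. \<Sum>i<q. chi (int (Suc i)) * of_real (Gamma t * (2 * pi * real (Suc (n * q + i))) powr (-t))) sums I1"
    unfolding I1_def
  proof (rule X.integral_block_series[where g = g1])
    show "has_bochner_integral lborel (\<lambda>y. indicator {0<..} y * k1 (Suc m) y) (Gamma t * (2 * pi * real (Suc m)) powr (-t))" for m
      unfolding k1_def by (rule has_bochner_Gamma) (use t in auto)
    show "has_bochner_integral lborel (\<lambda>y. indicator {0<..} y * g1 n y)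
        (2 * pi * real q * (Gamma (t + 1) * (2 * pi * real (Suc n)) powr (-(t + 1))))" for n
      using has_bochner_integral_mult_right[OF has_bochner_Gamma[of "t + 1" "2 * pi * real (Suc n)"], of "2 * pi * real q"] t
      by (simp add: g1_def mult_ac del: of_nat_Suc)
    have "summable (\<lambda>n. 2 * pi * real q * (Gamma (t + 1) * ((2 * pi) powr (-(t + 1)) * real (Suc n) powr (-(t + 1)))))"
      using t by (intro summable_mult summable_Suc_powr) auto
    thus "summable (\<lambda>n. 2 * pi * real q * (Gamma (t + 1) * (2 * pi * real (Suc n)) powr (-(t + 1))))"
      by (simp only: powr_mult)
  next
    fix y :: real assume y: "y > 0"
    have "summable (\<lambda>n. exp (- (2 * pi * y)) ^ Suc n)"
      using y by (intro summable_Suc_iff[THEN iffD2] summable_geometric) auto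
    moreover have "exp (- (2 * pi * y)) ^ Suc n = exp (- (2 * pi * real (Suc n)) * y)" for n
      unfolding exp_of_nat_mult[symmetric] by (simp only: mult_ac mult_minus_left mult_minus_right)
    ultimately have "summable (\<lambda>n. exp (- (2 * pi * real (Suc n)) * y))" by (simp only:)
    thus "summable (\<lambda>n. g1 n y)" unfolding g1_def by (intro summable_mult)
    fix n i assume i: "i < q"
    define a where "a = 2 * pi * real (Suc (n * q + 0))"
    define b where "b = 2 * pi * real (Suc (n * q + i))"
    have ab: "a \<le> b" "b - a \<le> 2 * pi * real q" using i by (auto simp: a_def b_def algebra_simps)
    have a: "2 * pi * real (Suc n) \<le> a" unfolding a_def using Suc_le_Suc_mult[OF q_pos, of n] by simp
    have "\<bar>exp (- b * y) - exp (- a * y)\<bar> \<le> (b - a) * y * exp (- a * y)"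
      using ab y by (intro exp_diff_le) auto
    also have "\<dots> \<le> (2 * pi * real q) * y * exp (- (2 * pi * real (Suc n)) * y)"
      using ab a y by (intro mult_mono) auto
    finally have "y powr (t - 1) * \<bar>exp (- b * y) - exp (- a * y)\<bar> \<le>
        y powr (t - 1) * ((2 * pi * real q) * y * exp (- (2 * pi * real (Suc n)) * y))"
      by (intro mult_left_mono) auto
    also have "\<dots> = 2 * pi * real q * ((y powr (t - 1) * y powr 1) * exp (- (2 * pi * real (Suc n)) * y))"
      using y by simp
    also have "y powr (t - 1) * y powr 1 = y powr (t + 1 - 1)"
      unfolding powr_add[symmetric] by simp
    finally show "\<bar>k1 (Suc (n * q + i)) y - k1 (Suc (n * q + 0)) y\<bar> \<le> g1 n y"
      unfolding k1_def g1_def a_def[symmetric] b_def[symmetric] right_diff_distrib[symmetric] abs_mult by simp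
  qed
  have s2: "(\<lambda>n. \<Sum>i<q. cnj (chi (int (Suc i))) * of_real (J * (real (Suc (n * q + i)) / real q) powr (t - 1))) sums I2"
    unfolding I2_def
  proof (rule Y.integral_block_series[where g = g2])
    show "has_bochner_integral lborel (\<lambda>y. indicator {0<..} y * k2 (Suc m) y) (J * (real (Suc m) / real q) powr (t - 1))" for m
    proof -
      define v where "v = real (Suc m) / real q"
      have v: "v > 0" using q_pos by (simp add: v_def)
      have "has_bochner_integral lborel (\<lambda>y. v * (indicator {0<..} y * (2 * y powr (t - 1) / (v\<^sup>2 + y\<^sup>2)))) (v * (J * v powr (t - 2)))"
        unfolding J_def by (intro has_bochner_integral_mult_right has_bochner_rational_scaled t v)
      also have "v * (J * v powr (t - 2)) = J * v powr (t - 1)"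
      proof -
        have "v powr (t - 1) = v powr 1 * v powr (t - 2)" unfolding powr_add[symmetric] by simp
        thus ?thesis using v by simp
      qed
      also have "(\<lambda>y. v * (indicator {0<..} y * (2 * y powr (t - 1) / (v\<^sup>2 + y\<^sup>2)))) = (\<lambda>y. indicator {0<..} y * k2 (Suc m) y)"
        unfolding k2_def rt_def v_def[symmetric] by (simp add: mult_ac)
      finally show ?thesis by (simp only: v_def)
    qed
    show "has_bochner_integral lborel (\<lambda>y. indicator {0<..} y * g2 n y) (J * (real (Suc n) / real q) powr (t - 2))" for n
      unfolding g2_def J_def using q_pos by (intro has_bochner_rational_scaled t) auto
    have "summable (\<lambda>n. J * (real q powr (2 - t) * real (Suc n) powr (-(2 - t))))"
      using t by (intro summable_mult summable_Suc_powr) auto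
    moreover have "(real (Suc n) / real q) powr (t - 2) = real q powr (2 - t) * real (Suc n) powr (-(2 - t))" for n
      using q_powr[of "real (Suc n)" "t - 2"] by simp
    ultimately show "summable (\<lambda>n. J * (real (Suc n) / real q) powr (t - 2))" by simp
  next
    fix y :: real assume y: "y > 0"
    have "summable (\<lambda>n. (2 * y powr (t - 1) * (real q)\<^sup>2) * real (Suc n) powr (-2))"
      by (intro summable_mult summable_Suc_powr) auto
    thus "summable (\<lambda>n. g2 n y)"
    proof (rule summable_comparison_test')
      fix n :: nat
      define v where "v = real (Suc n) / real q"
      have v: "v > 0" using q_pos by (simp add: v_def)
      have "2 * y powr (t - 1) / (v\<^sup>2 + y\<^sup>2) \<le> 2 * y powr (t - 1) / v\<^sup>2"
        using v by (intro divide_left_mono) (auto intro!: mult_pos_pos add_pos_nonneg)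
      also have "\<dots> = (2 * y powr (t - 1) * (real q)\<^sup>2) * real (Suc n) powr (-2)"
        by (simp add: v_def power_divide powr_minus_divide powr_numeral del: of_nat_Suc)
      finally show "norm (g2 n y) \<le> (2 * y powr (t - 1) * (real q)\<^sup>2) * real (Suc n) powr (-2)"
        by (simp add: g2_def v_def abs_of_nonneg del: of_nat_Suc)
    qed
    fix n i assume i: "i < q"
    define v where "v = real (Suc (n * q + 0)) / real q"
    define w where "w = real (Suc (n * q + i)) / real q"
    have v: "v > 0" using q_pos by (simp add: v_def divide_pos_pos add_pos_nonneg)
    have vw: "v \<le> w" "w \<le> v + 1" using i q_pos by (auto simp: v_def w_def divide_simps)
    have vn: "real (Suc n) / real q \<le> v" unfolding v_def using Suc_le_Suc_mult[OF q_pos, of n] by (intro divide_right_mono) auto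
    have "\<bar>2 * w / (w\<^sup>2 + y\<^sup>2) - 2 * v / (v\<^sup>2 + y\<^sup>2)\<bar> \<le> 2 / (v\<^sup>2 + y\<^sup>2)"
      by (rule rational_diff_le[OF v vw])
    also have "\<dots> \<le> 2 / ((real (Suc n) / real q)\<^sup>2 + y\<^sup>2)"
    proof (rule divide_left_mono)
      show "(real (Suc n) / real q)\<^sup>2 + y\<^sup>2 \<le> v\<^sup>2 + y\<^sup>2"
        using vn by (intro add_right_mono power_mono) auto
    qed (use y v in \<open>auto intro!: mult_pos_pos add_pos_nonneg add_nonneg_pos\<close>)
    finally have "y powr (t - 1) * \<bar>2 * w / (w\<^sup>2 + y\<^sup>2) - 2 * v / (v\<^sup>2 + y\<^sup>2)\<bar> \<le> y powr (t - 1) * (2 / ((real (Suc n) / real q)\<^sup>2 + y\<^sup>2))"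
      by (intro mult_left_mono) auto
    thus "\<bar>k2 (Suc (n * q + i)) y - k2 (Suc (n * q + 0)) y\<bar> \<le> g2 n y"
      unfolding k2_def rt_def g2_def v_def[symmetric] w_def[symmetric] right_diff_distrib[symmetric] abs_mult
      by (simp add: mult_ac)
  qed
  define C where "C = cnj (gauss 1) / of_nat q * (\<i> / (2 * of_real pi))"
  have pw: "(\<Sum>n. \<Sum>i<q. chi (int (Suc i)) * of_real (indicator {0<..} y * k1 (Suc (n * q + i)) y)) =
      C * (\<Sum>n. \<Sum>i<q. cnj (chi (int (Suc i))) * of_real (indicator {0<..} y * k2 (Suc (n * q + i)) y))" for y :: real
  proof (cases "y > 0")
    case True
    obtain S where
      S1: "(\<lambda>n. \<Sum>i<q. chi (int (Suc i)) * of_real (exp (- 2 * pi * real (Suc (n * q + i)) * y))) sums (C * S)" and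
      S2: "(\<lambda>n. \<Sum>i<q. cnj (chi (int (Suc i))) * of_real (rt (Suc (n * q + i)) y)) sums S"
      unfolding C_def by (rule exp_series_partial_fractions[OF True])
    have ex: "- 2 * pi * r * y = - (2 * pi * r) * y" for r by simp
    have "(\<lambda>n. \<Sum>i<q. chi (int (Suc i)) * of_real (indicator {0<..} y * k1 (Suc (n * q + i)) y)) sums (of_real (y powr (t - 1)) * (C * S))"
      using sums_mult[OF S1, of "of_real (y powr (t - 1))"] True unfolding ex k1_def sum_distrib_left
      by (simp add: mult_ac del: of_nat_Suc of_nat_add of_nat_mult)
    moreover have "(\<lambda>n. \<Sum>i<q. cnj (chi (int (Suc i))) * of_real (indicator {0<..} y * k2 (Suc (n * q + i)) y)) sums (of_real (y powr (t - 1)) * S)"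
      using sums_mult[OF S2, of "of_real (y powr (t - 1))"] True unfolding k2_def sum_distrib_left
      by (simp add: mult_ac del: of_nat_Suc of_nat_add of_nat_mult)
    ultimately show ?thesis by (simp add: sums_iff mult_ac)
  qed simp
  have I12: "I1 = C * I2" unfolding I1_def I2_def pw by simp
  have A1: "(\<lambda>n. of_real (Gamma t * (2 * pi) powr (-t)) * X.block (of_real t) n) sums (of_real (Gamma t * (2 * pi) powr (-t)) * X.D (of_real t))"
    unfolding X.D_def using t by (intro sums_mult summable_sums X.summable_block) auto
  have B1: "of_real (Gamma t * (2 * pi) powr (-t)) * X.block (of_real t) n =
      (\<Sum>i<q. chi (int (Suc i)) * of_real (Gamma t * (2 * pi * real (Suc (n * q + i))) powr (-t)))" for n
  proof -
    have "of_nat m powr (- of_real t) = (of_real (real m powr (-t)) :: complex)" for m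
      using powr_of_real[of "real m" "-t"] by simp
    thus ?thesis
      unfolding X.block_def sum_distrib_left powr_mult by (intro sum.cong refl) (simp add: mult_ac del: of_nat_Suc of_nat_add of_nat_mult)
  qed
  have D1: "of_real (Gamma t * (2 * pi) powr (-t)) * X.D (of_real t) = I1"
    by (rule sums_unique2[OF A1[unfolded B1] s1])
  have A2: "(\<lambda>n. of_real (J * real q powr (1 - t)) * Y.block (of_real (1 - t)) n) sums (of_real (J * real q powr (1 - t)) * Y.D (of_real (1 - t)))"
    unfolding Y.D_def using t by (intro sums_mult summable_sums Y.summable_block) auto
  have B2: "of_real (J * real q powr (1 - t)) * Y.block (of_real (1 - t)) n =
      (\<Sum>i<q. cnj (chi (int (Suc i))) * of_real (J * (real (Suc (n * q + i)) / real q) powr (t - 1)))" for n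
  proof -
    have a: "of_nat m powr (- of_real (1 - t)) = (of_real (real m powr (t - 1)) :: complex)" for m
      using powr_of_real[of "real m" "-(1 - t)"] by simp
    have b: "(r / real q) powr (t - 1) = real q powr (1 - t) * r powr (t - 1)" if "r \<ge> 0" for r
      using q_powr[OF that, of "t - 1"] by simp
    show ?thesis
      unfolding Y.block_def sum_distrib_left a
      by (intro sum.cong refl) (simp add: b mult_ac del: of_nat_Suc of_nat_add of_nat_mult)
  qed
  have D2: "of_real (J * real q powr (1 - t)) * Y.D (of_real (1 - t)) = I2"
    by (rule sums_unique2[OF A2[unfolded B2] s2])
  show ?thesis
    unfolding D1 I12 D2[symmetric] C_def J_def ..
qed

end

lemma Re_pos_not_nonpos_Ints: "Re z > 0 \<Longrightarrow> z \<notin> \<int>\<^sub>\<le>\<^sub>0"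
  by (auto elim!: nonpos_Ints_cases)

lemma Gamma_duplication_real:
  assumes t: "t > (0::real)"
  shows "Gamma (t / 2) * Gamma ((t + 1) / 2) = 2 powr (1 - t) * sqrt pi * Gamma t"
proof -
  have 1: "complex_of_real (t / 2) \<notin> \<int>\<^sub>\<le>\<^sub>0" "complex_of_real (t / 2) + 1 / 2 \<notin> \<int>\<^sub>\<le>\<^sub>0"
    using t by (intro Re_pos_not_nonpos_Ints; simp)+
  have "Gamma (complex_of_real (t / 2)) * Gamma (complex_of_real (t / 2) + 1 / 2) =
      exp ((1 - 2 * complex_of_real (t / 2)) * of_real (ln 2)) * of_real (sqrt pi) * Gamma (2 * complex_of_real (t / 2))"
    by (rule Gamma_legendre_duplication[OF 1])
  also have "complex_of_real (t / 2) + 1 / 2 = of_real ((t + 1) / 2)" by (simp add: add_divide_distrib)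
  also have "2 * complex_of_real (t / 2) = of_real t" by simp
  also have "exp ((1 - complex_of_real t) * of_real (ln 2)) = of_real (2 powr (1 - t))"
  proof -
    have "exp (complex_of_real ((1 - t) * ln 2)) = of_real (2 powr (1 - t))"
      unfolding exp_of_real by (simp add: powr_def)
    thus ?thesis by simp
  qed
  finally have "complex_of_real (Gamma (t / 2) * Gamma ((t + 1) / 2)) = of_real (2 powr (1 - t) * sqrt pi * Gamma t)"
    unfolding Gamma_complex_of_real by simp
  thus ?thesis unfolding of_real_eq_iff .
qed

lemma holomorphic_reflect:
  assumes f: "f holomorphic_on {s. Re s > a}"
  shows "(\<lambda>s. cnj (f (1 - cnj s))) holomorphic_on {s. Re s < 1 - a}"
proof -
  define h where "h = (\<lambda>s. f (1 - s))"
  have img: "cnj ` {s. Re s < 1 - a} = {s. Re s < 1 - a}"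
  proof (intro equalityI subsetI)
    fix x assume "x \<in> {s. Re s < 1 - a}"
    thus "x \<in> cnj ` {s. Re s < 1 - a}" by (intro image_eqI[of _ _ "cnj x"]) auto
  qed auto
  have "h holomorphic_on {s. Re s < 1 - a}"
    unfolding h_def by (rule holomorphic_on_compose_gen[of "\<lambda>s. 1 - s" _ f, unfolded o_def, OF _ f])
      (auto intro!: holomorphic_intros)
  hence "(cnj \<circ> h \<circ> cnj) holomorphic_on {s. Re s < 1 - a}"
    by (intro holomorphic_on_compose_cnj_cnj) (simp_all add: img open_halfspace_Re_lt)
  thus ?thesis by (simp add: h_def o_def)
qed

section \<open>The completed function and the entire continuation\<close>

context odd_primitive
begin

definition xfac :: "complex \<Rightarrow> complex" where
  "xfac s = of_real (real q / pi) powr ((s + 1) / 2)"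

definition xi0 :: "complex \<Rightarrow> complex" where
  "xi0 s = xfac s * Gamma ((s + 1) / 2) * X.D s"

lemma xfac_nonzero [simp]: "xfac s \<noteq> 0"
  using q_pos by (simp add: xfac_def)

lemma holomorphic_xfac [holomorphic_intros]: "xfac holomorphic_on A"
  unfolding xfac_def using q_pos
  by (intro holomorphic_intros) (auto simp: divide_complex_def complex_nonpos_Reals_iff)

lemma holomorphic_xi0: "xi0 holomorphic_on {s. Re s > 0}"
  unfolding xi0_def by (intro holomorphic_intros X.holomorphic_D Re_pos_not_nonpos_Ints) auto

lemma D_3_nonzero: "X.D 3 \<noteq> 0"
  using dseries_3_nonzero[of "\<lambda>n. chi (int n)"] norm_chi chi_1 X.D_eq_dseries[of 3] by simp

lemma xi0_3_nonzero: "xi0 3 \<noteq> 0"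
  using D_3_nonzero by (simp add: xi0_def Gamma_eq_zero_iff Re_pos_not_nonpos_Ints)

text \<open>The root number: \<open>cnj (gauss 1)\<close> is minus the ordinary Gauss sum of the odd
  character, so \<open>W\<close> is that Gauss sum divided by \<open>i * sqrt q\<close>.\<close>

definition W :: complex where
  "W = \<i> * (cnj (gauss 1) / of_nat q) * of_real (sqrt (real q))"

lemma functional_equation_real:
  assumes t: "0 < t" "t < 1"
  shows "xi0 (of_real t) = W * cnj (xi0 (1 - cnj (of_real t)))"
proof -
  define a where "a = Gamma t * (2 * pi) powr (-t)"
  define b where "b = Gamma (t / 2) * Gamma (1 - t / 2) * real q powr (1 - t) / (2 * pi)"
  define A where "A = (real q / pi) powr ((t + 1) / 2) * Gamma ((t + 1) / 2)"
  define B where "B = (real q / pi) powr ((2 - t) / 2) * Gamma ((2 - t) / 2)"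
  have G: "Gamma t > 0" "Gamma (t / 2) > 0" "Gamma ((t + 1) / 2) > 0" using t by (auto intro!: Gamma_real_pos)
  have a0: "a > 0" using G by (simp add: a_def)
  have q0: "real q > 0" using q_pos by simp
  \<comment> \<open>All constants of the functional equation are collected here. The duplication
    formula trades \<open>Gamma t\<close> for \<open>Gamma (t / 2) * Gamma ((t + 1) / 2)\<close>;
    with every power written as an exponential, the rest is a linear identity in
    \<open>ln q\<close>, \<open>ln pi\<close> and \<open>ln 2\<close>.\<close>
  have key: "sqrt (real q) * B * a = A * b"
  proof -
    define lq lp l2 where "lq = ln (real q)" and "lp = ln pi" and "l2 = ln (2::real)"
    have pw: "real q powr x = exp (x * lq)" "2 powr x = exp (x * l2)" "(2 * pi) powr x = exp (x * (l2 + lp))"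
      "(real q / pi) powr x = exp (x * (lq - lp))" for x
      using q0 by (simp_all add: powr_def lq_def lp_def l2_def ln_mult ln_div)
    have sq: "sqrt (real q) = exp (lq / 2)"
      using q0 powr_half_sqrt[of "real q"] pw(1)[of "1/2"] by simp
    have sp: "sqrt pi = exp (lp / 2)"
      using powr_half_sqrt[of pi] by (simp add: powr_def lp_def)
    have tp: "2 * pi = exp (l2 + lp)" by (simp add: exp_add l2_def lp_def)
    have "Gamma ((2 - t) / 2) = Gamma (1 - t / 2)" by (simp add: diff_divide_distrib)
    hence "sqrt (real q) * B * a * (2 * pi) = Gamma (1 - t / 2) * Gamma t * (exp (lq / 2) * exp ((2 - t) / 2 * (lq - lp)) * exp (- t * (l2 + lp)) * exp (l2 + lp))"
      unfolding B_def a_def pw sq by (simp add: tp[symmetric])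
    also have "\<dots> = Gamma (1 - t / 2) * Gamma t * exp (lq / 2 + (2 - t) / 2 * (lq - lp) + (- t * (l2 + lp)) + (l2 + lp))"
      by (simp only: exp_add)
    also have "lq / 2 + (2 - t) / 2 * (lq - lp) + (- t * (l2 + lp)) + (l2 + lp) =
        (1 - t) * l2 + lp / 2 + (t + 1) / 2 * (lq - lp) + (1 - t) * lq"
      by (simp add: field_simps)
    also have "Gamma (1 - t / 2) * Gamma t * exp \<dots> =
        Gamma (1 - t / 2) * (2 powr (1 - t) * sqrt pi * Gamma t) * (exp ((t + 1) / 2 * (lq - lp)) * exp ((1 - t) * lq))"
      unfolding exp_add pw sp by (simp add: mult_ac)
    also have "2 powr (1 - t) * sqrt pi * Gamma t = Gamma (t / 2) * Gamma ((t + 1) / 2)"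
      by (rule Gamma_duplication_real[OF t(1), symmetric])
    also have "Gamma (1 - t / 2) * (Gamma (t / 2) * Gamma ((t + 1) / 2)) *
        (exp ((t + 1) / 2 * (lq - lp)) * exp ((1 - t) * lq)) = A * b * (2 * pi)"
      unfolding A_def b_def pw by simp
    finally show ?thesis by simp
  qed
  have D: "of_real a * X.D (of_real t) = \<i> * (cnj (gauss 1) / of_nat q) * of_real b * Y.D (of_real (1 - t))"
    using functional_equation_aux[OF t] by (simp add: a_def b_def mult_ac)
  have L: "xi0 (of_real t) = of_real A * X.D (of_real t)"
  proof -
    have "(complex_of_real t + 1) / 2 = of_real ((t + 1) / 2)" by simp
    thus ?thesis
      unfolding xi0_def xfac_def A_def using q0
      by (simp only: powr_of_real Gamma_complex_of_real of_real_mult divide_nonneg_pos less_imp_le pi_gt_zero)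
  qed
  have R: "cnj (xi0 (1 - cnj (of_real t))) = of_real B * Y.D (of_real (1 - t))"
  proof -
    have "(1 - complex_of_real t + 1) / 2 = of_real ((2 - t) / 2)" by simp
    moreover have "Y.D (of_real (1 - t)) = cnj (X.D (1 - of_real t))"
      using Y_D[of "of_real (1 - t)"] t by simp
    ultimately show ?thesis
      unfolding xi0_def xfac_def B_def using q0 powr_of_real[of "real q / pi" "(2 - t) / 2"]
      by (simp add: Gamma_complex_of_real del: of_real_divide)
  qed
  have "of_real a * xi0 (of_real t) = of_real A * (of_real a * X.D (of_real t))"
    unfolding L by simp
  also have "\<dots> = \<i> * (cnj (gauss 1) / of_nat q) * of_real (A * b) * Y.D (of_real (1 - t))"
    unfolding D by simp
  also have "\<dots> = of_real a * (W * (of_real B * Y.D (of_real (1 - t))))"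
    unfolding key[symmetric] W_def by simp
  finally show ?thesis unfolding R using a0 by simp
qed

lemma reflect_holomorphic:
  assumes "f holomorphic_on {s. Re s > 0}"
  shows "(\<lambda>s. W * cnj (f (1 - cnj s))) holomorphic_on {s. Re s < 1}"
  using holomorphic_reflect[OF assms] by (intro holomorphic_intros) simp

lemma functional_equation_strip:
  assumes s: "0 < Re s" "Re s < 1"
  shows "xi0 s = W * cnj (xi0 (1 - cnj s))"
proof -
  define S where "S = {s. 0 < Re s \<and> Re s < 1}"
  have Seq: "S = {s. Re s > 0} \<inter> {s. Re s < 1}" by (auto simp: S_def)
  have S: "open S" "connected S"
    unfolding Seq by (intro open_Int open_halfspace_Re_gt open_halfspace_Re_lt)
      (intro convex_connected convex_Int convex_halfspace_Re_gt convex_halfspace_Re_lt)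
  define f where "f = (\<lambda>s. xi0 s - W * cnj (xi0 (1 - cnj s)))"
  have f: "f holomorphic_on S"
    unfolding f_def Seq
    by (intro holomorphic_on_diff holomorphic_on_subset[OF holomorphic_xi0]
        holomorphic_on_subset[OF reflect_holomorphic[OF holomorphic_xi0]]) auto
  define U where "U = complex_of_real ` {0<..<1}"
  have lim: "(1/2 :: complex) islimpt U"
    unfolding islimpt_approachable
  proof (intro allI impI)
    fix e :: real assume e: "e > 0"
    define d where "d = min (e / 2) (1 / 4)"
    have "complex_of_real (1/2 + d) \<in> U"
      unfolding U_def by (intro imageI) (use e in \<open>auto simp: d_def\<close>)
    moreover have "complex_of_real (1/2 + d) \<noteq> 1/2" using e by (simp add: d_def)
    moreover have "dist (complex_of_real (1/2 + d)) (1/2) < e" using e by (simp add: dist_norm d_def)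
    ultimately show "\<exists>x'\<in>U. x' \<noteq> 1 / 2 \<and> dist x' (1 / 2) < e" by blast
  qed
  have "f s = 0"
  proof (rule analytic_continuation[OF f S _ _ lim])
    fix z assume "z \<in> U"
    then obtain t where t: "z = of_real t" "0 < t" "t < 1" by (auto simp: U_def)
    show "f z = 0"
      unfolding f_def t(1) using functional_equation_real[OF t(2,3)] by (simp only: right_minus_eq)
  qed (use s in \<open>auto simp: U_def S_def\<close>)
  thus ?thesis by (simp add: f_def)
qed

text \<open>For \<open>Re s\<close> at most 0 the functional equation serves as the definition. The
  two branches agree on the open critical strip, so they glue to an entire function.\<close>

definition xi :: "complex \<Rightarrow> complex" where
  "xi s = (if Re s > 0 then xi0 s else W * cnj (xi0 (1 - cnj s)))"

lemma holomorphic_xi: "xi holomorphic_on UNIV"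
proof -
  have "xi holomorphic_on {s. Re s > 0}"
    by (rule holomorphic_transform[OF holomorphic_xi0]) (simp add: xi_def)
  moreover have "xi holomorphic_on {s. Re s < 1}"
  proof (rule holomorphic_transform[OF reflect_holomorphic[OF holomorphic_xi0]])
    fix s :: complex assume "s \<in> {s. Re s < 1}"
    thus "W * cnj (xi0 (1 - cnj s)) = xi s"
      unfolding xi_def using functional_equation_strip[of s, symmetric] by simp
  qed
  ultimately have "xi holomorphic_on ({s. Re s > 0} \<union> {s. Re s < 1})"
    by (intro holomorphic_on_Un open_halfspace_Re_gt open_halfspace_Re_lt)
  moreover have "{s. Re s > 0} \<union> {s. Re s < 1} = (UNIV :: complex set)" by auto
  ultimately show ?thesis by simp
qed

lemma xi_3_nonzero: "xi 3 \<noteq> 0"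
  using xi0_3_nonzero by (simp add: xi_def)

lemma xi_functional_equation: "xi s = W * cnj (xi (1 - cnj s))"
proof -
  define f where "f = (\<lambda>s. xi s - W * cnj (xi (1 - cnj s)))"
  have "(\<lambda>s. cnj (xi (1 - cnj s))) holomorphic_on UNIV"
  proof -
    have "(\<lambda>s. cnj (xi (1 - cnj s))) holomorphic_on {s. Re s < 1 - a}" for a
      by (rule holomorphic_reflect[OF holomorphic_on_subset[OF holomorphic_xi]]) auto
    note hol = this
    have "(\<lambda>s. cnj (xi (1 - cnj s))) field_differentiable (at s)" for s
      by (rule holomorphic_on_imp_differentiable_at[OF hol[of "- Re s"] open_halfspace_Re_lt]) simp
    thus ?thesis by (simp add: holomorphic_on_def)
  qed
  hence f: "f holomorphic_on UNIV" unfolding f_def by (intro holomorphic_intros holomorphic_xi)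
  have "f s = 0"
  proof (rule analytic_continuation_open[where s = "{s. 0 < Re s \<and> Re s < 1}" and s' = UNIV and f = f and g = "\<lambda>_. 0" and z = s])
    show "open {s :: complex. 0 < Re s \<and> Re s < 1}"
      by (intro open_Collect_conj open_halfspace_Re_gt open_halfspace_Re_lt)
    show "{s :: complex. 0 < Re s \<and> Re s < 1} \<noteq> {}"
      by (auto intro!: exI[of _ "1/2"])
    show "f z = 0" if "z \<in> {s. 0 < Re s \<and> Re s < 1}" for z
      using that functional_equation_strip[of z, symmetric] by (simp add: f_def xi_def)
  qed (use f in auto)
  thus ?thesis by (simp add: f_def)
qed

lemma W_nonzero: "W \<noteq> 0"
  using xi_functional_equation[of 3] xi_3_nonzero by auto

text \<open>Multiplying by the entire function \<open>rGamma\<close>, instead of dividing by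
  \<open>Gamma\<close>, makes \<open>L\<close> entire at once, with no exceptional points.\<close>

definition L :: "complex \<Rightarrow> complex" where
  "L s = xi s * rGamma ((s + 1) / 2) / xfac s"

lemma holomorphic_L: "L holomorphic_on UNIV"
  unfolding L_def by (intro holomorphic_intros holomorphic_xi) auto

lemma L_eq_D: "Re s > 0 \<Longrightarrow> L s = X.D s"
  using Re_pos_not_nonpos_Ints[of "(s + 1) / 2"] 
  by (simp add: L_def xi_def xi0_def rGamma_inverse_Gamma Gamma_eq_zero_iff)

lemma dirichlet_L_eq: "dirichlet_L chi = L"
proof (rule dirichlet_L_entire_eqI[OF holomorphic_L])
  fix s :: complex assume s: "Re s > 1"
  have "L s = (\<Sum>n. dterm (\<lambda>n. chi (int n)) s n)"
    using s by (simp add: L_eq_D X.D_eq_dseries)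
  also have "\<dots> = dirichlet_series chi s"
    unfolding dirichlet_series_def dterm_def by (simp add: powr_minus_divide del: of_nat_Suc)
  finally show "L s = dirichlet_series chi s" .
qed

end

subsection \<open>Growth of the completed function\<close>

lemma norm_Gamma_le:
  assumes z: "Re z > 0"
  shows "norm (Gamma z) \<le> Gamma (Re z)"
proof -
  have 1: "((\<lambda>t. of_real t powr (z - 1) / of_real (exp t)) has_integral Gamma z) {0..}"
    by (rule Gamma_integral_complex[OF z])
  have 2: "((\<lambda>t. t powr (Re z - 1) / exp t) has_integral Gamma (Re z)) {0..}"
    by (rule Gamma_integral_real[OF z])
  have "norm (integral {0..} (\<lambda>t. of_real t powr (z - 1) / complex_of_real (exp t))) \<le> integral {0..} (\<lambda>t. t powr (Re z - 1) / exp t)"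
  proof (rule integral_norm_bound_integral)
    fix t :: real assume "t \<in> {0..}"
    thus "norm (of_real t powr (z - 1) / complex_of_real (exp t)) \<le> t powr (Re z - 1) / exp t"
      by (cases "t = 0") (simp_all add: norm_divide norm_powr_real_powr)
  qed (use 1 2 in blast)+
  thus ?thesis using integral_unique[OF 1] integral_unique[OF 2] by simp
qed

text \<open>The recurrence with \<open>x * (x + 1)\<close> at least 1/4 gives \<open>Gamma x\<close>
  at most \<open>4 * Gamma (x + 2)\<close>, hence at most \<open>4 * n^n\<close> for an integer
  \<open>n\<close> between \<open>x + 1\<close> and \<open>x + 2\<close>, and \<open>ln n\<close> is
  at most \<open>2 * sqrt n\<close>. The threshold 1/4 is the least real part of
  \<open>(1 - s) / 2\<close> for \<open>Re s\<close> at most 1/2.\<close>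

lemma Gamma_real_growth:
  assumes x: "x \<ge> (1/4 :: real)"
  shows "Gamma x \<le> exp (8 * (1 + x) powr (3/2))"
proof -
  have x0: "x > 0" using x by simp
  define n where "n = nat \<lceil>x\<rceil> + 1"
  have n: "real n \<ge> x + 1" "real n \<le> x + 2" "n \<ge> 1" using x0 by (auto simp: n_def) linarith+
  have "x \<noteq> 0" "x + 1 \<noteq> 0" using x0 by auto
  have "Gamma (x + 1) = x * Gamma x" "Gamma (x + 1 + 1) = (x + 1) * Gamma (x + 1)"
    by (rule Gamma_plus1; use x0 in \<open>auto elim!: nonpos_Ints_cases\<close>)+
  hence eq: "Gamma (x + 2) = (x * (x + 1)) * Gamma x" by (simp add: add.assoc)
  have "1/4 * (5/4) \<le> x * (x + 1)" using x by (intro mult_mono) auto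
  hence "Gamma x * (1/4) \<le> Gamma x * (x * (x + 1))"
    using x0 by (intro mult_left_mono) (auto intro!: Gamma_real_nonneg)
  hence 1: "Gamma x \<le> 4 * Gamma (x + 2)" unfolding eq by (simp add: mult_ac)
  have "Gamma (x + 2) \<le> Gamma (real n + 1)"
  proof (cases "x + 2 = real n + 1")
    case True
    show ?thesis unfolding True ..
  next
    case False
    thus ?thesis using Gamma_real_strict_mono[of "x + 2" "real n + 1"] n x0 by simp
  qed
  also have "\<dots> = fact n" using Gamma_fact[of n, where ?'a = real] by (simp add: add.commute)
  also have "\<dots> \<le> real n ^ n"
    using fact_le_power[of n, where ?'a = real] by simp
  also have "\<dots> = exp (real n * ln (real n))"
    using n(3) by (simp add: exp_of_nat_mult)
  also have "\<dots> \<le> exp (6 * (1 + x) powr (3/2))"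
  proof -
    have ln: "ln (real n) \<le> real n powr (1/2) / (1/2)" using n(3) by (intro ln_powr_bound) auto
    have "real n * ln (real n) \<le> real n * (real n powr (1/2) / (1/2))"
      using ln by (intro mult_left_mono) auto
    also have "\<dots> = 2 * (real n powr 1 * real n powr (1/2))" using n(3) by simp
    also have "\<dots> = 2 * real n powr (3/2)" unfolding powr_add[symmetric] by simp
    also have "real n powr (3/2) \<le> (2 * (1 + x)) powr (3/2)"
      using n x0 by (intro powr_mono2) auto
    also have "\<dots> = 2 powr (3/2) * (1 + x) powr (3/2)" by (rule powr_mult)
    also have "(2::real) powr (3/2) \<le> 3"
    proof -
      have "(2::real) powr (3/2) = sqrt (2 powr 3)" using powr_half_sqrt_powr[of 2 3] by simp
      also have "\<dots> \<le> sqrt 9" by (intro real_sqrt_le_mono) (simp add: powr_numeral)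
      finally show ?thesis by simp
    qed
    finally show ?thesis by (simp add: mult_right_mono)
  qed
  finally have 2: "Gamma (x + 2) \<le> exp (6 * (1 + x) powr (3/2))" .
  have one: "(1::real) \<le> (1 + x) powr (3/2)" using x0 by (intro ge_one_powr_ge_zero) auto
  have "(4::real) \<le> exp 2"
    using exp_ge_add_one_self[of "1::real"] power_mono[of 2 "exp (1::real)" 2] by (simp add: exp_double[symmetric])
  also have "exp 2 \<le> exp (2 * (1 + x) powr (3/2))" using one by simp
  finally have 4: "4 \<le> exp (2 * (1 + x) powr (3/2))" .
  have "4 * Gamma (x + 2) \<le> exp (2 * (1 + x) powr (3/2)) * exp (6 * (1 + x) powr (3/2))"
    using 2 4 x0 by (intro mult_mono Gamma_real_nonneg) auto
  also have "\<dots> = exp (8 * (1 + x) powr (3/2))" unfolding exp_add[symmetric] by simp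
  finally show ?thesis using 1 by linarith
qed

text \<open>A version of \<open>growth\<close> on a set, so that bounds on overlapping half-planes
  can be glued.\<close>

definition growth_on :: "complex set \<Rightarrow> (complex \<Rightarrow> complex) \<Rightarrow> bool" where
  "growth_on S f \<longleftrightarrow> (\<exists>C\<ge>0. \<forall>z\<in>S. norm (f z) \<le> exp (C * (1 + norm z) powr (3/2)))"

lemma growth_on_UNIV: "growth_on UNIV f \<Longrightarrow> growth f"
  unfolding growth_on_def using growthI by blast

lemma growth_on_Un: 
  assumes "growth_on S f" "growth_on T f"
  shows "growth_on (S \<union> T) f"
proof -
  obtain C D where C: "C \<ge> 0" "\<And>z. z \<in> S \<Longrightarrow> norm (f z) \<le> exp (C * (1 + norm z) powr (3/2))"
    and D: "D \<ge> 0" "\<And>z. z \<in> T \<Longrightarrow> norm (f z) \<le> exp (D * (1 + norm z) powr (3/2))"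
    using assms unfolding growth_on_def by metis
  have "norm (f z) \<le> exp ((C + D) * (1 + norm z) powr (3/2))" if "z \<in> S \<union> T" for z
  proof -
    define P where "P = (1 + norm z) powr (3/2)"
    have "exp (C * P) \<le> exp ((C + D) * P)" "exp (D * P) \<le> exp ((C + D) * P)"
      using C(1) D(1) by (simp_all add: P_def mult_right_mono)
    moreover have "norm (f z) \<le> exp (C * P) \<or> norm (f z) \<le> exp (D * P)"
      using C(2)[of z] D(2)[of z] that unfolding P_def by blast
    ultimately show ?thesis unfolding P_def[symmetric] by linarith
  qed
  thus ?thesis
    unfolding growth_on_def using C(1) D(1) by (intro exI[of _ "C + D"]) auto
qed

lemma growth_on_mult:
  assumes "growth_on S f" "growth_on S g"
  shows "growth_on S (\<lambda>z. f z * g z)"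
proof -
  obtain C D where C: "C \<ge> 0" "\<And>z. z \<in> S \<Longrightarrow> norm (f z) \<le> exp (C * (1 + norm z) powr (3/2))"
    and D: "D \<ge> 0" "\<And>z. z \<in> S \<Longrightarrow> norm (g z) \<le> exp (D * (1 + norm z) powr (3/2))"
    using assms unfolding growth_on_def by metis
  have "norm (f z * g z) \<le> exp ((C + D) * (1 + norm z) powr (3/2))" if "z \<in> S" for z
    unfolding norm_mult distrib_right exp_add using C(2)[OF that] D(2)[OF that] by (intro mult_mono) auto
  thus ?thesis
    unfolding growth_on_def using C(1) D(1) by (intro exI[of _ "C + D"]) auto
qed

lemma powr_ge_self: "1 + norm (z::complex) \<le> (1 + norm z) powr (3/2)"
  using powr_mono[of 1 "3/2" "1 + norm z"] by simp

lemma growth_on_linear: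
  assumes "C \<ge> 0" "\<And>z. z \<in> S \<Longrightarrow> norm (f z) \<le> exp (C * (1 + norm z))"
  shows "growth_on S f"
  unfolding growth_on_def
proof (intro exI[of _ C] conjI ballI)
  fix z assume "z \<in> S"
  have "C * (1 + norm z) \<le> C * (1 + norm z) powr (3/2)"
    using assms(1) powr_ge_self[of z] by (intro mult_left_mono)
  thus "norm (f z) \<le> exp (C * (1 + norm z) powr (3/2))"
    using assms(2)[OF \<open>z \<in> S\<close>] by (meson exp_le_cancel_iff order_trans)
qed (rule assms)

lemma growth_on_Gamma:
  assumes "\<And>z. z \<in> S \<Longrightarrow> Re (a + b * z) \<ge> 1/4"
  shows "growth_on S (\<lambda>z. Gamma (a + b * z))"
  unfolding growth_on_def
proof (intro exI[of _ "8 * (1 + norm a + norm b) powr (3/2)"] conjI ballI)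
  fix z assume z: "z \<in> S"
  define w where "w = a + b * z"
  have w: "Re w \<ge> 1/4" using assms[OF z] by (simp add: w_def)
  have "norm (Gamma w) \<le> Gamma (Re w)" using w by (intro norm_Gamma_le) auto
  also have "\<dots> \<le> exp (8 * (1 + Re w) powr (3/2))" by (rule Gamma_real_growth[OF w])
  also have "\<dots> \<le> exp (8 * ((1 + norm a + norm b) * (1 + norm z)) powr (3/2))"
  proof -
    have "Re w \<le> norm w" by (rule complex_Re_le_cmod)
    also have "\<dots> \<le> norm a + norm b * norm z" unfolding w_def using norm_triangle_ineq[of a "b * z"] by (simp add: norm_mult)
    finally have "1 + Re w \<le> 1 + norm a + norm b * norm z" by simp
    also have "\<dots> \<le> (1 + norm a + norm b) * (1 + norm z)"
      by (simp add: algebra_simps)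
    finally show ?thesis using w by (auto intro!: powr_mono2)
  qed
  also have "((1 + norm a + norm b) * (1 + norm z)) powr (3/2) = (1 + norm a + norm b) powr (3/2) * (1 + norm z) powr (3/2)"
    by (rule powr_mult)
  finally show "norm (Gamma (a + b * z)) \<le> exp (8 * (1 + norm a + norm b) powr (3/2) * (1 + norm z) powr (3/2))"
    by (simp add: w_def mult.assoc)
qed auto

lemma growth_on_reflect:
  assumes "growth_on S f"
  shows "growth_on {z. 1 - cnj z \<in> S} (\<lambda>z. W * cnj (f (1 - cnj z)))"
proof -
  obtain C where C: "C \<ge> 0" "\<And>z. z \<in> S \<Longrightarrow> norm (f z) \<le> exp (C * (1 + norm z) powr (3/2))"
    using assms unfolding growth_on_def by metis
  have 1: "growth_on {z. 1 - cnj z \<in> S} (\<lambda>z. cnj (f (1 - cnj z)))"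
    unfolding growth_on_def
  proof (intro exI[of _ "C * 2 powr (3/2)"] conjI ballI)
    fix z assume z: "z \<in> {z. 1 - cnj z \<in> S}"
    have "1 + norm (1 - cnj z) \<le> 2 * (1 + norm z)"
      using norm_triangle_ineq4[of 1 "cnj z"] norm_ge_zero[of z] unfolding complex_mod_cnj norm_one by argo
    hence "(1 + norm (1 - cnj z)) powr (3/2) \<le> (2 * (1 + norm z)) powr (3/2)"
      by (intro powr_mono2) auto
    also have "\<dots> = 2 powr (3/2) * (1 + norm z) powr (3/2)" by (rule powr_mult)
    finally have "C * (1 + norm (1 - cnj z)) powr (3/2) \<le> C * 2 powr (3/2) * (1 + norm z) powr (3/2)"
      unfolding mult.assoc using C(1) by (intro mult_left_mono)
    thus "norm (cnj (f (1 - cnj z))) \<le> exp (C * 2 powr (3/2) * (1 + norm z) powr (3/2))"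
      using C(2)[of "1 - cnj z"] z by (auto intro: order_trans)
  qed (use C in auto)
  have "growth_on {z. 1 - cnj z \<in> S} (\<lambda>z. W)"
  proof (rule growth_on_linear)
    fix z :: complex
    have "norm W \<le> exp (norm W)" using exp_ge_add_one_self[of "norm W"] by linarith
    also have "\<dots> \<le> exp (norm W * (1 + norm z))" by (simp add: distrib_left)
    finally show "norm W \<le> exp (norm W * (1 + norm z))" .
  qed simp
  thus ?thesis using 1 by (rule growth_on_mult)
qed

lemma growth_on_cong: "(\<And>z. z \<in> S \<Longrightarrow> f z = g z) \<Longrightarrow> growth_on S f \<longleftrightarrow> growth_on S g"
  unfolding growth_on_def by simp

lemma growth_on_subset: "growth_on S f \<Longrightarrow> T \<subseteq> S \<Longrightarrow> growth_on T f"
  unfolding growth_on_def by blast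

lemma norm_exp_affine:
  fixes l :: real
  shows "norm (exp (of_real l * (z + 1) / 2)) \<le> exp (\<bar>l\<bar> * (1 + norm (z::complex)))"
proof -
  have "Re (of_real l * (z + 1) / 2) \<le> norm (of_real l * (z + 1) / 2)" by (rule complex_Re_le_cmod)
  also have "\<dots> = \<bar>l\<bar> * (norm (z + 1) / 2)" by (simp add: norm_mult norm_divide)
  also have "\<dots> \<le> \<bar>l\<bar> * (1 + norm z)"
  proof (rule mult_left_mono)
    show "norm (z + 1) / 2 \<le> 1 + norm z"
      using norm_triangle_ineq[of z 1] norm_ge_zero[of z] unfolding norm_one by argo
  qed simp
  finally show ?thesis by simp
qed

context odd_primitive
begin

lemma xfac_exp: "xfac s = exp (of_real (ln (real q / pi)) * (s + 1) / 2)"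
proof -
  have "ln (complex_of_real (real q / pi)) = of_real (ln (real q / pi))"
    using q_pos by (intro Ln_of_real) auto
  moreover have "complex_of_real (real q / pi) \<noteq> 0" using q_pos by simp
  ultimately show ?thesis by (simp add: xfac_def powr_def mult_ac)
qed

lemma growth_on_xfac: "growth_on S xfac" "growth_on S (\<lambda>s. 1 / xfac s)"
proof -
  show "growth_on S xfac"
    unfolding xfac_exp by (rule growth_on_linear[of "\<bar>ln (real q / pi)\<bar>"]) (use norm_exp_affine in auto)
  have eq: "1 / xfac s = exp (of_real (- ln (real q / pi)) * (s + 1) / 2)" for s
    unfolding xfac_exp by (simp add: exp_minus inverse_eq_divide)
  show "growth_on S (\<lambda>s. 1 / xfac s)"
    unfolding eq
    by (rule growth_on_linear[of "\<bar>- ln (real q / pi)\<bar>"]) (use norm_exp_affine[of "- ln (real q / pi)"] in auto)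
qed

lemma growth_on_D: "growth_on {s. Re s \<ge> 1/2} X.D"
proof -
  obtain K where K: "K > 0" "\<And>s. Re s \<ge> 1/2 \<Longrightarrow> norm (X.D s) \<le> K * norm s"
    using X.norm_D_le by blast
  show ?thesis
  proof (rule growth_on_linear[of K])
    fix s assume "s \<in> {s. Re s \<ge> 1/2}"
    hence "norm (X.D s) \<le> K * norm s" using K by simp
    also have "\<dots> \<le> K * (1 + norm s)" using K by simp
    also have "\<dots> \<le> exp (K * (1 + norm s))" using exp_ge_add_one_self[of "K * (1 + norm s)"] by linarith
    finally show "norm (X.D s) \<le> exp (K * (1 + norm s))" .
  qed (use K in auto)
qed

text \<open>To the right of the critical line the factors are bounded directly; the left side
  follows by reflection in that line.\<close>

lemma growth_xi: "growth_on UNIV xi"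
proof -
  have "growth_on {s. Re s \<ge> 1/2} (\<lambda>s. Gamma (1/2 + 1/2 * s))"
    by (rule growth_on_Gamma) simp
  hence "growth_on {s. Re s \<ge> 1/2} (\<lambda>s. xfac s * Gamma (1/2 + 1/2 * s) * X.D s)"
    by (intro growth_on_mult growth_on_xfac growth_on_D)
  also have "?this \<longleftrightarrow> growth_on {s. Re s \<ge> 1/2} xi"
    by (rule growth_on_cong) (simp add: xi_def xi0_def add_divide_distrib add.commute)
  finally have 1: "growth_on {s. Re s \<ge> 1/2} xi" .
  have "growth_on {s. 1 - cnj s \<in> {s. Re s \<ge> 1/2}} (\<lambda>s. W * cnj (xi (1 - cnj s)))"
    by (rule growth_on_reflect[OF 1])
  also have "?this \<longleftrightarrow> growth_on {s. 1 - cnj s \<in> {s. Re s \<ge> 1/2}} xi"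
    by (rule growth_on_cong) (rule xi_functional_equation[symmetric])
  finally have "growth_on ({s. Re s \<ge> 1/2} \<union> {s. 1 - cnj s \<in> {s. Re s \<ge> 1/2}}) xi"
    by (intro growth_on_Un 1)
  moreover have "{s. Re s \<ge> 1/2} \<union> {s. 1 - cnj s \<in> {s. Re s \<ge> 1/2}} = UNIV" by auto
  ultimately show ?thesis by simp
qed

text \<open>On the left half-plane an upper bound for \<open>rGamma\<close> is required, which
  bounds on Gamma give only through the reflection formula: \<open>rGamma z\<close> is
  \<open>Gamma (1 - z)\<close> times a sine over \<open>pi\<close>, and \<open>1 - z\<close> has
  real part at least 1/4.\<close>

lemma growth_L: "growth L"
proof -
  have 1: "growth_on {s. Re s \<ge> 1/2} L"
    using growth_on_D by (subst growth_on_cong[of _ L X.D]) (auto simp: L_eq_D)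
  define S where "S = {s :: complex. Re s \<le> 1/2}"
  have "growth_on S (\<lambda>s. Gamma (1/2 + (-1/2) * s))"
    by (rule growth_on_Gamma) (simp add: S_def)
  moreover have "growth_on S (\<lambda>s. sin (of_real pi * ((s + 1) / 2)) / of_real pi)"
  proof (rule growth_on_linear[of pi])
    fix s :: complex
    have "norm (sin (of_real pi * ((s + 1) / 2)) / of_real pi) \<le> norm (sin (of_real pi * ((s + 1) / 2))) / 1"
      unfolding norm_divide by (intro divide_left_mono) (use pi_ge_two in auto)
    also have "norm (sin (of_real pi * ((s + 1) / 2))) \<le> exp (pi * (1 + norm s))"
    proof -
      define w where "w = of_real pi * ((s + 1) / 2)"
      have nw: "norm w \<le> pi * (1 + norm s)"
      proof -
        have "norm (s + 1) / 2 \<le> 1 + norm s"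
          using norm_triangle_ineq[of s 1] norm_ge_zero[of s] unfolding norm_one by argo
        thus ?thesis by (simp add: w_def norm_mult norm_divide mult_left_mono)
      qed
      have "norm (sin w) = norm (exp (\<i> * w) - exp (- (\<i> * w))) / 2"
        unfolding sin_exp_eq by (simp add: norm_divide norm_mult)
      also have "\<dots> \<le> (norm (exp (\<i> * w)) + norm (exp (- (\<i> * w)))) / 2"
        by (intro divide_right_mono norm_triangle_ineq4) auto
      also have "\<dots> \<le> (exp (norm w) + exp (norm w)) / 2"
        using abs_Im_le_cmod[of w] by (intro divide_right_mono add_mono) auto
      also have "\<dots> \<le> exp (pi * (1 + norm s))" using nw by simp
      finally show ?thesis by (simp add: w_def)
    qed
    finally show "norm (sin (of_real pi * ((s + 1) / 2)) / of_real pi) \<le> exp (pi * (1 + norm s))" by simp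
  qed simp
  ultimately have "growth_on S (\<lambda>s. xi s * (Gamma (1/2 + (-1/2) * s) * (sin (of_real pi * ((s + 1) / 2)) / of_real pi)) * (1 / xfac s))"
    by (intro growth_on_mult growth_on_xfac growth_on_subset[OF growth_xi]) auto
  also have "?this \<longleftrightarrow> growth_on S L"
  proof (rule growth_on_cong)
    fix s assume s: "s \<in> S"
    define z where "z = (s + 1) / 2"
    have z1: "1/2 + (-1/2) * s = 1 - z" by (simp add: z_def field_simps)
    have "Re (1 - z) > 0" using s by (simp add: z_def S_def)
    hence "Gamma (1 - z) \<noteq> 0" by (simp add: Gamma_eq_zero_iff Re_pos_not_nonpos_Ints)
    hence "Gamma (1 - z) * (sin (of_real pi * z) / of_real pi) = rGamma z"
      unfolding rGamma_reflection_complex[symmetric] by (simp add: rGamma_inverse_Gamma[of "1 - z"])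
    thus "xi s * (Gamma (1/2 + (-1/2) * s) * (sin (of_real pi * ((s + 1) / 2)) / of_real pi)) * (1 / xfac s) = L s"
      unfolding z1 z_def[symmetric] L_def by simp
  qed
  finally have "growth_on ({s. Re s \<ge> 1/2} \<union> S) L" by (intro growth_on_Un 1)
  moreover have "{s. Re s \<ge> 1/2} \<union> S = UNIV" by (auto simp: S_def)
  ultimately show ?thesis by (intro growth_on_UNIV) simp
qed

end

subsection \<open>The equivalence\<close>

lemma pi_less_3_156: "pi < 3156 / 1000"
proof (rule ccontr)
  assume "\<not> ?thesis"
  hence pi: "3156 / 1000 \<le> pi" by simp
  \<comment> \<open>This is 3.156 / 6. The Taylor bound shows that its sine exceeds 1/2, the sine of
    \<open>pi / 6\<close>.\<close>
  define x :: real where "x = 526 / 1000"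
  have "sin x \<le> sin (pi / 6)"
    using pi pi_less_4 by (intro sin_monotone_2pi_le) (auto simp: x_def)
  hence "sin x \<le> 1/2" by (simp add: sin_30)
  moreover have "x - x ^ 3 / 6 - x ^ 5 / 120 \<le> sin x"
  proof -
    have "(\<Sum>m<5. sin_coeff m * x ^ m) = x - x ^ 3 / 6"
    proof -
      have "{..<5} = {0, 1, 2, 3, 4 :: nat}" by auto
      thus ?thesis by (simp add: sin_coeff_def fact_numeral)
    qed
    moreover have "inverse (fact 5) * \<bar>x\<bar> ^ 5 = x ^ 5 / 120"
      by (simp add: x_def fact_numeral)
    ultimately show ?thesis using Maclaurin_sin_bound[of x 5] by argo
  qed
  ultimately show False by (simp add: x_def power_divide)
qed

text \<open>Amounts to \<open>4 * pi * exp euler_mascheroni < 23\<close>. With Euler's constant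
  below 13/22, the exponential below 1.82 and \<open>pi\<close> below 3.156, the left side stays
  below 22.98, so these bounds leave little room.\<close>

lemma Digamma_one_half_bound: "- Digamma (1/2 :: real) < ln (23 / pi)"
proof -
  \<comment> \<open>Splitting into 32 equal factors makes the quadratic upper bound for the
    exponential sharp enough.\<close>
  have "exp (13/22 :: real) = exp (13/704) ^ 32"
    by (simp flip: exp_of_nat_mult)
  also have "\<dots> \<le> (1 + 13/704 + (13/704)\<^sup>2) ^ 32"
    by (intro power_mono exp_bound) auto
  also have "\<dots> < 182 / 100" by (simp add: power_divide)
  finally have "4 * exp (13/22) * pi < 4 * (182/100) * (3156/1000 :: real)"
    using pi_less_3_156 by (intro mult_strict_mono[of "4 * exp (13/22)"]) auto
  hence "4 * exp (13/22) < 23 / pi" by (simp add: field_simps)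
  hence "ln (4 * exp (13/22)) < ln (23 / pi)" by (subst ln_less_cancel_iff) auto
  moreover have "ln (4 * exp (13/22)) = 2 * ln 2 + (13/22 :: real)"
    using ln_realpow[of 2 2] by (simp add: ln_mult)
  moreover have "- Digamma (1/2 :: real) = euler_mascheroni + 2 * ln 2" by (simp add: Digamma_one_half)
  ultimately show ?thesis using euler_mascheroni_less_13_over_22 by argo
qed

text \<open>Termwise comparison: \<open>Re (1 / (z + k))\<close> is at most
  \<open>1 / norm (z + k)\<close>, hence at most \<open>1 / (k + 1/2)\<close>. The bound does not
  depend on the imaginary part, so it holds along whole vertical lines.\<close>

lemma Re_Digamma_ge:
  assumes z: "Re z \<ge> 1/2"
  shows "Digamma (1/2 :: real) \<le> Re (Digamma z)"
proof -
  have z0: "z \<noteq> 0" using z by auto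
  have "(\<lambda>k. inverse (of_nat (Suc k)) - inverse (z + of_nat k)) sums (Digamma z + euler_mascheroni)"
    using summable_sums[OF summable_Digamma[OF z0]] by (simp add: Digamma_def)
  from sums_Re[OF this]
  have 1: "(\<lambda>k. Re (inverse (of_nat (Suc k)) - inverse (z + of_nat k))) sums (Re (Digamma z) + euler_mascheroni)"
    using Re_complex_of_real[of euler_mascheroni] unfolding of_real_euler_mascheroni by simp
  have 2: "(\<lambda>k. inverse (of_nat (Suc k)) - inverse (1/2 + of_nat k)) sums (Digamma (1/2 :: real) + euler_mascheroni)"
    using summable_sums[OF summable_Digamma[of "1/2 :: real"]] by (simp add: Digamma_def)
  have "Digamma (1/2 :: real) + euler_mascheroni \<le> Re (Digamma z) + euler_mascheroni"
  proof (rule sums_le[OF _ 2 1])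
    fix k
    have pos: "1/2 + real k > 0" by simp
    have "Re (inverse (z + of_nat k)) \<le> norm (inverse (z + of_nat k))" by (rule complex_Re_le_cmod)
    also have "\<dots> = inverse (norm (z + of_nat k))" by (rule norm_inverse)
    also have "\<dots> \<le> inverse (1/2 + real k)"
    proof (rule le_imp_inverse_le[OF _ pos])
      show "1/2 + real k \<le> norm (z + of_nat k)"
        using z complex_Re_le_cmod[of "z + of_nat k"] by simp
    qed
    finally have "Re (inverse (z + of_nat k)) \<le> inverse (1/2 + real k)" .
    moreover have "Re (inverse (of_nat (Suc k))) = inverse (real (Suc k))"
      by (simp add: Re_divide_of_nat inverse_eq_divide del: of_nat_Suc)
    ultimately show "inverse (of_nat (Suc k)) - inverse (1/2 + real k) \<le> Re (inverse (of_nat (Suc k)) - inverse (z + of_nat k))"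
      by simp
  qed
  thus ?thesis by simp
qed

context odd_primitive
begin

text \<open>The case left open by the 3, 4, 1 argument is the point 1 with a nonzero sum of squares.
  Invariance of that sum under multiplication by units then forces the square of \<open>chi\<close>
  to be 1 on units, so \<open>chi\<close> is real.\<close>

lemma D_line_1_nonzero: "X.D (Complex 1 u) \<noteq> 0"
proof (cases "u \<noteq> 0 \<or> (\<Sum>i<q. chi (int (Suc i)) ^ 2) = 0")
  case True
  show ?thesis
  proof (rule X.D_line_nonzero)
    show "norm (chi (int n)) = 0 \<or> norm (chi (int n)) = 1" for n
      using norm_chi[of "int n"] by simp
    show "u \<noteq> 0 \<or> (\<Sum>i<q. chi (int (Suc i)) ^ 2) = 0" by (rule True)
  qed (simp_all add: mult chi_1)
next
  case False
  have "(\<Sum>i<q. chi (int (Suc i)) ^ 2) = (\<Sum>b\<in>{0..<int q}. chi b ^ 2)"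
    using sum_Suc_eq[of "\<lambda>b. chi b ^ 2"] by (simp add: chi_0 chi_q)
  hence nz: "(\<Sum>b\<in>{0..<int q}. chi b ^ 2) \<noteq> 0" using False by simp
  have sq: "chi a ^ 2 = 1" if a: "coprime a (int q)" for a
  proof -
    have "(\<Sum>b\<in>{0..<int q}. chi (a * b) ^ 2) = (\<Sum>b\<in>{0..<int q}. chi b ^ 2)"
      by (rule sum_reindex_mult[OF _ a]) (metis cong)
    hence "chi a ^ 2 * (\<Sum>b\<in>{0..<int q}. chi b ^ 2) = (\<Sum>b\<in>{0..<int q}. chi b ^ 2)"
      by (simp add: mult power_mult_distrib sum_distrib_left)
    thus ?thesis using nz by simp
  qed
  have "X.D 1 \<noteq> 0"
  proof (rule X.D_1_nonzero_real)
    show "chi (int n) \<in> {- 1, 0, 1}" for n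
      using sq[of "int n"] nonzero_iff[of "int n"] by (cases "coprime (int n) (int q)") (auto simp: power2_eq_1_iff)
  qed (simp_all add: mult chi_1)
  moreover have "Complex 1 u = 1" using False by (simp add: complex_eq_iff)
  ultimately show ?thesis by simp
qed

lemma xi_eq_L: "Re s > -1 \<Longrightarrow> xi s = L s * xfac s * Gamma ((s + 1) / 2)"
  using Re_pos_not_nonpos_Ints[of "(s + 1) / 2"]
  by (simp add: L_def rGamma_inverse_Gamma Gamma_eq_zero_iff)

lemma xi_eq_0_iff: "Re s > -1 \<Longrightarrow> xi s = 0 \<longleftrightarrow> L s = 0"
  using Re_pos_not_nonpos_Ints[of "(s + 1) / 2"] by (simp add: xi_eq_L Gamma_eq_zero_iff)

lemma xi_reflect_eq_0_iff: "xi (1 - cnj s) = 0 \<longleftrightarrow> xi s = 0"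
  using xi_functional_equation[of s] W_nonzero by auto

lemma xi_nonzero_ge_1: assumes "Re s \<ge> 1" shows "xi s \<noteq> 0"
proof -
  have "X.D s \<noteq> 0"
  proof (cases "Re s = 1")
    case True
    hence "s = Complex 1 (Im s)" by (simp add: complex_eq_iff)
    thus ?thesis using D_line_1_nonzero by metis
  next
    case False
    hence s: "Re s > 1" using assms by simp
    have "(\<Sum>n. dterm (\<lambda>n. chi (int n)) s n) \<noteq> 0"
      by (rule dseries_nonzero) (use s norm_chi in \<open>auto simp: mult chi_1\<close>)
    thus ?thesis using X.D_eq_dseries[OF s] by simp
  qed
  thus ?thesis using assms xi_eq_0_iff[of s] L_eq_D[of s] by simp
qed

lemma xi_zero_strip: assumes "xi \<rho> = 0" shows "0 < Re \<rho> \<and> Re \<rho> < 1"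
  using xi_nonzero_ge_1[of \<rho>] xi_nonzero_ge_1[of "1 - cnj \<rho>"] xi_reflect_eq_0_iff[of \<rho>] assms by force

lemma deriv_xi_reflect: "deriv xi s = - W * cnj (deriv xi (1 - cnj s))"
proof -
  have "((\<lambda>z. xi (1 - z)) has_field_derivative deriv xi (1 - cnj s) * (-1)) (at (cnj s))"
    by (rule DERIV_chain2[OF holomorphic_derivI[OF holomorphic_xi open_UNIV UNIV_I]]) (auto intro!: derivative_eq_intros)
  from has_field_derivative_cnj_cnj[OF this]
  have "(cnj \<circ> (\<lambda>z. xi (1 - z)) \<circ> cnj has_field_derivative cnj (deriv xi (1 - cnj s) * (-1))) (at s)"
    by simp
  hence "((\<lambda>z. W * cnj (xi (1 - cnj z))) has_field_derivative W * cnj (deriv xi (1 - cnj s) * (-1))) (at s)"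
    by (intro DERIV_cmult) (simp add: o_def)
  moreover have "(\<lambda>z. W * cnj (xi (1 - cnj z))) = xi"
    by (intro ext) (rule xi_functional_equation[symmetric])
  ultimately show ?thesis by (simp add: DERIV_imp_deriv)
qed

lemma Re_logderiv_xi_reflect:
  "Re (deriv xi (1 - cnj s) / xi (1 - cnj s)) = - Re (deriv xi s / xi s)"
proof -
  have "deriv xi s / xi s = (W * - cnj (deriv xi (1 - cnj s))) / (W * cnj (xi (1 - cnj s)))"
    by (subst deriv_xi_reflect[of s], subst xi_functional_equation[of s]) simp
  also have "\<dots> = - cnj (deriv xi (1 - cnj s) / xi (1 - cnj s))"
    using W_nonzero by simp
  finally show ?thesis by (simp del: complex_cnj_divide)
qed

lemma Re_logderiv_xi_nonpos:
  assumes nz: "xi s \<noteq> 0" and zeros: "\<And>\<rho>. xi \<rho> = 0 \<Longrightarrow> Re s \<le> Re \<rho> \<and> Re \<rho> \<le> 1 - Re s"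
  shows "Re (deriv xi s / xi s) \<le> 0"
proof -
  have "Re (deriv xi s / xi s) \<le> Re (deriv xi (1 - cnj s) / xi (1 - cnj s))"
    by (rule Re_logderiv_mono[OF holomorphic_xi growth_on_UNIV[OF growth_xi] nz])
      (use nz xi_reflect_eq_0_iff[of s] zeros in auto)
  thus ?thesis unfolding Re_logderiv_xi_reflect by linarith
qed

text \<open>Valid wherever the Gamma factor is regular, in particular on the left boundary Re s = 0
  of the strip.\<close>

lemma logderiv_L:
  assumes s: "Re s > -1" and nz: "L s \<noteq> 0"
  shows "deriv L s / L s = deriv xi s / xi s - of_real (ln (real q / pi)) / 2 - Digamma ((s + 1) / 2) / 2"
proof -
  define z where "z = (s + 1) / 2"
  have z: "Re z > 0" using s by (simp add: z_def)
  hence zn: "z \<notin> \<int>\<^sub>\<le>\<^sub>0" by (rule Re_pos_not_nonpos_Ints)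
  hence Gnz: "Gamma z \<noteq> 0" by (simp add: Gamma_eq_zero_iff)
  define l :: complex where "l = of_real (ln (real q / pi))"
  have dx: "(xfac has_field_derivative xfac s * (l / 2)) (at s)"
    unfolding xfac_exp l_def by (auto intro!: derivative_eq_intros)
  have dG: "((\<lambda>s. Gamma ((s + 1) / 2)) has_field_derivative (Gamma z * Digamma z) * (1 / 2)) (at s)"
    unfolding z_def by (rule DERIV_chain2[OF has_field_derivative_Gamma])
      (use zn in \<open>auto intro!: derivative_eq_intros simp: z_def\<close>)
  have "((\<lambda>s. L s * xfac s * Gamma ((s + 1) / 2)) has_field_derivative
      (deriv L s * xfac s + xfac s * (l / 2) * L s) * Gamma z + (Gamma z * Digamma z) * (1 / 2) * (L s * xfac s)) (at s)"
    using DERIV_mult[OF DERIV_mult[OF holomorphic_derivI[OF holomorphic_L open_UNIV UNIV_I] dx] dG]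
    unfolding z_def by argo
  hence "deriv (\<lambda>s. L s * xfac s * Gamma ((s + 1) / 2)) s =
      (deriv L s * xfac s + xfac s * (l / 2) * L s) * Gamma z + (Gamma z * Digamma z) * (1 / 2) * (L s * xfac s)"
    by (rule DERIV_imp_deriv)
  moreover have "deriv xi s = deriv (\<lambda>s. L s * xfac s * Gamma ((s + 1) / 2)) s"
  proof (rule deriv_cong_ev)
    have "\<forall>\<^sub>F z in nhds s. z \<in> {z. Re z > -1}"
      using s by (intro eventually_nhds_in_open open_halfspace_Re_gt) simp
    thus "\<forall>\<^sub>F s in nhds s. xi s = L s * xfac s * Gamma ((s + 1) / 2)"
      by eventually_elim (simp add: xi_eq_L)
  qed simp
  ultimately have d: "deriv xi s = (deriv L s * xfac s + xfac s * (l / 2) * L s) * Gamma z + (Gamma z * Digamma z) * (1 / 2) * (L s * xfac s)"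
    by simp
  have x: "xi s = L s * xfac s * Gamma z" using xi_eq_L[OF s] by (simp add: z_def)
  have "deriv xi s / xi s = deriv L s / L s + l / 2 + Digamma z / 2"
    unfolding d x using nz Gnz by (simp add: field_simps)
  thus ?thesis by (simp add: z_def l_def)
qed

lemma Re_logderiv_L_le:
  assumes s: "Re s \<ge> 0" and nz: "L s \<noteq> 0" and "Re (deriv xi s / xi s) \<le> 0"
  shows "Re (deriv L s / L s) \<le> - ((ln (real q / pi) + Digamma (1/2)) / 2)"
proof -
  have "Digamma (1/2 :: real) \<le> Re (Digamma ((s + 1) / 2))"
    by (rule Re_Digamma_ge) (use s in simp)
  moreover have "Re (deriv L s / L s) = Re (deriv xi s / xi s) - ln (real q / pi) / 2 - Re (Digamma ((s + 1) / 2)) / 2"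
    using logderiv_L[of s] s nz by simp
  ultimately show ?thesis using assms(3) by argo
qed

theorem L_deriv_equivalence:
  assumes q: "q \<ge> 23"
  shows "(\<forall>s. 0 < Re s \<and> Re s < 1/2 \<longrightarrow> L s \<noteq> 0) \<longleftrightarrow> (\<forall>s. 0 < Re s \<and> Re s < 1/2 \<longrightarrow> deriv L s \<noteq> 0)"
proof -
  define c where "c = (ln (real q / pi) + Digamma (1/2)) / 2"
  have "ln (23 / pi) \<le> ln (real q / pi)"
    using q by (subst ln_le_cancel_iff) (auto intro!: divide_right_mono)
  hence c: "c > 0" using Digamma_one_half_bound unfolding c_def by argo
  show ?thesis
  proof (intro iffI allI impI)
    fix s assume L: "\<forall>s. 0 < Re s \<and> Re s < 1/2 \<longrightarrow> L s \<noteq> 0" and s: "0 < Re s \<and> Re s < 1/2"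
    \<comment> \<open>A zero in the right half of the strip is reflected into the left half, which
      assumption (i) excludes; zeros on the lines Re s = 0 and Re s = 1 are excluded
      unconditionally.\<close>
    have half: "Re \<rho> = 1/2" if "xi \<rho> = 0" for \<rho>
    proof (rule ccontr)
      assume "Re \<rho> \<noteq> 1/2"
      moreover have "\<not> (0 < Re z \<and> Re z < 1/2)" if "xi z = 0" for z
        using L that xi_eq_0_iff[of z] by force
      from this[of \<rho>] this[of "1 - cnj \<rho>"] have "\<not> (0 < Re \<rho> \<and> Re \<rho> < 1/2)" "\<not> (1/2 < Re \<rho> \<and> Re \<rho> < 1)"
        using that xi_reflect_eq_0_iff[of \<rho>] by auto
      ultimately show False using xi_zero_strip[OF that] by force
    qed
    have nz: "L s \<noteq> 0" using L s by blast
    have "Re (deriv xi s / xi s) \<le> 0"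
      by (rule Re_logderiv_xi_nonpos) (use nz s xi_eq_0_iff[of s] half in force)+
    hence "Re (deriv L s / L s) \<le> - c"
      unfolding c_def using s nz by (intro Re_logderiv_L_le) auto
    thus "deriv L s \<noteq> 0" using c by auto
  next
    fix s assume dL: "\<forall>s. 0 < Re s \<and> Re s < 1/2 \<longrightarrow> deriv L s \<noteq> 0" and s: "0 < Re s \<and> Re s < 1/2"
    have L3: "L 3 \<noteq> 0" using xi_3_nonzero xi_eq_0_iff[of 3] by simp
    show "L s \<noteq> 0"
    proof (rule deriv_zero_free_imp_zero_free[OF holomorphic_L growth_L L3 _ _ c])
      fix z assume z: "Re z = 0 \<or> Re z = 1/2" "L z \<noteq> 0"
      have xz: "xi z \<noteq> 0" using z xi_eq_0_iff[of z] by auto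
      have "Re (deriv xi z / xi z) \<le> 0"
      proof (cases "Re z = 0")
        case True
        show ?thesis
          by (rule Re_logderiv_xi_nonpos[OF xz]) (use xi_zero_strip True in force)
      next
        case False
        hence "1 - cnj z = z" using z by (simp add: complex_eq_iff)
        thus ?thesis using Re_logderiv_xi_reflect[of z] by simp
      qed
      thus "Re (deriv L z / L z) \<le> - c"
        unfolding c_def using z by (intro Re_logderiv_L_le) auto
    qed (use dL s in auto)
  qed
qed

end

theorem theorem8:
  fixes q :: nat and chi :: "int \<Rightarrow> complex"
  assumes "primitive_character q chi"
    and "odd_character chi"
    and "q \<ge> 23"
  shows "(\<forall>s. 0 < Re s \<and> Re s < 1/2 \<longrightarrow> dirichlet_L chi s \<noteq> 0) \<longleftrightarrow>
         (\<forall>s. 0 < Re s \<and> Re s < 1/2 \<longrightarrow> deriv (dirichlet_L chi) s \<noteq> 0)"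
proof -
  interpret odd_primitive q chi
    using assms by unfold_locales (auto simp: primitive_character_def odd_character_def)
  show ?thesis
    unfolding dirichlet_L_eq by (rule L_deriv_equivalence[OF assms(3)])
qed

end
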